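(* Let $\mathbb{F}=\mathbb{R}$ or $\mathbb{F}=\mathbb{C}$, and set $\alpha=1$ if $\mathbb{F}=\mathbb{R}$, $\alpha=0$ if $\mathbb{F}=\mathbb{C}$. Let $A\in\mathbb{F}^{m\times n}$ be a fixed matrix, let $r$ be a target rank with $1\le r\le\min\{m,n\}$, and let $k,\ell$ be integers with $k\le n$, $\ell\le m$, $k>r+\alpha$ and $\ell>k+\alpha$. Draw $\Omega\in\mathbb{F}^{n\times k}$ and $\Psi\in\mathbb{F}^{\ell\times m}$ independently from the standard normal distribution over $\mathbb{F}$. Let $\hat A=QX$ be the rank-$k$ approximation of $A$ computed from the sketch $(A\Omega,\Psi A)$, as defined in the context, and let $[\![\hat A]\!]_r=Q[\![X]\!]_r$ be the resulting rank-$r$ approximation. Then $$ \mathbb{E}\,\|A-[\![\hat A]\!]_r\|_{\mathrm F}\;\le\;\tau_{r+1}(A)+2\sqrt{1+f(k,\ell)}\cdot\min_{\varrho<k-\alpha}\sqrt{1+f(\varrho,k)}\cdot\tau_{\varrho+1}(A), $$ where the index $\varrho$ ranges over natural numbers $\varrho\ge1$ with $\varrho<k-\alpha$.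
   Context: Standard normal matrices: a real standard normal matrix has independent $N(0,1)$ entries; a complex standard normal matrix is $G_1+\mathrm{i}G_2$ with $G_1,G_2$ independent real standard normal matrices. $f(s,t):=s/(t-s-\alpha)$ for integers with $t>s+\alpha>\alpha$. Tail energy: $\tau_j(A)\ge0$ with $\tau_j^2(A):=\min_{\operatorname{rank}(B)<j}\|A-B\|_{\mathrm F}^2=\sum_{i\ge j}\sigma_i^2(A)$, where $\sigma_i(A)$ is the $i$th largest singular value (zero for $i>\min\{m,n\}$) and $\|\cdot\|_{\mathrm F}$ is the Frobenius norm. $[\![M]\!]_r$ denotes a best approximation of $M$ in Frobenius norm among matrices of rank at most $r$ (possibly non-unique; a fixed measurable selection is used, e.g. by truncating a singular value decomposition). When $Q$ has orthonormal columns, $Q[\![X]\!]_r$ is a best rank-$r$ approximation of $QX$. The approximation: form $Y:=A\Omega\in\mathbb{F}^{m\times k}$ and $W:=\Psi A\in\mathbb{F}^{\ell\times n}$. Compute an orthogonal--triangular (QR) factorization $Y=QR$, where $Q\in\mathbb{F}^{m\times k}$ has orthonormal columns; $Q$ is obtained from $Y$ by a fixed (measurable) procedure, so it is a function of $\Omega$ only (for fixed $A$). Set $X:=(\Psi Q)^\dagger W\in\mathbb{F}^{k\times n}$, where $\dagger$ is the Moore--Penrose pseudoinverse, and $\hat A:=QX$. $\mathbb{E}$ is expectation over both $\Omega$ and $\Psi$. *)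

theory Defs
  imports "HOL-Probability.Probability" "Jordan_Normal_Form.Conjugate"
begin

text \<open>
  An \<open>m \<times> n\<close> matrix over \<open>\<real>\<close> or \<open>\<complex>\<close> is an element of \<open>'a^'n^'m\<close>, with the dimensions given by the
  cardinalities of the index types.  On this type \<^const>\<open>norm\<close> is the Frobenius norm:
\<close>

lemma norm_matrix_eq_frobenius:
  fixes A :: "'a::real_normed_vector^'n^'m"
  shows "norm A = sqrt (\<Sum>i\<in>UNIV. \<Sum>j\<in>UNIV. (norm (A $ i $ j))\<^sup>2)"
  by (simp add: norm_vec_def L2_set_def sum_nonneg)

text \<open>\<^const>\<open>conjugate\<close> is the identity on \<^typ>\<open>real\<close> and \<^const>\<open>cnj\<close> on \<^typ>\<open>complex\<close>.\<close>

definition adjoint_matrix :: "'a::conjugate^'n^'m \<Rightarrow> 'a^'m^'n" where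
  "adjoint_matrix A = (\<chi> i j. conjugate (A $ j $ i))"

text \<open>The four Penrose conditions, which have exactly one solution for every real or complex matrix.\<close>

definition is_pseudoinverse :: "'a::conjugatable_field^'n^'m \<Rightarrow> 'a^'m^'n \<Rightarrow> bool" where
  "is_pseudoinverse A X \<longleftrightarrow>
     A ** X ** A = A \<and> X ** A ** X = X \<and>
     adjoint_matrix (A ** X) = A ** X \<and> adjoint_matrix (X ** A) = X ** A"

definition pseudoinverse :: "'a::conjugatable_field^'n^'m \<Rightarrow> 'a^'m^'n" where
  "pseudoinverse A = (THE X. is_pseudoinverse A X)"

definition orthonormal_columns :: "'a::conjugatable_field^'n^'m \<Rightarrow> bool" where
  "orthonormal_columns Q \<longleftrightarrow> adjoint_matrix Q ** Q = mat 1"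

definition upper_triangular :: "'a::zero^('k::{finite,linorder})^('k::{finite,linorder}) \<Rightarrow> bool" where
  "upper_triangular R \<longleftrightarrow> (\<forall>i j. j < i \<longrightarrow> R $ i $ j = 0)"

definition qr_factorization ::
  "'a::conjugatable_field^('k::{finite,linorder})^'m
     \<Rightarrow> 'a^('k::{finite,linorder})^'m \<Rightarrow> 'a^('k::{finite,linorder})^('k::{finite,linorder}) \<Rightarrow> bool" where
  "qr_factorization Y Q R \<longleftrightarrow> orthonormal_columns Q \<and> upper_triangular R \<and> Y = Q ** R"

definition qr_procedure ::
  "('a::{conjugatable_field,real_normed_field}^('k::{finite,linorder})^'m
     \<Rightarrow> 'a^('k::{finite,linorder})^'m) \<Rightarrow> bool" where
  "qr_procedure qr \<longleftrightarrow> qr \<in> borel_measurable borel \<and> (\<forall>Y. \<exists>R. qr_factorization Y (qr Y) R)"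

definition is_best_rank_approx ::
  "nat \<Rightarrow> 'a::real_normed_field^'n^'m \<Rightarrow> 'a^'n^'m \<Rightarrow> bool" where
  "is_best_rank_approx r M B \<longleftrightarrow>
     rank B \<le> r \<and> (\<forall>C. rank C \<le> r \<longrightarrow> norm (M - B) \<le> norm (M - C))"

definition best_rank_selection ::
  "nat \<Rightarrow> ('a::real_normed_field^'n^'m \<Rightarrow> 'a^'n^'m) \<Rightarrow> bool" where
  "best_rank_selection r T \<longleftrightarrow> T \<in> borel_measurable borel \<and> (\<forall>M. is_best_rank_approx r M (T M))"

text \<open>
  For \<open>j \<ge> 1\<close> the infimum is a minimum, since the matrices of rank less than \<open>j\<close> form a nonempty
  closed set.
\<close>

definition tail_energy :: "nat \<Rightarrow> 'a::real_normed_field^'n^'m \<Rightarrow> real" where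
  "tail_energy j A = sqrt (INF B\<in>{B. rank B < j}. (norm (A - B))\<^sup>2)"

text \<open>
  The parameter \<open>\<alpha>\<close> is 1 over the reals and 0 over the complex numbers; the value is meaningful for
  \<open>t > s + \<alpha> > \<alpha>\<close>.
\<close>

definition sketch_factor :: "nat \<Rightarrow> nat \<Rightarrow> nat \<Rightarrow> real" where
  "sketch_factor \<alpha> s t = real s / (real t - real s - real \<alpha>)"

text \<open>
  The approximation of \<open>A\<close> is \<open>Q X\<close>; since \<open>Q\<close> has orthonormal columns, replacing \<open>X\<close> by a best rank-\<open>r\<close>
  approximation \<open>T X\<close> yields a best rank-\<open>r\<close> approximation \<open>Q (T X)\<close> of it.
\<close>

definition sketch_Q ::
  "('a::{conjugatable_field,real_normed_field}^'k^'m \<Rightarrow> 'a^'k^'m) \<Rightarrow> 'a^'n^'m \<Rightarrow> 'a^'k^'n \<Rightarrow> 'a^'k^'m" where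
  "sketch_Q qr A \<Omega> = qr (A ** \<Omega>)"

definition sketch_X ::
  "('a::{conjugatable_field,real_normed_field}^'k^'m \<Rightarrow> 'a^'k^'m)
     \<Rightarrow> 'a^'n^'m \<Rightarrow> 'a^'k^'n \<Rightarrow> 'a^'m^'l \<Rightarrow> 'a^'n^'k" where
  "sketch_X qr A \<Omega> \<Psi> = pseudoinverse (\<Psi> ** sketch_Q qr A \<Omega>) ** (\<Psi> ** A)"

definition fixed_rank_approx ::
  "('a::{conjugatable_field,real_normed_field}^'k^'m \<Rightarrow> 'a^'k^'m) \<Rightarrow> ('a^'n^'k \<Rightarrow> 'a^'n^'k)
     \<Rightarrow> 'a^'n^'m \<Rightarrow> 'a^'k^'n \<Rightarrow> 'a^'m^'l \<Rightarrow> 'a^'n^'m" where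
  "fixed_rank_approx qr T A \<Omega> \<Psi> = sketch_Q qr A \<Omega> ** T (sketch_X qr A \<Omega> \<Psi>)"

context prob_space
begin

text \<open>\<^const>\<open>indep_var\<close> requires both variables to have the same type; this is its
  characterisation \<open>indep_var_eq\<close>, for Borel random variables of different types.\<close>

definition indep_borel :: "('a \<Rightarrow> 'b::topological_space) \<Rightarrow> ('a \<Rightarrow> 'c::topological_space) \<Rightarrow> bool" where
  "indep_borel X Y \<longleftrightarrow>
     (random_variable borel X \<and> random_variable borel Y) \<and>
     indep_set
       (sigma_sets (space M) {X -` S \<inter> space M |S. S \<in> sets borel})
       (sigma_sets (space M) {Y -` S \<inter> space M |S. S \<in> sets borel})"

definition real_std_normal_matrix :: "('a \<Rightarrow> real^'n^'m) \<Rightarrow> bool" where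
  "real_std_normal_matrix G \<longleftrightarrow>
     indep_vars (\<lambda>_. borel) (\<lambda>(i, j) \<omega>. G \<omega> $ i $ j) UNIV \<and>
     (\<forall>i j. distributed M lborel (\<lambda>\<omega>. G \<omega> $ i $ j) std_normal_density)"

definition complex_std_normal_matrix :: "('a \<Rightarrow> complex^'n^'m) \<Rightarrow> bool" where
  "complex_std_normal_matrix G \<longleftrightarrow>
     (\<exists>G\<^sub>1 G\<^sub>2. real_std_normal_matrix G\<^sub>1 \<and> real_std_normal_matrix G\<^sub>2 \<and> indep_borel G\<^sub>1 G\<^sub>2 \<and>
        (\<forall>\<omega>. G \<omega> = (\<chi> i j. of_real (G\<^sub>1 \<omega> $ i $ j) + \<i> * of_real (G\<^sub>2 \<omega> $ i $ j))))"

end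

end

theory Submission
  imports Defs
begin

text \<open>
  Let \<open>P\<close> be an orthogonal projection with trace \<open>p\<close>, let \<open>x\<close> be an \<open>l \<times> m\<close> standard normal matrix, and
  let \<open>P N = 0\<close>. Both stages of the algorithm reduce to the estimate
  \<open>E \<parallel>(x P)\<^sup>\<dagger> x N\<parallel>\<^sup>2 \<le> p / (l - p - \<alpha>) \<parallel>N\<parallel>\<^sup>2\<close>: for the sketch by \<open>\<Psi>\<close> take \<open>x = \<Psi>\<close>, \<open>P = Q Q\<^sup>*\<close> and
  \<open>N = (I - P) A\<close>; for the range finder take \<open>x = \<Omega>\<^sup>*\<close>, \<open>P\<close> the projection onto the row space of a
  low-rank competitor \<open>B\<close>, and \<open>N = (I - P) A\<^sup>*\<close>.

  The estimate needs neither the inverse Wishart distribution nor rotation invariance. Replace the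
  pseudoinverse of \<open>G = x P\<close> by \<open>(G\<^sup>* G + e I)\<^sup>-\<^sup>1 G\<^sup>*\<close>, which is bounded and smooth in \<open>x\<close>, and put
  \<open>H = (G\<^sup>* G + e I)\<^sup>-\<^sup>1\<close>. Stein's identity \<open>E \<langle>x, F\<rangle> = E div F\<close> applied to \<open>F = G H\<close> bounds the expected
  trace of \<open>P H\<close>. The matrix \<open>H G\<^sup>*\<close> does not change when \<open>x\<close> moves in directions killed by \<open>P\<close>, so
  Stein's identity in those directions also evaluates \<open>E \<parallel>H G\<^sup>* x N\<parallel>\<^sup>2\<close>. Fatou's lemma for \<open>e \<rightarrow> 0\<close>
  gives the estimate, and also shows that \<open>(x P)\<^sup>\<dagger> x P = P\<close> almost surely.
\<close>

section \<open>Matrices over the real or complex numbers\<close>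

text \<open>The regularisation is forced: the pseudoinverse is neither bounded nor continuous where
  the rank drops, whereas Stein's identity needs a field that is Lipschitz along the direction of
  differentiation.

  The denominator \<open>l - p - \<alpha>\<close> comes from the divergence of \<open>F\<close>.
  Write \<open>c\<close> for the real dimension of the field and \<tau> for the trace of
  \<open>P H\<close>. The divergence of \<open>G H\<close> consists of \<open>c l \<tau>\<close>
  from the factor \<open>G\<close> and of \<open>- c (p - e \<tau>) \<tau> - (2 - c) |G H|^2\<close>
  from the resolvent, the last term being due to the conjugate-linear part of the derivative. As
  \<open>|G H|^2 \<le> \<tau>\<close> and \<open>\<langle>x, F\<rangle> = p - e \<tau>\<close>, the
  mean of \<tau> is at most \<open>p / (c (l - p) - (2 - c))\<close>. The second use of Stein's
  identity gives back a factor \<open>c\<close>, and \<open>2 - c = c \<alpha>\<close> turns the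
  quotient into \<open>p / (l - p - \<alpha>)\<close>.

  The constants of the two stages multiply, because \<Psi> is integrated first with \<open>Q\<close>
  held fixed. Jensen's inequality leads from the second moment to the mean, and the factor 2 of the
  theorem is the price of the triangle inequality when \<open>Q X\<close> is truncated to rank
  \<open>r\<close>.\<close>

text \<open>
  The sum in \<open>sum_Basis_conjugate\<close> vanishes over the complex numbers. It is the only place where the two fields differ, and
  it is the origin of \<open>\<alpha>\<close>.
\<close>

class real_or_complex = conjugatable_field + real_normed_field + euclidean_space +
  assumes inner_mult_left: "inner (x * y) z = inner y (conjugate x * z)"
    and inner_conjugate: "inner (conjugate x) (conjugate y) = inner x y"
    and mult_conjugate_scaleR: "x * conjugate x = inner x x *\<^sub>R 1"
    and sum_Basis_mult: "(\<Sum>b\<in>Basis. inner b (x * b * y)) = real DIM('a) * inner 1 (x * y)"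
    and sum_Basis_conjugate:
      "(\<Sum>b\<in>Basis. inner b (x * conjugate b * y)) = (2 - real DIM('a)) * inner x y"
    and DIM_le_2: "DIM('a) \<le> 2"

instance real :: real_or_complex
  by intro_classes (auto simp: algebra_simps)

instance complex :: real_or_complex
  by intro_classes
    (auto simp: inner_complex_def Basis_complex_def complex_eq_iff algebra_simps power2_eq_square)

lemma mult_conjugate_self: "x * conjugate x = of_real (inner x x)" for x :: "'a::real_or_complex"
  by (simp add: mult_conjugate_scaleR of_real_def)

lemma conjugate_1 [simp]: "conjugate (1::'a::real_or_complex) = 1"
proof -
  have "conjugate (1::'a) * conjugate 1 = conjugate 1 * 1"
    by (metis conjugate_dist_mul mult.right_neutral)
  moreover have "conjugate (1::'a) \<noteq> 0" by simp
  ultimately show ?thesis by (metis mult_left_cancel)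
qed

lemma inner_1_1 [simp]: "inner (1::'a::real_or_complex) 1 = 1"
  by (simp add: dot_square_norm)

text \<open>A self-conjugate \<open>z\<close> satisfies \<open>z * z = |z|^2\<close>, and in a field
  the only square roots of that are the real elements \<open>|z|\<close> and
  \<open>- |z|\<close>.\<close>

lemma conjugate_eq_self_imp_real:
  fixes z :: "'a::real_or_complex"
  assumes "conjugate z = z" shows "z = of_real (inner 1 z)"
proof -
  have "z * z = of_real (norm z) * of_real (norm z)"
    using mult_conjugate_self[of z] assms
    by (simp add: dot_square_norm power2_eq_square)
  then have "z = of_real (norm z) \<or> z = - of_real (norm z)"
    by (simp add: square_eq_iff)
  then obtain s where s: "z = of_real s" by (metis of_real_minus)
  then show ?thesis by (simp add: of_real_def)
qed

lemma conjugate_of_real [simp]: "conjugate (of_real r :: 'a::real_or_complex) = of_real r"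
proof (cases "r = 0")
  case False
  have "of_real r * conjugate (of_real r :: 'a) = of_real r * of_real r"
    unfolding mult_conjugate_self by (simp add: of_real_def)
  with False show ?thesis by simp
qed simp

lemma conjugate_scaleR: "conjugate (r *\<^sub>R x :: 'a::real_or_complex) = r *\<^sub>R conjugate x"
  by (simp add: scaleR_conv_of_real conjugate_dist_mul)

lemma sum_Basis_vec:
  "(\<Sum>b\<in>(Basis :: ('a::euclidean_space^'n) set). f b) = (\<Sum>i\<in>UNIV. \<Sum>b\<in>Basis. f (axis i b))"
proof -
  have "(\<Sum>b\<in>(Basis :: ('a^'n) set). f b) = (\<Sum>b\<in>(\<Union>i\<in>UNIV. (axis i) ` (Basis::'a set)). f b)"
    by (rule arg_cong[where f="sum f"]) (auto simp: Basis_vec_def)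
  also have "\<dots> = (\<Sum>i\<in>UNIV. \<Sum>b\<in>axis i ` (Basis::'a set). f b)"
    by (rule sum.UNION_disjoint) (auto simp: axis_eq_axis)
  also have "\<dots> = (\<Sum>i\<in>UNIV. \<Sum>b\<in>Basis. f (axis i b))"
    by (intro sum.cong refl sum.reindex_cong[where l="axis _"]) (auto simp: inj_on_def axis_eq_axis)
  finally show ?thesis .
qed

lemma adjoint_matrix_nth [simp]: "adjoint_matrix A $ i $ j = conjugate (A $ j $ i)"
  by (simp add: adjoint_matrix_def)

lemma adjoint_matrix_adjoint [simp]: "adjoint_matrix (adjoint_matrix A) = A"
  by (simp add: vec_eq_iff)

lemma adjoint_matrix_mult: "adjoint_matrix (A ** B) = adjoint_matrix B ** adjoint_matrix (A::'a::real_or_complex^'n^'m)"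
  by (simp add: vec_eq_iff matrix_matrix_mult_def sum_conjugate conjugate_dist_mul mult.commute)

lemma adjoint_matrix_add: "adjoint_matrix (A + B) = adjoint_matrix A + adjoint_matrix (B::'a::real_or_complex^'n^'m)"
  by (simp add: vec_eq_iff conjugate_dist_add)

lemma adjoint_matrix_minus: "adjoint_matrix (A - B) = adjoint_matrix A - adjoint_matrix (B::'a::real_or_complex^'n^'m)"
  using adjoint_matrix_add[of "A-B" B] by (simp add: algebra_simps)

lemma adjoint_matrix_scaleR: "adjoint_matrix (r *\<^sub>R A) = r *\<^sub>R adjoint_matrix (A::'a::real_or_complex^'n^'m)"
  by (simp add: vec_eq_iff conjugate_scaleR)

lemma adjoint_matrix_mat_1 [simp]: "adjoint_matrix (mat 1) = (mat 1 :: 'a::real_or_complex^'n^'n)"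
  by (simp add: vec_eq_iff mat_def)

lemma adjoint_matrix_0 [simp]: "adjoint_matrix (0::'a::real_or_complex^'n^'m) = 0"
  by (simp add: vec_eq_iff)

lemma inner_adjoint: "inner (adjoint_matrix A) (adjoint_matrix B) = inner A (B::'a::real_or_complex^'n^'m)"
  by (simp add: inner_vec_def inner_conjugate) (rule sum.swap)

lemma norm_adjoint [simp]: "norm (adjoint_matrix (A::'a::real_or_complex^'n^'m)) = norm A"
  by (simp add: norm_eq_sqrt_inner inner_adjoint)

lemma inner_mult_left_matrix:
  "inner (X ** A) B = inner A (adjoint_matrix X ** (B::'a::real_or_complex^'n^'m))"
proof -
  have "inner (X ** A) B = (\<Sum>i\<in>UNIV. \<Sum>j\<in>UNIV. \<Sum>k\<in>UNIV. inner (A$k$j) (conjugate (X$i$k) * B$i$j))"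
    by (simp add: inner_vec_def matrix_matrix_mult_def inner_sum_left inner_mult_left)
  also have "\<dots> = (\<Sum>k\<in>UNIV. \<Sum>j\<in>UNIV. \<Sum>i\<in>UNIV. inner (A$k$j) (conjugate (X$i$k) * B$i$j))"
    by (subst (2) sum.swap, subst sum.swap, subst (2) sum.swap) (rule refl)
  also have "\<dots> = inner A (adjoint_matrix X ** B)"
    by (simp add: inner_vec_def matrix_matrix_mult_def inner_sum_right)
  finally show ?thesis .
qed

lemma inner_mult_right_matrix:
  "inner (A ** X) B = inner A ((B::'a::real_or_complex^'n^'m) ** adjoint_matrix X)"
proof -
  have "inner (A ** X) B = inner (adjoint_matrix X ** adjoint_matrix A) (adjoint_matrix B)"
    by (simp add: adjoint_matrix_mult[symmetric] inner_adjoint)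
  also have "\<dots> = inner (adjoint_matrix A) (adjoint_matrix (B ** adjoint_matrix X))"
    by (simp add: inner_mult_left_matrix adjoint_matrix_mult)
  finally show ?thesis by (simp add: inner_adjoint)
qed

lemma scaleR_matrix_mult: "(r *\<^sub>R A) ** B = r *\<^sub>R (A ** (B::'a::real_or_complex^'n^'k))"
  by (simp add: vec_eq_iff matrix_matrix_mult_def scaleR_sum_right)

lemma matrix_mult_scaleR: "A ** (r *\<^sub>R B) = r *\<^sub>R (A ** (B::'a::real_or_complex^'n^'k))"
  by (simp add: vec_eq_iff matrix_matrix_mult_def scaleR_sum_right)

lemma matrix_diff_ldistrib: "A ** (B - C) = A ** B - A ** (C::'a::real_or_complex^'n^'k)"
  by (metis add_diff_cancel_right' diff_add_cancel matrix_add_ldistrib)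

lemma matrix_diff_rdistrib: "(A - B) ** C = A ** C - B ** (C::'a::real_or_complex^'n^'k)"
  by (simp add: vec_eq_iff matrix_matrix_mult_def algebra_simps sum_subtractf)

lemma norm_matrix_mult: "norm (A ** B) \<le> norm A * norm (B::'a::real_or_complex^'n^'k)"
proof -
  let ?a = "\<lambda>i k. norm (A$i$k)" and ?b = "\<lambda>k j. norm (B$k$j)"
  have 1: "norm (\<Sum>k\<in>UNIV. A$i$k * B$k$j) ^ 2 \<le> (\<Sum>k\<in>UNIV. (?a i k)\<^sup>2) * (\<Sum>k\<in>UNIV. (?b k j)\<^sup>2)" for i j
  proof -
    have "norm (\<Sum>k\<in>UNIV. A$i$k * B$k$j) \<le> (\<Sum>k\<in>UNIV. ?a i k * ?b k j)"
      by (rule sum_norm_le) (simp add: norm_mult)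
    then have "norm (\<Sum>k\<in>UNIV. A$i$k * B$k$j) ^ 2 \<le> (\<Sum>k\<in>UNIV. ?a i k * ?b k j) ^ 2"
      by (rule power_mono) simp
    also have "\<dots> \<le> (\<Sum>k\<in>UNIV. (?a i k)\<^sup>2) * (\<Sum>k\<in>UNIV. (?b k j)\<^sup>2)"
      by (rule Cauchy_Schwarz_ineq_sum)
    finally show ?thesis .
  qed
  have nn: "norm M ^ 2 = (\<Sum>i\<in>UNIV. \<Sum>j\<in>UNIV. (norm (M $ i $ j))\<^sup>2)" for M :: "'a^'x^'y"
    by (simp add: norm_matrix_eq_frobenius sum_nonneg)
  have "norm (A ** B) ^ 2 \<le> (\<Sum>i\<in>UNIV. \<Sum>j\<in>UNIV. (\<Sum>k\<in>UNIV. (?a i k)\<^sup>2) * (\<Sum>k\<in>UNIV. (?b k j)\<^sup>2))"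
    unfolding nn by (intro sum_mono) (simp add: matrix_matrix_mult_def 1)
  also have "\<dots> = (\<Sum>i\<in>UNIV. \<Sum>k\<in>UNIV. (?a i k)\<^sup>2) * (\<Sum>j\<in>UNIV. \<Sum>k\<in>UNIV. (?b k j)\<^sup>2)"
    by (simp add: sum_product)
  also have "(\<Sum>j\<in>UNIV. \<Sum>k\<in>UNIV. (?b k j)\<^sup>2) = norm B ^ 2"
    unfolding nn by (rule sum.swap)
  also have "(\<Sum>i\<in>UNIV. \<Sum>k\<in>UNIV. (?a i k)\<^sup>2) = norm A ^ 2" unfolding nn ..
  finally show ?thesis
    by (metis mult_nonneg_nonneg norm_ge_zero power2_le_imp_le power_mult_distrib)
qed

text \<open>The sum is the trace of the real-linear map \<open>D \<mapsto> X ** D ** Y\<close>, and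
  \<open>inner (mat 1)\<close> is the real part of the matrix trace. Entrywise one finds the real
  part of a product of two matrix traces; it splits because a self-adjoint \<open>X\<close> has real
  trace.\<close>

lemma sum_Basis_mult_matrix:
  fixes X :: "'a::real_or_complex^'m^'m" and Y :: "'a^'n^'n"
  assumes "adjoint_matrix X = X"
  shows "(\<Sum>D\<in>Basis. inner D (X ** D ** Y)) = real DIM('a) * inner (mat 1) X * inner (mat 1) Y"
proof -
  have e: "(X ** axis i (axis j b) ** Y) $ i $ j = X$i$i * b * Y$j$j" for i j b
  proof -
    have "(X ** axis i (axis j b)) $ i $ k = X$i$i * (if k = j then b else 0)" for k
      by (simp add: matrix_matrix_mult_def axis_def if_distrib[where f="\<lambda>x. x $ k"] if_distrib[where f="(*) _"] cong: if_cong)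
    then show ?thesis
      by (simp add: matrix_matrix_mult_def[of "X ** _"] if_distrib[where f="(*) _"] if_distrib[where f="\<lambda>x. x * _"] cong: if_cong)
  qed
  have tr: "inner (mat 1) Z = inner 1 (\<Sum>i\<in>UNIV. Z$i$i)" for Z :: "'a^'k^'k"
    by (simp add: inner_vec_def mat_def if_distrib[where f="\<lambda>x. inner x _"] inner_sum_right cong: if_cong)
  have "(\<Sum>D\<in>Basis. inner D (X ** D ** Y)) = (\<Sum>i\<in>UNIV. \<Sum>j\<in>UNIV. \<Sum>b\<in>Basis. inner b (X$i$i * b * Y$j$j))"
    by (simp add: sum_Basis_vec inner_axis' e)
  also have "\<dots> = real DIM('a) * inner 1 ((\<Sum>i\<in>UNIV. X$i$i) * (\<Sum>j\<in>UNIV. Y$j$j))"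
    by (simp only: sum_Basis_mult sum_product inner_sum_right) (simp only: sum_distrib_left)
  also have "(\<Sum>i\<in>UNIV. X$i$i) = of_real (inner (mat 1) X)"
  proof -
    have "conjugate (X$i$i) = X$i$i" for i using assms by (metis adjoint_matrix_nth)
    then have "conjugate (\<Sum>i\<in>UNIV. X$i$i) = (\<Sum>i\<in>UNIV. X$i$i)" by (simp add: sum_conjugate)
    then show ?thesis unfolding tr by (rule conjugate_eq_self_imp_real)
  qed
  also have "inner 1 (of_real (inner (mat 1) X) * (\<Sum>j\<in>UNIV. Y$j$j)) = inner (mat 1) X * inner (mat 1) Y"
    by (simp only: tr[of Y] scaleR_conv_of_real[symmetric] inner_scaleR_right)
  finally show ?thesis by simp
qed

text \<open>The map \<open>D \<mapsto> X ** adjoint_matrix D ** Y\<close> is conjugate-linear. Over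
  the complex numbers the basis elements \<open>1\<close> and \<open>\<i>\<close> of an entry
  contribute opposite amounts to its trace, hence the factor 0 there.\<close>

lemma sum_Basis_adjoint_matrix:
  fixes X Y :: "'a::real_or_complex^'n^'m"
  shows "(\<Sum>D\<in>Basis. inner D (X ** adjoint_matrix D ** Y)) = (2 - real DIM('a)) * inner X Y"
proof -
  have e: "(X ** adjoint_matrix (axis i (axis j b)) ** Y) $ i $ j = X$i$j * conjugate b * Y$i$j" for i j b
  proof -
    have "(X ** adjoint_matrix (axis i (axis j b))) $ i $ k = (if k = i then X$i$j * conjugate b else 0)" for k
      by (auto simp add: matrix_matrix_mult_def axis_def if_distrib[where f="\<lambda>x. x $ _"] if_distrib[where f="(*) _"] if_distrib[where f=conjugate] cong: if_cong)
    then show ?thesis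
      by (simp add: matrix_matrix_mult_def[of "X ** _"] if_distrib[where f="(*) _"] if_distrib[where f="\<lambda>x. x * _"] cong: if_cong)
  qed
  have "(\<Sum>D\<in>Basis. inner D (X ** adjoint_matrix D ** Y)) = (\<Sum>i\<in>UNIV. \<Sum>j\<in>UNIV. \<Sum>b\<in>Basis. inner b (X$i$j * conjugate b * Y$i$j))"
    by (simp add: sum_Basis_vec inner_axis' e)
  also have "\<dots> = (2 - real DIM('a)) * inner X Y"
    by (simp add: sum_Basis_conjugate sum_distrib_left[symmetric] inner_vec_def)
  finally show ?thesis .
qed

lemma inner_mat_1: "inner (mat 1) (adjoint_matrix A ** B) = inner A (B::'a::real_or_complex^'n^'m)"
  by (metis adjoint_matrix_adjoint inner_mult_left_matrix matrix_mul_rid)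

lemma norm_sq_matrix: "inner (mat 1) (adjoint_matrix A ** A) = norm (A::'a::real_or_complex^'n^'m) ^ 2"
  by (simp add: inner_mat_1 dot_square_norm)

lemma matrix_add_rdistrib: "(A + B) ** C = A ** C + B ** (C::'a::semiring_1^'n^'k)"
  by (simp add: vec_eq_iff matrix_matrix_mult_def distrib_right sum.distrib)

lemma matrix_mult_minus_right: "C ** (- A) = - (C ** (A::'a::ring_1^'n^'m))"
  by (simp add: vec_eq_iff matrix_matrix_mult_def sum_negf)

section \<open>Regularised inverses and the pseudoinverse\<close>

text \<open>The resolvent of the Gram matrix of \<open>G\<close> at \<open>- e\<close>, meaningful
  for \<open>e > 0\<close>; \<open>resolvent e G ** adjoint_matrix G\<close> is the
  Tikhonov-regularised pseudoinverse.\<close>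

definition resolvent :: "real \<Rightarrow> 'a::real_or_complex^'m^'l \<Rightarrow> 'a^'m^'m" where
  "resolvent e G = matrix_inv (adjoint_matrix G ** G + e *\<^sub>R mat 1)"

text \<open>Positivity of the shifted Gram matrix in quantitative form: for \<open>e > 0\<close> its
  invertibility and the bounds on the resolvent come from this identity.\<close>

lemma inner_gram_shift:
  "inner X ((adjoint_matrix G ** G + e *\<^sub>R mat 1) ** X) = norm (G ** X) ^ 2 + e * norm (X::'a::real_or_complex^'n^'m) ^ 2"
proof -
  have "inner X (adjoint_matrix G ** G ** X) = norm (G ** X) ^ 2"
    by (metis dot_square_norm inner_mult_left_matrix matrix_mul_assoc)
  then show ?thesis
    by (simp add: matrix_add_rdistrib inner_add_right scaleR_matrix_mult matrix_mul_lid dot_square_norm)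
qed

lemma resolvent_inverse:
  fixes G :: "'a::real_or_complex^'m^'l"
  assumes e: "e > 0"
  shows resolvent_right: "(adjoint_matrix G ** G + e *\<^sub>R mat 1) ** resolvent e G = mat 1"
    and resolvent_left: "resolvent e G ** (adjoint_matrix G ** G + e *\<^sub>R mat 1) = mat 1"
proof -
  let ?S = "adjoint_matrix G ** G + e *\<^sub>R mat 1"
  have "x = 0" if x: "?S *v x = 0" for x
  proof -
    \<comment> \<open>The vector becomes a one-column matrix, so that the identity for matrices
      applies to it.\<close>
    define X :: "'a^1^'m" where "X = (\<chi> i j. x $ i)"
    have "(?S ** X) $ i $ j = (?S *v x) $ i" for i j
      by (simp add: matrix_matrix_mult_def matrix_vector_mult_def X_def)
    then have "?S ** X = 0" using x by (simp add: vec_eq_iff)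
    then have "norm (G ** X) ^ 2 + e * norm X ^ 2 = 0"
      using inner_gram_shift[of X G e] by simp
    then have "e * norm X ^ 2 = 0" using e
      by (smt (verit) mult_nonneg_nonneg zero_le_power2)
    then have "X = 0" using e by simp
    then show "x = 0" by (simp add: X_def vec_eq_iff)
  qed
  then have "\<exists>B. B ** ?S = mat 1"
    by (simp add: matrix_left_invertible_ker)
  then have "invertible ?S" by (simp add: invertible_left_inverse)
  then have "\<exists>B. ?S ** B = mat 1 \<and> B ** ?S = mat 1"
    by (simp add: invertible_def)
  then have "?S ** matrix_inv ?S = mat 1 \<and> matrix_inv ?S ** ?S = mat 1"
    unfolding matrix_inv_def by (rule someI_ex)
  then show "?S ** resolvent e G = mat 1" "resolvent e G ** ?S = mat 1"
    by (auto simp: resolvent_def)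
qed

lemma gram_mult_resolvent:
  assumes "e > 0"
  shows "adjoint_matrix G ** G ** resolvent e G = mat 1 - e *\<^sub>R resolvent e G"
  using resolvent_right[OF assms, of G]
  by (simp add: matrix_add_rdistrib scaleR_matrix_mult matrix_mul_lid algebra_simps)

lemma resolvent_mult_gram:
  assumes "e > 0"
  shows "resolvent e G ** (adjoint_matrix G ** G) = mat 1 - e *\<^sub>R resolvent e G"
  using resolvent_left[OF assms, of G]
  by (simp add: matrix_add_ldistrib matrix_mult_scaleR matrix_mul_rid algebra_simps)

lemma adjoint_resolvent:
  fixes G :: "'a::real_or_complex^'m^'l"
  assumes "e > 0"
  shows "adjoint_matrix (resolvent e G) = resolvent e G"
proof -
  let ?S = "adjoint_matrix G ** G + e *\<^sub>R mat 1"
  have S: "adjoint_matrix ?S = ?S"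
    by (simp add: adjoint_matrix_add adjoint_matrix_mult adjoint_matrix_scaleR)
  have "adjoint_matrix (resolvent e G) ** ?S = mat 1"
    using arg_cong[OF resolvent_right[OF assms, of G], of adjoint_matrix]
    by (simp only: adjoint_matrix_mult S adjoint_matrix_mat_1)
  then show ?thesis
    by (metis resolvent_right[OF assms] matrix_mul_assoc matrix_mul_lid matrix_mul_rid)
qed

text \<open>With \<open>X = resolvent e G ** Z\<close> the left side of
  \<open>inner_gram_shift\<close> is \<open>inner X Z\<close>. Dropping one of the two squares and
  applying Cauchy-Schwarz gives the bounds; their constants involve neither \<open>G\<close> nor the
  dimension.\<close>

lemma norm_resolvent_mult:
  fixes G :: "'a::real_or_complex^'m^'l"
  assumes e: "e > 0"
  shows "e * norm (resolvent e G ** X) \<le> norm X"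
    and "norm (G ** resolvent e G ** (adjoint_matrix G ** Y)) \<le> norm Y"
proof -
  have *: "norm (G ** (resolvent e G ** Z)) ^ 2 + e * norm (resolvent e G ** Z) ^ 2 = inner (resolvent e G ** Z) Z"
    for Z :: "'a^'z^'m"
    unfolding inner_gram_shift[symmetric]
    by (simp add: matrix_mul_assoc resolvent_right[OF e] matrix_mul_lid)
  let ?Y = "resolvent e G ** X"
  have "e * norm ?Y ^ 2 \<le> inner ?Y X"
    using *[of X] by (smt (verit) zero_le_power2)
  also have "\<dots> \<le> norm ?Y * norm X" by (rule norm_cauchy_schwarz)
  finally show "e * norm ?Y \<le> norm X"
    by (cases "norm ?Y = 0") (auto simp: power2_eq_square algebra_simps)
  let ?Z = "resolvent e G ** (adjoint_matrix G ** Y)"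
  have "norm (G ** ?Z) ^ 2 \<le> inner ?Z (adjoint_matrix G ** Y)"
    using *[of "adjoint_matrix G ** Y"] e by (smt (verit) mult_nonneg_nonneg zero_le_power2)
  also have "\<dots> = inner (G ** ?Z) Y" by (simp add: inner_mult_left_matrix)
  also have "\<dots> \<le> norm (G ** ?Z) * norm Y" by (rule norm_cauchy_schwarz)
  finally show "norm (G ** resolvent e G ** (adjoint_matrix G ** Y)) \<le> norm Y"
    unfolding matrix_mul_assoc[symmetric]
    by (cases "norm (G ** ?Z) = 0") (auto simp: power2_eq_square)
qed

lemma norm_mult_resolvent:
  fixes G :: "'a::real_or_complex^'m^'l"
  assumes e: "e > 0"
  shows "norm (resolvent e G) \<le> norm (mat 1 :: 'a^'m^'m) / e"
    and "norm (G ** resolvent e G) \<le> norm (mat 1 :: 'a^'m^'m) / sqrt e"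
proof -
  let ?I = "mat 1 :: 'a^'m^'m"
  show 1: "norm (resolvent e G) \<le> norm ?I / e"
    using norm_resolvent_mult(1)[OF e, of G ?I] e by (simp add: matrix_mul_rid field_simps)
  have "norm (G ** resolvent e G) ^ 2 + e * norm (resolvent e G) ^ 2 = inner (resolvent e G) ?I"
    unfolding inner_gram_shift[symmetric] by (simp add: resolvent_right[OF e])
  then have "norm (G ** resolvent e G) ^ 2 \<le> inner (resolvent e G) ?I"
    using e by (smt (verit) mult_nonneg_nonneg zero_le_power2)
  also have "\<dots> \<le> norm (resolvent e G) * norm ?I" by (rule norm_cauchy_schwarz)
  also have "\<dots> \<le> norm ?I / e * norm ?I" using 1 by (rule mult_right_mono) simp
  also have "\<dots> = (norm ?I / sqrt e) ^ 2" using e by (simp add: power_divide power2_eq_square)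
  finally show "norm (G ** resolvent e G) \<le> norm ?I / sqrt e"
    using e by (intro power2_le_imp_le[of "norm (G ** resolvent e G)"]) auto
qed

text \<open>The second resolvent identity \<open>H' - H = H (S - S') H'\<close> for the shifted Gram
  matrices. \<open>S - S'\<close> is split so that, apart from the increment \<open>G' - G\<close>,
  the matrices \<open>G\<close> and \<open>G'\<close> occur only in \<open>G' ** H'\<close>,
  \<open>G ** H\<close> and \<open>G ** H ** adjoint_matrix G\<close>, all bounded independently of
  \<open>G\<close>. Being exact, the formulas yield Lipschitz bounds and derivatives alike.\<close>

lemma resolvent_diff:
  fixes G G' :: "'a::real_or_complex^'m^'l"
  assumes e: "e > 0"
  defines "H \<equiv> resolvent e G" and "H' \<equiv> resolvent e G'"
  shows "H' - H = - (H ** adjoint_matrix (G' - G) ** (G' ** H') + adjoint_matrix (G ** H) ** (G' - G) ** H')"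
    and "G' ** H' - G ** H = (G' - G) ** H' - G ** H ** adjoint_matrix (G' - G) ** (G' ** H')
           - G ** H ** adjoint_matrix G ** ((G' - G) ** H')"
proof -
  let ?S = "adjoint_matrix G ** G + e *\<^sub>R mat 1" and ?S' = "adjoint_matrix G' ** G' + e *\<^sub>R mat 1"
  have S: "?S - ?S' = - (adjoint_matrix (G' - G) ** G' + adjoint_matrix G ** (G' - G))"
    by (simp add: adjoint_matrix_minus matrix_diff_ldistrib matrix_diff_rdistrib)
  have "H' - H = H ** ?S ** H' - H ** (?S' ** H')"
    by (simp only: H_def H'_def resolvent_right[OF e] resolvent_left[OF e] matrix_mul_lid matrix_mul_rid)
  also have "\<dots> = H ** (?S - ?S') ** H'"
    by (simp only: matrix_diff_ldistrib matrix_diff_rdistrib matrix_mul_assoc)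
  also have "\<dots> = - (H ** adjoint_matrix (G' - G) ** (G' ** H') + H ** adjoint_matrix G ** (G' - G) ** H')"
    unfolding S minus_add_distrib
    by (simp add: matrix_diff_ldistrib matrix_diff_rdistrib matrix_mul_assoc)
  finally have *: "H' - H = \<dots>" .
  have H: "adjoint_matrix H = H" using adjoint_resolvent[OF e] by (simp add: H_def)
  show "H' - H = - (H ** adjoint_matrix (G' - G) ** (G' ** H') + adjoint_matrix (G ** H) ** (G' - G) ** H')"
    by (simp only: * adjoint_matrix_mult H)
  have "G' ** H' - G ** H = (G' - G) ** H' + G ** (H' - H)"
    by (simp add: matrix_diff_ldistrib matrix_diff_rdistrib)
  also have "G ** (H' - H) = - (G ** H ** adjoint_matrix (G' - G) ** (G' ** H') + G ** H ** adjoint_matrix G ** ((G' - G) ** H'))"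
    unfolding * matrix_mult_minus_right by (simp only: matrix_add_ldistrib matrix_mul_assoc)
  finally show "G' ** H' - G ** H = (G' - G) ** H' - G ** H ** adjoint_matrix (G' - G) ** (G' ** H')
           - G ** H ** adjoint_matrix G ** ((G' - G) ** H')" by simp
qed

text \<open>The constants depend on \<open>e\<close> and the dimension only. The first bound makes
  the resolvent continuous, hence measurable; the second is the Lipschitz hypothesis of Stein's
  identity for the field \<open>G ** H\<close>.\<close>

lemma resolvent_lipschitz:
  fixes G G' :: "'a::real_or_complex^'m^'l"
  assumes e: "e > 0"
  defines "c \<equiv> norm (mat 1 :: 'a^'m^'m)"
  shows "norm (resolvent e G' - resolvent e G) \<le> 2 * (c / e) * (c / sqrt e) * norm (G' - G)"
    and "norm (G' ** resolvent e G' - G ** resolvent e G) \<le> (2 * (c / e) + (c / sqrt e)\<^sup>2) * norm (G' - G)"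
proof -
  let ?H = "resolvent e G" and ?H' = "resolvent e G'" and ?D = "G' - G"
  have c: "c / e \<ge> 0" "c / sqrt e \<ge> 0" using e by (auto simp: c_def)
  note b = norm_mult_resolvent[OF e, where ?'a='a and ?'m='m, folded c_def]
  have 1: "norm (?H ** adjoint_matrix ?D ** (G' ** ?H')) \<le> (c / e) * norm ?D * (c / sqrt e)"
    by (intro order_trans[OF norm_matrix_mult] mult_mono b mult_nonneg_nonneg norm_ge_zero c
          order_trans[OF norm_matrix_mult order_trans[OF mult_right_mono]]) (auto simp: b)
  have 2: "norm (adjoint_matrix (G ** ?H) ** ?D ** ?H') \<le> (c / sqrt e) * norm ?D * (c / e)"
    by (intro order_trans[OF norm_matrix_mult] mult_mono b mult_nonneg_nonneg norm_ge_zero c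
          order_trans[OF norm_matrix_mult order_trans[OF mult_right_mono]]) (auto simp: b)
  show "norm (?H' - ?H) \<le> 2 * (c / e) * (c / sqrt e) * norm ?D"
    unfolding resolvent_diff(1)[OF e, of G' G] norm_minus_cancel
  proof (rule norm_triangle_le)
    have "2 * (c / e) * (c / sqrt e) * norm ?D = (c / e) * norm ?D * (c / sqrt e) + (c / sqrt e) * norm ?D * (c / e)"
      by simp
    then show "norm (?H ** adjoint_matrix ?D ** (G' ** ?H')) + norm (adjoint_matrix (G ** ?H) ** ?D ** ?H')
        \<le> 2 * (c / e) * (c / sqrt e) * norm ?D"
      using 1 2 by linarith
  qed
  have 3: "norm (?D ** ?H') \<le> norm ?D * (c / e)"
    by (rule order_trans[OF norm_matrix_mult]) (rule mult_left_mono[OF b(1)], simp)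
  have 4: "norm (G ** ?H ** adjoint_matrix ?D ** (G' ** ?H')) \<le> (c / sqrt e) * norm ?D * (c / sqrt e)"
    by (intro order_trans[OF norm_matrix_mult] mult_mono b mult_nonneg_nonneg norm_ge_zero c
          order_trans[OF norm_matrix_mult order_trans[OF mult_right_mono]]) (auto simp: b)
  \<comment> \<open>Multiplication by \<open>G ** H ** adjoint_matrix G\<close> does not increase
    the norm, so the previous bound carries over.\<close>
  have 5: "norm (G ** ?H ** adjoint_matrix G ** (?D ** ?H')) \<le> norm ?D * (c / e)"
    using norm_resolvent_mult(2)[OF e, of G "?D ** ?H'"] 3 by (simp add: matrix_mul_assoc)
  have "norm (G' ** ?H' - G ** ?H) \<le> norm (?D ** ?H') + norm (G ** ?H ** adjoint_matrix ?D ** (G' ** ?H'))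
     + norm (G ** ?H ** adjoint_matrix G ** (?D ** ?H'))"
    unfolding resolvent_diff(2)[OF e, of G' G]
    by (intro norm_triangle_le_diff add_mono norm_triangle_ineq4) simp
  also have "\<dots> \<le> norm ?D * (c / e) + (c / sqrt e) * norm ?D * (c / sqrt e) + norm ?D * (c / e)"
    by (intro add_mono 3 4 5)
  finally show "norm (G' ** ?H' - G ** ?H) \<le> (2 * (c / e) + (c / sqrt e)\<^sup>2) * norm ?D"
    by (simp add: power2_eq_square algebra_simps)
qed

lemma continuous_on_resolvent:
  assumes e: "e > 0"
  shows "continuous_on UNIV (resolvent e :: 'a::real_or_complex^'m^'l \<Rightarrow> _)"
proof -
  let ?c = "norm (mat 1 :: 'a^'m^'m)"
  have "(2 * (?c / e) * (?c / sqrt e))-lipschitz_on UNIV (resolvent e :: 'a^'m^'l \<Rightarrow> _)"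
    using resolvent_lipschitz(1)[OF e] e by (auto simp: lipschitz_on_def dist_norm)
  then show ?thesis by (rule lipschitz_on_continuous_on)
qed

lemma continuous_on_matrix_mult [continuous_intros]:
  fixes f :: "'b::topological_space \<Rightarrow> 'a::real_or_complex^'k^'m" and g :: "'b \<Rightarrow> 'a^'n^'k"
  assumes "continuous_on S f" "continuous_on S g"
  shows "continuous_on S (\<lambda>x. f x ** g x)"
  unfolding matrix_matrix_mult_def
  by (intro continuous_intros assms)

lemma continuous_on_adjoint_matrix [continuous_intros]:
  fixes f :: "'b::topological_space \<Rightarrow> 'a::real_or_complex^'k^'m"
  assumes "continuous_on S f"
  shows "continuous_on S (\<lambda>x. adjoint_matrix (f x))"
proof -
  have "1-lipschitz_on UNIV (adjoint_matrix :: 'a^'k^'m \<Rightarrow> _)"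
    by (auto simp: lipschitz_on_def dist_norm adjoint_matrix_minus[symmetric])
  from continuous_on_compose2[OF lipschitz_on_continuous_on[OF this] assms] show ?thesis by simp
qed

lemma borel_measurable_matrix_mult [measurable]:
  fixes f :: "'b \<Rightarrow> 'a::real_or_complex^'k^'m" and g :: "'b \<Rightarrow> 'a^'n^'k"
  assumes [measurable]: "f \<in> borel_measurable M" "g \<in> borel_measurable M"
  shows "(\<lambda>x. f x ** g x) \<in> borel_measurable M"
  by (rule borel_measurable_continuous_Pair[OF assms]) (intro continuous_intros)

lemma borel_measurable_adjoint_matrix [measurable]:
  "(adjoint_matrix :: 'a::real_or_complex^'k^'m \<Rightarrow> _) \<in> borel_measurable borel"
  by (intro borel_measurable_continuous_onI continuous_intros)

lemma borel_measurable_resolvent [measurable]: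
  assumes "e > 0"
  shows "(resolvent e :: 'a::real_or_complex^'m^'l \<Rightarrow> _) \<in> borel_measurable borel"
  by (intro borel_measurable_continuous_onI continuous_on_resolvent assms)

section \<open>Existence, uniqueness and limit formula of the pseudoinverse\<close>

lemma gram_cancel:
  assumes "adjoint_matrix G ** G ** Z = (0::'a::real_or_complex^'n^'m)"
  shows "G ** Z = 0"
proof -
  have "norm (G ** Z) ^ 2 = inner (adjoint_matrix G ** G ** Z) Z"
    by (metis adjoint_matrix_adjoint dot_square_norm inner_mult_left_matrix matrix_mul_assoc)
  then show ?thesis using assms by simp
qed

text \<open>A linear right inverse of \<open>H\<close> on its range, defined on the whole space, is
  such a \<open>Y\<close>. It satisfies only the first Penrose condition and serves as raw material
  for the pseudoinverse.\<close>

lemma matrix_inner_inverse: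
  fixes H :: "'a::field^'n^'m"
  obtains Y where "H ** Y ** H = H"
proof -
  obtain g where "Vector_Spaces.linear (*s) (*s) g" and g: "\<And>v. v \<in> range ((*v) H) \<Longrightarrow> H *v (g v) = v"
    using vec.linear_exists_right_inverse_on[OF matrix_vector_mul_linear_gen vec.subspace_UNIV, of H] by blast
  then have "g = (*v) (matrix g)"
    by (simp add: matrix_vector_mul(1) fun_eq_iff matrix_works)
  then have "H *v (matrix g *v (H *v x)) = H *v x" for x
    using g by (metis rangeI)
  then have "(H ** matrix g ** H) *v x = H *v x" for x
    by (simp add: matrix_vector_mul_assoc matrix_mul_assoc)
  then have "H ** matrix g ** H = H" by (simp add: matrix_eq)
  then show thesis by (rule that)
qed

text \<open>\<open>A ** X\<close> and \<open>A ** Y\<close> are both the orthogonal projection onto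
  the range of \<open>A\<close>, and \<open>X ** A\<close> and \<open>Y ** A\<close> that onto the
  range of the adjoint. Hence \<open>X = X A X = X A Y = Y A Y = Y\<close>.\<close>

lemma is_pseudoinverse_unique:
  fixes A :: "'a::real_or_complex^'n^'m"
  assumes X: "is_pseudoinverse A X" and Y: "is_pseudoinverse A Y"
  shows "X = Y"
proof -
  have "A ** X = A ** Y"
  proof -
    have "A ** X = adjoint_matrix (A ** X)" using X by (simp add: is_pseudoinverse_def)
    also have "\<dots> = adjoint_matrix (A ** Y ** (A ** X))" using Y by (simp add: is_pseudoinverse_def matrix_mul_assoc)
    also have "\<dots> = adjoint_matrix (A ** X) ** adjoint_matrix (A ** Y)" by (rule adjoint_matrix_mult)
    also have "\<dots> = A ** X ** (A ** Y)" using X Y by (simp add: is_pseudoinverse_def)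
    also have "\<dots> = A ** Y" using X by (simp add: is_pseudoinverse_def matrix_mul_assoc)
    finally show ?thesis .
  qed
  moreover have "X ** A = Y ** A"
  proof -
    have "X ** A = adjoint_matrix (X ** A)" using X by (simp add: is_pseudoinverse_def)
    also have "\<dots> = adjoint_matrix (X ** A ** (Y ** A))" using Y by (metis is_pseudoinverse_def matrix_mul_assoc)
    also have "\<dots> = adjoint_matrix (Y ** A) ** adjoint_matrix (X ** A)" by (rule adjoint_matrix_mult)
    also have "\<dots> = Y ** A ** (X ** A)" using X Y by (simp add: is_pseudoinverse_def)
    also have "\<dots> = Y ** A" using X by (metis is_pseudoinverse_def matrix_mul_assoc)
    finally show ?thesis .
  qed
  ultimately show ?thesis
    using X Y by (metis is_pseudoinverse_def matrix_mul_assoc)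
qed

text \<open>Take inner inverses \<open>Y\<close> of \<open>adjoint_matrix A ** A\<close> and
  \<open>Z\<close> of \<open>A ** adjoint_matrix A\<close>. Cancelling one factor by
  \<open>gram_cancel\<close> shows that \<open>L\<close> and \<open>R\<close> are the orthogonal
  projections onto the ranges of \<open>A\<close> and of its adjoint; \<open>X\<close> is built so
  that \<open>A ** X = L\<close> and \<open>X ** A = R\<close>.\<close>

lemma is_pseudoinverse_exists:
  fixes A :: "'a::real_or_complex^'n^'m"
  shows "\<exists>X. is_pseudoinverse A X"
proof -
  let ?a = "adjoint_matrix A"
  obtain Y where Y: "?a ** A ** Y ** (?a ** A) = ?a ** A" by (rule matrix_inner_inverse)
  obtain Z where Z: "A ** ?a ** Z ** (A ** ?a) = A ** ?a" by (rule matrix_inner_inverse)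
  have 1: "A ** Y ** ?a ** A = A"
  proof -
    have "?a ** A ** (Y ** ?a ** A - mat 1) = 0"
      using Y by (simp add: matrix_diff_ldistrib matrix_mul_assoc matrix_mul_rid)
    from gram_cancel[OF this] show ?thesis
      by (simp add: matrix_diff_ldistrib matrix_mul_assoc matrix_mul_rid)
  qed
  have 2: "?a ** Z ** A ** ?a = ?a"
  proof -
    have "adjoint_matrix ?a ** ?a ** (Z ** A ** ?a - mat 1) = 0"
      using Z by (simp add: matrix_diff_ldistrib matrix_mul_assoc matrix_mul_rid)
    from gram_cancel[OF this] show ?thesis
      by (simp add: matrix_diff_ldistrib matrix_mul_assoc matrix_mul_rid)
  qed
  have 3: "A ** ?a ** adjoint_matrix Z ** A = A"
    using arg_cong[OF 2, of adjoint_matrix] by (simp add: adjoint_matrix_mult matrix_mul_assoc)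
  have 4: "?a ** A ** adjoint_matrix Y ** ?a = ?a"
    using arg_cong[OF 1, of adjoint_matrix] by (simp add: adjoint_matrix_mult matrix_mul_assoc)
  define L where "L = A ** Y ** ?a"
  define R where "R = ?a ** Z ** A"
  have L1: "L ** A = A" by (simp add: L_def 1)
  have R1: "R ** ?a = ?a" by (simp add: R_def 2)
  have La: "adjoint_matrix L = L"
  proof -
    \<comment> \<open>The right side is self-adjoint, so \<open>L\<close> is its own
      adjoint.\<close>
    have "adjoint_matrix L = L ** adjoint_matrix L"
      by (metis L1 L_def adjoint_matrix_adjoint adjoint_matrix_mult matrix_mul_assoc)
    then show ?thesis by (metis adjoint_matrix_adjoint adjoint_matrix_mult)
  qed
  have Ra: "adjoint_matrix R = R"
  proof -
    have "adjoint_matrix R = R ** adjoint_matrix R"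
      by (metis R1 R_def adjoint_matrix_adjoint adjoint_matrix_mult matrix_mul_assoc)
    then show ?thesis by (metis adjoint_matrix_adjoint adjoint_matrix_mult)
  qed
  have aL: "?a ** L = ?a" by (metis L1 La adjoint_matrix_mult)
  have AR: "A ** R = A" by (metis R1 Ra adjoint_matrix_adjoint adjoint_matrix_mult)
  define X where "X = ?a ** Z ** A ** Y ** ?a"
  have AX: "A ** X = L"
    by (simp add: X_def matrix_mul_assoc) (metis AR L_def R_def matrix_mul_assoc)
  have XA: "X ** A = R"
    unfolding X_def by (metis L1 L_def R_def matrix_mul_assoc)
  have "X ** L = X" unfolding X_def using aL by (metis matrix_mul_assoc)
  then have "is_pseudoinverse A X"
    unfolding is_pseudoinverse_def using AX XA L1 La Ra by (metis matrix_mul_assoc)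
  then show ?thesis ..
qed

lemma is_pseudoinverse_pseudoinverse: "is_pseudoinverse A (pseudoinverse (A::'a::real_or_complex^'n^'m))"
  unfolding pseudoinverse_def
  by (rule theI') (use is_pseudoinverse_exists is_pseudoinverse_unique in blast)

lemma pseudoinverse_eqI: "is_pseudoinverse A X \<Longrightarrow> pseudoinverse A = (X::'a::real_or_complex^'m^'n)"
  using is_pseudoinverse_pseudoinverse is_pseudoinverse_unique by blast

text \<open>The error is of order \<open>e\<close>. Since the adjoint of \<open>G\<close> is the
  Gram matrix times \<open>K\<close>, the regularised inverse equals \<open>K\<close> minus
  \<open>e\<close> times \<open>H ** K\<close>. As \<open>K\<close> is in turn the Gram matrix times
  \<open>Z\<close>, the product \<open>H ** K\<close> equals \<open>Z\<close> minus \<open>e\<close>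
  times \<open>H ** Z\<close>, of norm at most \<open>2 * norm Z\<close> for all
  \<open>e\<close>.\<close>

lemma tendsto_resolvent_pseudoinverse:
  fixes G :: "'a::real_or_complex^'m^'l"
  shows "((\<lambda>e. resolvent e G ** adjoint_matrix G) \<longlongrightarrow> pseudoinverse G) (at_right 0)"
proof -
  define K where "K = pseudoinverse G"
  have K: "G ** K ** G = G" "K ** G ** K = K" "adjoint_matrix (G ** K) = G ** K" "adjoint_matrix (K ** G) = K ** G"
    using is_pseudoinverse_pseudoinverse[of G] by (auto simp: is_pseudoinverse_def K_def)
  define Z where "Z = K ** adjoint_matrix K ** K"
  have aG: "adjoint_matrix G = adjoint_matrix G ** G ** K"
    by (metis K(1,3) adjoint_matrix_mult matrix_mul_assoc)
  have KZ: "K = adjoint_matrix G ** G ** Z"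
    unfolding Z_def by (metis K(2,4) aG adjoint_matrix_mult matrix_mul_assoc)
  have b: "norm (resolvent e G ** adjoint_matrix G - K) \<le> e * (2 * norm Z)" if e: "e > 0" for e
  proof -
    let ?H = "resolvent e G"
    have "?H ** adjoint_matrix G = ?H ** (adjoint_matrix G ** G) ** K"
      using aG by (metis matrix_mul_assoc)
    also have "\<dots> = K - e *\<^sub>R (?H ** K)"
      by (simp add: resolvent_mult_gram[OF e] matrix_diff_rdistrib scaleR_matrix_mult matrix_mul_lid)
    finally have 1: "?H ** adjoint_matrix G - K = - (e *\<^sub>R (?H ** K))" by simp
    have "?H ** K = ?H ** (adjoint_matrix G ** G) ** Z" using KZ by (metis matrix_mul_assoc)
    also have "\<dots> = Z - e *\<^sub>R (?H ** Z)"
      by (simp add: resolvent_mult_gram[OF e] matrix_diff_rdistrib scaleR_matrix_mult matrix_mul_lid)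
    finally have "norm (?H ** K) \<le> norm Z + norm (e *\<^sub>R (?H ** Z))"
      by (metis norm_triangle_ineq4)
    also have "\<dots> \<le> 2 * norm Z" using norm_resolvent_mult(1)[OF e, of G Z] e by simp
    finally show ?thesis unfolding 1 using e by simp
  qed
  have "((\<lambda>e. e * (2 * norm Z)) \<longlongrightarrow> 0) (at_right (0::real))"
    by (rule tendsto_eq_intros refl | simp)+
  then have "((\<lambda>e. resolvent e G ** adjoint_matrix G - K) \<longlongrightarrow> 0) (at_right 0)"
    by (rule Lim_null_comparison[rotated]) (auto simp: eventually_at_filter b)
  then show ?thesis unfolding K_def by (rule Lim_null[THEN iffD2])
qed

lemma LIMSEQ_resolvent_pseudoinverse:
  "(\<lambda>i. resolvent (1 / real (Suc i)) G ** adjoint_matrix G) \<longlonglongrightarrow> pseudoinverse (G::'a::real_or_complex^'m^'l)"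
  by (rule filterlim_compose[OF tendsto_resolvent_pseudoinverse])
    (auto simp: filterlim_at LIMSEQ_Suc[OF lim_1_over_n] simp del: of_nat_Suc)

text \<open>The pseudoinverse jumps where the rank drops; its measurability is inherited from the
  regularised inverses, of which it is a pointwise limit.\<close>

lemma borel_measurable_pseudoinverse [measurable]:
  "(pseudoinverse :: 'a::real_or_complex^'m^'l \<Rightarrow> _) \<in> borel_measurable borel"
proof (rule borel_measurable_LIMSEQ_metric)
  fix i
  have [measurable]: "(resolvent (1 / real (Suc i)) :: 'a^'m^'l \<Rightarrow> _) \<in> borel_measurable borel"
    by (rule borel_measurable_resolvent) simp
  show "(\<lambda>G::'a^'m^'l. resolvent (1 / real (Suc i)) G ** adjoint_matrix G) \<in> borel_measurable borel"
    by measurable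
qed (rule LIMSEQ_resolvent_pseudoinverse)

text \<open>This translates the matrix \<open>\<Psi> ** Q\<close> of the algorithm into the form
  \<open>x ** P\<close>, with \<open>P\<close> a projection of the full space, in which the Gaussian
  estimates are proved.\<close>

lemma pseudoinverse_orthonormal_columns:
  fixes Q :: "'a::real_or_complex^'k^'m" and \<Psi> :: "'a^'m^'l"
  assumes "orthonormal_columns Q"
  shows "pseudoinverse (\<Psi> ** (Q ** adjoint_matrix Q)) = Q ** pseudoinverse (\<Psi> ** Q)"
proof (rule pseudoinverse_eqI)
  let ?Y = "pseudoinverse (\<Psi> ** Q)" and ?q = "adjoint_matrix Q"
  have Q: "?q ** Q = mat 1" using assms by (simp add: orthonormal_columns_def)
  have Y: "\<Psi> ** Q ** ?Y ** (\<Psi> ** Q) = \<Psi> ** Q" "?Y ** (\<Psi> ** Q) ** ?Y = ?Y"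
      "adjoint_matrix (\<Psi> ** Q ** ?Y) = \<Psi> ** Q ** ?Y" "adjoint_matrix (?Y ** (\<Psi> ** Q)) = ?Y ** (\<Psi> ** Q)"
    using is_pseudoinverse_pseudoinverse[of "\<Psi> ** Q"] by (auto simp: is_pseudoinverse_def)
  have 1: "\<Psi> ** (Q ** ?q) ** (Q ** ?Y) = \<Psi> ** Q ** ?Y"
    by (metis Q matrix_mul_assoc matrix_mul_rid)
  have 2: "Q ** ?Y ** (\<Psi> ** (Q ** ?q)) = Q ** (?Y ** (\<Psi> ** Q)) ** ?q"
    by (simp add: matrix_mul_assoc)
  show "is_pseudoinverse (\<Psi> ** (Q ** ?q)) (Q ** ?Y)"
    unfolding is_pseudoinverse_def 1 2
  proof (intro conjI)
    show "\<Psi> ** Q ** ?Y ** (\<Psi> ** (Q ** ?q)) = \<Psi> ** (Q ** ?q)"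
      using Y(1) by (metis matrix_mul_assoc)
    show "Q ** (?Y ** (\<Psi> ** Q)) ** ?q ** (Q ** ?Y) = Q ** ?Y"
      using Y(2) Q by (metis matrix_mul_assoc matrix_mul_rid)
    show "adjoint_matrix (Q ** (?Y ** (\<Psi> ** Q)) ** ?q) = Q ** (?Y ** (\<Psi> ** Q)) ** ?q"
      using Y(4) by (simp add: adjoint_matrix_mult matrix_mul_assoc)
  qed (fact Y(3))
qed

section \<open>Gaussian measures and Stein's identity\<close>

lemma abs_exp_minus_1_le: "\<bar>exp y - 1\<bar> \<le> \<bar>y\<bar> * exp \<bar>y\<bar>" for y :: real
proof (cases "y \<ge> 0")
  case True
  have "(1 - y) * exp y \<le> exp (- y) * exp y"
    using exp_ge_add_one_self[of "- y"] by (intro mult_right_mono) auto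
  then show ?thesis using True by (simp add: exp_minus algebra_simps)
next
  case False
  have "1 - exp y \<le> - y * 1" using exp_ge_add_one_self[of y] by linarith
  also have "\<dots> \<le> - y * exp (- y)" using False by (intro mult_left_mono) auto
  finally show ?thesis using False by simp
qed

text \<open>
  The Cameron--Martin formula characterises the standard Gaussian measure. It is stable under
  isometries and products, and Stein's identity is its derivative in \<open>u\<close>.
\<close>

locale standard_gaussian = prob_space \<mu> for \<mu> :: "'e::euclidean_space measure" +
  assumes sets_eq_borel [measurable_cong]: "sets \<mu> = sets borel"
    and distr_shift: "distr \<mu> borel (\<lambda>x. x + u) = density \<mu> (\<lambda>x. ennreal (exp (x \<bullet> u - u \<bullet> u / 2)))"
begin

lemma integral_shift:
  fixes F :: "'e \<Rightarrow> real"
  assumes [measurable]: "F \<in> borel_measurable borel"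
  shows "(\<integral>x. F (x + u) \<partial>\<mu>) = (\<integral>x. F x * exp (x \<bullet> u - u \<bullet> u / 2) \<partial>\<mu>)"
    and "integrable \<mu> (\<lambda>x. F x * exp (x \<bullet> u - u \<bullet> u / 2)) \<longleftrightarrow> integrable \<mu> (\<lambda>x. F (x + u))"
proof -
  have d: "distr \<mu> borel (\<lambda>x. x + u) = density \<mu> (\<lambda>x. ennreal (exp (x \<bullet> u - u \<bullet> u / 2)))"
    by (rule distr_shift)
  have "(\<integral>x. F (x + u) \<partial>\<mu>) = (\<integral>x. F x \<partial>distr \<mu> borel (\<lambda>x. x + u))"
    by (simp add: integral_distr)
  also have "\<dots> = (\<integral>x. F x * exp (x \<bullet> u - u \<bullet> u / 2) \<partial>\<mu>)"
    unfolding d by (subst integral_density) (auto simp: mult.commute)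
  finally show "(\<integral>x. F (x + u) \<partial>\<mu>) = (\<integral>x. F x * exp (x \<bullet> u - u \<bullet> u / 2) \<partial>\<mu>)" .
  have "integrable \<mu> (\<lambda>x. F (x + u)) \<longleftrightarrow> integrable (distr \<mu> borel (\<lambda>x. x + u)) F"
    by (simp add: integrable_distr_eq)
  also have "\<dots> \<longleftrightarrow> integrable \<mu> (\<lambda>x. F x * exp (x \<bullet> u - u \<bullet> u / 2))"
    unfolding d by (subst integrable_density) (auto simp: mult.commute)
  finally show "integrable \<mu> (\<lambda>x. F x * exp (x \<bullet> u - u \<bullet> u / 2)) \<longleftrightarrow> integrable \<mu> (\<lambda>x. F (x + u))" by simp
qed

lemma integrable_exp: "integrable \<mu> (\<lambda>x. exp (x \<bullet> u))"
proof -
  have "integrable \<mu> (\<lambda>x. 1 * exp (x \<bullet> u - u \<bullet> u / 2))"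
    by (subst integral_shift(2)) auto
  then have "integrable \<mu> (\<lambda>x. exp (u \<bullet> u / 2) * (1 * exp (x \<bullet> u - u \<bullet> u / 2)))"
    by (rule integrable_mult_right)
  then show ?thesis by (simp add: exp_add[symmetric])
qed

text \<open>By \<open>|y| \<le> exp y + exp (- y)\<close>, each coordinate of \<open>x\<close> is
  absorbed by shifting \<open>w\<close> by plus or minus a basis vector, and pure exponentials are
  integrable.\<close>

lemma integrable_norm_exp: "integrable \<mu> (\<lambda>x. (1 + norm x) * exp (x \<bullet> w))"
proof (rule Bochner_Integration.integrable_bound)
  show "integrable \<mu> (\<lambda>x. exp (x \<bullet> w) + (\<Sum>b\<in>Basis. exp (x \<bullet> (w + b)) + exp (x \<bullet> (w - b))))"
    by (intro Bochner_Integration.integrable_add Bochner_Integration.integrable_sum integrable_exp)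
  show "AE x in \<mu>. norm ((1 + norm x) * exp (x \<bullet> w))
     \<le> norm (exp (x \<bullet> w) + (\<Sum>b\<in>Basis. exp (x \<bullet> (w + b)) + exp (x \<bullet> (w - b))))"
  proof (rule AE_I2)
    fix x :: 'e
    have 1: "\<bar>y\<bar> \<le> exp y + exp (- y)" for y :: real
      using exp_ge_add_one_self[of y] exp_ge_add_one_self[of "- y"] exp_gt_zero[of y] exp_gt_zero[of "- y"]
      by linarith
    have "norm x \<le> (\<Sum>b\<in>Basis. \<bar>x \<bullet> b\<bar>)" by (rule norm_le_l1)
    also have "\<dots> \<le> (\<Sum>b\<in>Basis. exp (x \<bullet> b) + exp (- (x \<bullet> b)))" by (intro sum_mono 1)
    finally have "norm x * exp (x \<bullet> w) \<le> (\<Sum>b\<in>Basis. exp (x \<bullet> b) + exp (- (x \<bullet> b))) * exp (x \<bullet> w)"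
      by (rule mult_right_mono) simp
    also have "\<dots> = (\<Sum>b\<in>Basis. exp (x \<bullet> (w + b)) + exp (x \<bullet> (w - b)))"
      unfolding sum_distrib_right distrib_right
      by (simp add: exp_add[symmetric] inner_add_right inner_diff_right algebra_simps)
    finally have "(1 + norm x) * exp (x \<bullet> w) \<le> exp (x \<bullet> w) + (\<Sum>b\<in>Basis. exp (x \<bullet> (w + b)) + exp (x \<bullet> (w - b)))"
      by (simp add: algebra_simps)
    moreover have "0 \<le> (1 + norm x) * exp (x \<bullet> w)" by simp
    ultimately show "norm ((1 + norm x) * exp (x \<bullet> w))
       \<le> norm (exp (x \<bullet> w) + (\<Sum>b\<in>Basis. exp (x \<bullet> (w + b)) + exp (x \<bullet> (w - b))))"
      unfolding real_norm_def by linarith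
  qed
qed measurable

text \<open>By the shift formula at \<open>t u\<close>, the difference quotient of \<open>F\<close>
  along \<open>u\<close> and the product of \<open>F\<close> with that of the Gaussian density ratio
  have equal means. As \<open>t\<close> tends to 0, hypothesis \<open>C\<close> dominates the
  former, and the growth bound \<open>B\<close> together with exponential moments dominates the
  latter.\<close>

lemma stein_identity:
  fixes F F' :: "'e \<Rightarrow> real"
  assumes [measurable]: "F \<in> borel_measurable borel"
    and B: "\<And>x. \<bar>F x\<bar> \<le> B * (1 + norm x)"
    and C: "\<And>x t. \<bar>F (x + t *\<^sub>R u) - F x\<bar> \<le> C * \<bar>t\<bar>"
    and D: "\<And>x. ((\<lambda>t. (F (x + t *\<^sub>R u) - F x) / t) \<longlongrightarrow> F' x) (at 0)"
  shows "integrable \<mu> (\<lambda>x. (x \<bullet> u) * F x)" and "integrable \<mu> F'"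
    and "(\<integral>x. (x \<bullet> u) * F x \<partial>\<mu>) = (\<integral>x. F' x \<partial>\<mu>)"
proof -
  define q where "q = u \<bullet> u"
  have q: "q \<ge> 0" by (simp add: q_def)
  \<comment> \<open>The steps stay in \<open>(0, 1]\<close>, so that one function dominates all
    difference quotients.\<close>
  define t where "t = (\<lambda>i. 1 / real (Suc i))"
  have t: "0 < t i" "t i \<le> 1" for i by (auto simp: t_def)
  have t0: "filterlim t (at 0) sequentially"
    unfolding t_def by (auto simp: filterlim_at LIMSEQ_Suc[OF lim_1_over_n] simp del: of_nat_Suc)
  have B0: "B \<ge> 0" using B[of 0] by simp
  define s where "s = (\<lambda>i x. (F (x + t i *\<^sub>R u) - F x) / t i)"
  define E where "E = (\<lambda>i x. (exp (x \<bullet> (t i *\<^sub>R u) - (t i *\<^sub>R u) \<bullet> (t i *\<^sub>R u) / 2) - 1) / t i)"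
  define r where "r = (\<lambda>i x. F x * E i x)"
  \<comment> \<open>\<open>b\<close> arises from
    \<open>|E i x| \<le> a * exp a \<le> exp (2 * a)\<close> with
    \<open>a = |x \<bullet> u| + q / 2\<close>; the modulus in the exponent is then traded for the
    two directions \<open>2 u\<close> and \<open>- 2 u\<close>.\<close>
  define b where "b = (\<lambda>x. B * exp q * ((1 + norm x) * exp (x \<bullet> (2 *\<^sub>R u)) + (1 + norm x) * exp (x \<bullet> ((-2) *\<^sub>R u))))"
  have s_lim: "(\<lambda>i. s i x) \<longlonglongrightarrow> F' x" for x
    unfolding s_def by (rule filterlim_compose[OF D t0])
  have [measurable]: "s i \<in> borel_measurable \<mu>" for i unfolding s_def by measurable
  have F'_meas: "F' \<in> borel_measurable \<mu>"
    by (rule borel_measurable_LIMSEQ_metric[where f=s]) (auto intro: s_lim)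
  have s_le: "norm (s i x) \<le> C" for i x
    using C[of x "t i"] t[of i] by (simp add: s_def field_simps)
  show "integrable \<mu> F'"
    by (rule integrable_dominated_convergence[where s=s and w="\<lambda>_. C"]) (auto simp: F'_meas s_lim s_le[unfolded real_norm_def])
  have int_s: "(\<lambda>i. \<integral>x. s i x \<partial>\<mu>) \<longlonglongrightarrow> (\<integral>x. F' x \<partial>\<mu>)"
    by (rule integral_dominated_convergence[where w="\<lambda>_. C"]) (auto simp: F'_meas s_lim s_le[unfolded real_norm_def])
  have E_eq: "E i x = (exp (t i * (x \<bullet> u) - (t i)\<^sup>2 * q / 2) - 1) / t i" for i x
    by (simp add: E_def q_def power2_eq_square algebra_simps)
  have E_lim: "(\<lambda>i. E i x) \<longlonglongrightarrow> x \<bullet> u" for x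
  proof -
    have "((\<lambda>t. exp (t * (x \<bullet> u) - t\<^sup>2 * q / 2)) has_real_derivative (x \<bullet> u)) (at 0)"
      by (auto intro!: derivative_eq_intros)
    then have "((\<lambda>t. (exp (t * (x \<bullet> u) - t\<^sup>2 * q / 2) - 1) / t) \<longlongrightarrow> x \<bullet> u) (at 0)"
      by (simp add: DERIV_def)
    from filterlim_compose[OF this t0] show ?thesis by (simp add: E_eq)
  qed
  have E_le: "\<bar>E i x\<bar> \<le> exp q * (exp (x \<bullet> (2 *\<^sub>R u)) + exp (x \<bullet> ((-2) *\<^sub>R u)))" for i x
  proof -
    define a where "a = \<bar>x \<bullet> u\<bar> + q / 2"
    let ?y = "t i * (x \<bullet> u) - (t i)\<^sup>2 * q / 2"
    have a0: "a \<ge> 0" using q by (simp add: a_def)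
    have "(t i)\<^sup>2 * q \<le> t i * q"
      using t[of i] q by (intro mult_right_mono) (auto simp: power2_eq_square mult_left_le)
    moreover have "(t i)\<^sup>2 * q \<ge> 0" using q by simp
    ultimately have y: "\<bar>?y\<bar> \<le> t i * a"
      using abs_mult[of "t i" "x \<bullet> u"] t[of i] unfolding a_def distrib_left abs_if
      by (auto split: if_splits)
    also have "\<dots> \<le> a" using t[of i] a0 by (simp add: mult_left_le_one_le)
    finally have ya: "\<bar>?y\<bar> \<le> a" .
    have "\<bar>exp ?y - 1\<bar> \<le> \<bar>?y\<bar> * exp \<bar>?y\<bar>" by (rule abs_exp_minus_1_le)
    also have "\<dots> \<le> (t i * a) * exp a" using y ya t[of i] a0 by (intro mult_mono) auto
    finally have "\<bar>E i x\<bar> \<le> a * exp a" using t[of i] by (simp add: E_eq field_simps)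
    also have "\<dots> \<le> exp a * exp a" using a0 by (intro mult_right_mono order_trans[OF _ exp_ge_add_one_self[of a]]) auto
    also have "\<dots> = exp q * exp (2 * \<bar>x \<bullet> u\<bar>)" by (simp add: a_def exp_add[symmetric])
    also have "\<dots> \<le> exp q * (exp (x \<bullet> (2 *\<^sub>R u)) + exp (x \<bullet> ((-2) *\<^sub>R u)))"
      by (intro mult_left_mono) (auto simp: abs_if)
    finally show ?thesis .
  qed
  have r_le: "norm (r i x) \<le> b x" for i x
  proof -
    have "norm (r i x) \<le> B * (1 + norm x) * (exp q * (exp (x \<bullet> (2 *\<^sub>R u)) + exp (x \<bullet> ((-2) *\<^sub>R u))))"
      unfolding r_def real_norm_def abs_mult using B0 by (intro mult_mono B E_le) auto
    then show ?thesis by (simp add: b_def algebra_simps)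
  qed
  have b_int: "integrable \<mu> b"
    unfolding b_def by (intro integrable_mult_right Bochner_Integration.integrable_add integrable_norm_exp)
  have r_lim: "(\<lambda>i. r i x) \<longlonglongrightarrow> (x \<bullet> u) * F x" for x
    unfolding r_def by (subst mult.commute) (intro tendsto_mult E_lim tendsto_const)
  have [measurable]: "E i \<in> borel_measurable \<mu>" for i unfolding E_def by measurable
  have [measurable]: "r i \<in> borel_measurable \<mu>" for i unfolding r_def by measurable
  show "integrable \<mu> (\<lambda>x. (x \<bullet> u) * F x)"
    by (rule integrable_dominated_convergence[where s=r and w=b]) (auto simp: b_int r_lim r_le[unfolded real_norm_def])
  have int_r: "(\<lambda>i. \<integral>x. r i x \<partial>\<mu>) \<longlonglongrightarrow> (\<integral>x. (x \<bullet> u) * F x \<partial>\<mu>)"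
    by (rule integral_dominated_convergence[where w=b]) (auto simp: b_int r_lim r_le[unfolded real_norm_def])
  have F_int: "integrable \<mu> F"
  proof (rule Bochner_Integration.integrable_bound)
    show "integrable \<mu> (\<lambda>x. B * ((1 + norm x) * exp (x \<bullet> 0)))"
      by (intro integrable_mult_right integrable_norm_exp)
    show "AE x in \<mu>. norm (F x) \<le> norm (B * ((1 + norm x) * exp (x \<bullet> 0)))"
      using order_trans[OF B abs_ge_self] by (intro AE_I2) simp
  qed simp
  have "(\<integral>x. s i x \<partial>\<mu>) = (\<integral>x. r i x \<partial>\<mu>)" for i
  proof -
    have "integrable \<mu> (s i)"
      by (rule integrable_const_bound[where B=C]) (auto simp: s_le[unfolded real_norm_def])
    then have "integrable \<mu> (\<lambda>x. t i * s i x + F x)"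
      by (intro Bochner_Integration.integrable_add integrable_mult_right F_int)
    then have Ft: "integrable \<mu> (\<lambda>x. F (x + t i *\<^sub>R u))"
      using t[of i] by (simp add: s_def)
    then have Fe: "integrable \<mu> (\<lambda>x. F x * exp (x \<bullet> (t i *\<^sub>R u) - (t i *\<^sub>R u) \<bullet> (t i *\<^sub>R u) / 2))"
      by (subst integral_shift(2)) auto
    have "(\<integral>x. s i x \<partial>\<mu>) = ((\<integral>x. F (x + t i *\<^sub>R u) \<partial>\<mu>) - (\<integral>x. F x \<partial>\<mu>)) / t i"
      unfolding s_def using Ft F_int by simp
    also have "\<dots> = ((\<integral>x. F x * exp (x \<bullet> (t i *\<^sub>R u) - (t i *\<^sub>R u) \<bullet> (t i *\<^sub>R u) / 2) \<partial>\<mu>) - (\<integral>x. F x \<partial>\<mu>)) / t i"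
      by (subst integral_shift(1)) auto
    also have "\<dots> = (\<integral>x. (F x * exp (x \<bullet> (t i *\<^sub>R u) - (t i *\<^sub>R u) \<bullet> (t i *\<^sub>R u) / 2) - F x) / t i \<partial>\<mu>)"
      using Fe F_int by simp
    also have "\<dots> = (\<integral>x. r i x \<partial>\<mu>)"
      by (simp add: r_def E_def right_diff_distrib)
    finally show ?thesis .
  qed
  then show "(\<integral>x. (x \<bullet> u) * F x \<partial>\<mu>) = (\<integral>x. F' x \<partial>\<mu>)"
    using int_r int_s LIMSEQ_unique by (metis (no_types, lifting) ext)
qed

end

section \<open>Gaussian matrices and orthogonal projections\<close>

lemma bounded_bilinear_matrix_mult:
  "bounded_bilinear ((**) :: 'a::real_or_complex^'k^'m \<Rightarrow> 'a^'n^'k \<Rightarrow> 'a^'n^'m)"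
  by (rule bounded_bilinear.intro)
    (auto simp: matrix_add_ldistrib matrix_add_rdistrib scaleR_matrix_mult matrix_mult_scaleR
      intro!: exI[of _ 1] norm_matrix_mult)

lemmas tendsto_matrix_mult [tendsto_intros] = bounded_bilinear.tendsto[OF bounded_bilinear_matrix_mult]

lemma inner_mat_1_mat_1: "inner (mat 1) (mat 1 :: 'a::real_or_complex^'n^'n) = real CARD('n)"
  by (simp add: inner_vec_def mat_def if_distrib[where f="\<lambda>x. inner x _"] if_distrib[where f="inner _"] cong: if_cong)

definition orthogonal_projection :: "'a::conjugatable_field^'m^'m \<Rightarrow> bool" where
  "orthogonal_projection P \<longleftrightarrow> adjoint_matrix P = P \<and> P ** P = P"

text \<open>The trace \<open>inner (mat 1) P\<close> stands in for the dimension of the range; as a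
  squared norm it is nonnegative.\<close>

lemma norm_orthogonal_projection_sq:
  "orthogonal_projection P \<Longrightarrow> norm P ^ 2 = inner (mat 1) (P::'a::real_or_complex^'m^'m)"
  by (metis norm_sq_matrix orthogonal_projection_def)

context
  fixes P :: "'a::real_or_complex^'m^'m" and e :: real
  assumes P: "orthogonal_projection P" and e: "e > 0"
begin

lemma adjoint_mult_projection:
  fixes x :: "'a^'m^'l"
  shows "P ** adjoint_matrix (x ** P) = adjoint_matrix (x ** P)" "x ** P ** P = x ** P"
  using P by (simp_all add: orthogonal_projection_def adjoint_matrix_mult matrix_mul_assoc) (metis matrix_mul_assoc)

text \<open>Multiplying the Gram matrix of \<open>x ** P\<close> by \<open>P\<close> on either side
  does not change it, so \<open>P\<close> commutes with the shifted Gram matrix and hence with its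
  inverse.\<close>

lemma projection_commutes_resolvent:
  fixes x :: "'a^'m^'l"
  shows "P ** resolvent e (x ** P) = resolvent e (x ** P) ** P"
proof -
  let ?G = "x ** P" and ?H = "resolvent e (x ** P)"
  let ?S = "adjoint_matrix ?G ** ?G + e *\<^sub>R mat 1"
  have "?S ** P = P ** ?S"
    by (simp add: matrix_add_ldistrib matrix_add_rdistrib scaleR_matrix_mult matrix_mult_scaleR)
      (metis adjoint_mult_projection matrix_mul_assoc)
  then have "?H ** (?S ** P) ** ?H = ?H ** (P ** ?S) ** ?H" by simp
  then have "(?H ** ?S) ** P ** ?H = ?H ** P ** (?S ** ?H)" by (simp only: matrix_mul_assoc)
  then show ?thesis by (simp only: resolvent_left[OF e] resolvent_right[OF e] matrix_mul_lid matrix_mul_rid)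
qed

lemma mult_resolvent_projection:
  fixes x :: "'a^'m^'l"
  shows "x ** P ** resolvent e (x ** P) ** P = x ** P ** resolvent e (x ** P)"
  by (metis adjoint_mult_projection(2) matrix_mul_assoc projection_commutes_resolvent)

text \<open>The first two come from the trace of \<open>P\<close> times
  \<open>gram_mult_resolvent\<close>, the third from \<open>inner_gram_shift\<close> at
  \<open>H ** P\<close>. The third lets \<tau> dominate both \<open>norm (G ** H) ^ 2\<close> and
  \<open>e * norm (H ** P) ^ 2\<close>.\<close>

lemma inner_mult_resolvent:
  fixes x :: "'a^'m^'l"
  defines "\<tau> \<equiv> inner (mat 1) (P ** resolvent e (x ** P))"
  shows "inner (x ** P) (x ** P ** resolvent e (x ** P)) = inner (mat 1) P - e * \<tau>"
    and "inner x (x ** P ** resolvent e (x ** P)) = inner (mat 1) P - e * \<tau>"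
    and "\<tau> = norm (x ** P ** resolvent e (x ** P)) ^ 2 + e * norm (resolvent e (x ** P) ** P) ^ 2"
proof -
  let ?G = "x ** P" and ?H = "resolvent e (x ** P)"
  have aP: "adjoint_matrix P = P" and PP: "P ** P = P" using P by (auto simp: orthogonal_projection_def)
  have "inner ?G (?G ** ?H) = inner (mat 1) (adjoint_matrix ?G ** (?G ** ?H))"
    by (simp add: inner_mat_1)
  also have "adjoint_matrix ?G ** (?G ** ?H) = P ** (adjoint_matrix ?G ** ?G ** ?H)"
    by (metis adjoint_mult_projection(1) matrix_mul_assoc)
  also have "\<dots> = P - e *\<^sub>R (P ** ?H)"
    by (simp add: gram_mult_resolvent[OF e] matrix_diff_ldistrib matrix_mult_scaleR)
  finally show 1: "inner ?G (?G ** ?H) = inner (mat 1) P - e * \<tau>"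
    by (simp add: inner_diff_right \<tau>_def)
  have "inner x (?G ** ?H) = inner x (?G ** ?H ** P)"
    by (simp only: mult_resolvent_projection)
  also have "\<dots> = inner ?G (?G ** ?H)"
    using inner_mult_right_matrix[of x P "?G ** ?H"] by (simp only: aP)
  finally show "inner x (?G ** ?H) = inner (mat 1) P - e * \<tau>" using 1 by simp
  have "norm (?G ** (?H ** P)) ^ 2 + e * norm (?H ** P) ^ 2 = inner (?H ** P) P"
    unfolding inner_gram_shift[symmetric]
    by (simp only: matrix_mul_assoc[of "_ + _"] resolvent_right[OF e] matrix_mul_lid)
  also have "\<dots> = inner (mat 1) (adjoint_matrix (?H ** P) ** P)"
    by (simp add: inner_mat_1)
  also have "adjoint_matrix (?H ** P) ** P = P ** ?H"
    by (simp add: adjoint_matrix_mult aP adjoint_resolvent[OF e])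
      (metis PP matrix_mul_assoc projection_commutes_resolvent)
  finally show "\<tau> = norm (?G ** ?H) ^ 2 + e * norm (?H ** P) ^ 2"
    using mult_resolvent_projection[of x] by (simp add: matrix_mul_assoc \<tau>_def)
qed

text \<open>This is the divergence of \<open>x \<mapsto> G ** H\<close>. In the first term
  \<open>D\<close> is multiplied from the left by the identity, of trace \<open>CARD('l)\<close>;
  the second is conjugate-linear in \<open>D\<close>; in the third the left factor
  \<open>G ** H ** adjoint_matrix G\<close> has trace \<open>p - e * \<tau>\<close>.\<close>

lemma sum_Basis_resolvent_derivative:
  fixes x :: "'a^'m^'l"
  defines "G \<equiv> x ** P" and "H \<equiv> resolvent e (x ** P)"
  defines "\<tau> \<equiv> inner (mat 1) (P ** H)" and "p \<equiv> inner (mat 1) P"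
  shows "(\<Sum>D\<in>Basis. inner D ((D ** P) ** H - G ** H ** adjoint_matrix (D ** P) ** (G ** H)
            - G ** H ** adjoint_matrix G ** ((D ** P) ** H)))
         = real DIM('a) * real CARD('l) * \<tau> - (2 - real DIM('a)) * norm (G ** H) ^ 2
            - real DIM('a) * (p - e * \<tau>) * \<tau>"
proof -
  have aP: "adjoint_matrix P = P" using P by (auto simp: orthogonal_projection_def)
  have 1: "(\<Sum>D\<in>(Basis :: ('a^'m^'l) set). inner D ((D ** P) ** H)) = real DIM('a) * real CARD('l) * \<tau>"
    using sum_Basis_mult_matrix[of "mat 1 :: 'a^'l^'l" "P ** H"]
    by (simp add: inner_mat_1_mat_1 \<tau>_def matrix_mul_assoc)
  have "G ** H ** adjoint_matrix (D ** P) ** (G ** H) = (G ** H) ** adjoint_matrix D ** (G ** H)" for D :: "'a^'m^'l"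
    using mult_resolvent_projection[of x] by (simp add: adjoint_matrix_mult aP G_def H_def matrix_mul_assoc)
  then have 2: "(\<Sum>D\<in>Basis. inner D (G ** H ** adjoint_matrix (D ** P) ** (G ** H))) = (2 - real DIM('a)) * norm (G ** H) ^ 2"
    by (simp add: sum_Basis_adjoint_matrix dot_square_norm)
  have h: "adjoint_matrix (G ** H ** adjoint_matrix G) = G ** H ** adjoint_matrix G"
    by (simp add: adjoint_matrix_mult H_def adjoint_resolvent[OF e] matrix_mul_assoc)
  have "inner (mat 1) (G ** H ** adjoint_matrix G) = inner (adjoint_matrix (G ** H)) (adjoint_matrix G)"
    using inner_mat_1[of "adjoint_matrix (G ** H)" "adjoint_matrix G"] by simp
  also have "\<dots> = p - e * \<tau>"
    unfolding inner_adjoint using inner_mult_resolvent(1)[of x]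
    by (simp add: G_def H_def p_def \<tau>_def inner_commute)
  finally have "(\<Sum>D\<in>Basis. inner D ((G ** H ** adjoint_matrix G) ** D ** (P ** H))) = real DIM('a) * (p - e * \<tau>) * \<tau>"
    using sum_Basis_mult_matrix[OF h, of "P ** H"] by (simp add: \<tau>_def)
  then have 3: "(\<Sum>D\<in>Basis. inner D (G ** H ** adjoint_matrix G ** ((D ** P) ** H))) = real DIM('a) * (p - e * \<tau>) * \<tau>"
    by (simp add: matrix_mul_assoc)
  show ?thesis
    by (simp add: inner_diff_right sum_subtractf 1 2 3)
qed

text \<open>In the exact formula \<open>resolvent_diff\<close> the increment is \<open>t\<close>
  times \<open>D ** P\<close> and enters each term once. After division by \<open>t\<close> only
  \<open>G' t\<close> and \<open>H' t\<close> still depend on \<open>t\<close>, and these converge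
  by continuity.\<close>

lemma tendsto_resolvent_line:
  fixes x D :: "'a^'m^'l"
  defines "G \<equiv> x ** P" and "H \<equiv> resolvent e (x ** P)"
  shows "((\<lambda>t. ((x + t *\<^sub>R D) ** P ** resolvent e ((x + t *\<^sub>R D) ** P) - G ** H) /\<^sub>R t) \<longlongrightarrow>
     (D ** P) ** H - G ** H ** adjoint_matrix (D ** P) ** (G ** H)
            - G ** H ** adjoint_matrix G ** ((D ** P) ** H)) (at 0)"
proof -
  define G' where "G' = (\<lambda>t. (x + t *\<^sub>R D) ** P)"
  define H' where "H' = (\<lambda>t. resolvent e (G' t))"
  have G'G: "G' t - G = t *\<^sub>R (D ** P)" for t
    by (simp add: G'_def G_def matrix_add_rdistrib scaleR_matrix_mult)
  have G': "G' t = G + t *\<^sub>R (D ** P)" for t using G'G[of t] by (simp add: algebra_simps)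
  have G0: "(G' \<longlongrightarrow> G) (at 0)"
    unfolding G' by (rule tendsto_eq_intros refl | simp)+
  have H0: "(H' \<longlongrightarrow> H) (at 0)"
    unfolding H'_def H_def G_def[symmetric]
    using continuous_on_resolvent[OF e] G0
    by (metis continuous_on_eq_continuous_at isCont_tendsto_compose open_UNIV UNIV_I)
  have "(G' t ** H' t - G ** H) /\<^sub>R t = (D ** P) ** H' t - G ** H ** adjoint_matrix (D ** P) ** (G' t ** H' t)
            - G ** H ** adjoint_matrix G ** ((D ** P) ** H' t)" if "t \<noteq> 0" for t
  proof -
    have "H = resolvent e G" "H' t = resolvent e (G' t)" by (simp_all add: H_def G_def H'_def)
    note d = resolvent_diff(2)[OF e, of "G' t" G, folded this, unfolded G'G]
    show ?thesis
      unfolding d using that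
      by (simp add: adjoint_matrix_scaleR scaleR_matrix_mult matrix_mult_scaleR scaleR_diff_right[symmetric])
  qed
  then have "((\<lambda>t. (G' t ** H' t - G ** H) /\<^sub>R t) \<longlongrightarrow>
     (D ** P) ** H - G ** H ** adjoint_matrix (D ** P) ** (G ** H)
            - G ** H ** adjoint_matrix G ** ((D ** P) ** H)) (at 0)
     \<longleftrightarrow> ((\<lambda>t. (D ** P) ** H' t - G ** H ** adjoint_matrix (D ** P) ** (G' t ** H' t)
            - G ** H ** adjoint_matrix G ** ((D ** P) ** H' t)) \<longlongrightarrow>
     (D ** P) ** H - G ** H ** adjoint_matrix (D ** P) ** (G ** H)
            - G ** H ** adjoint_matrix G ** ((D ** P) ** H)) (at 0)"
    by (intro tendsto_cong) (auto simp: eventually_at_filter)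
  also have \<dots> by (intro tendsto_intros G0 H0)
  finally show ?thesis by (simp add: G'_def H'_def)
qed

end

text \<open>Fatou's lemma with bounds that may move with \<open>i\<close>: they are constant for the
  moment estimate and tend to 0 for the almost sure statement.\<close>

lemma nn_integral_LIMSEQ_le:
  fixes f :: "nat \<Rightarrow> 'b \<Rightarrow> real"
  assumes meas: "\<And>i. f i \<in> borel_measurable M" and lim: "\<And>x. (\<lambda>i. f i x) \<longlonglongrightarrow> g x"
    and int: "\<And>i. integrable M (f i)" and nn: "\<And>i x. 0 \<le> f i x"
    and le: "\<And>i. (\<integral>x. f i x \<partial>M) \<le> c i" and c: "c \<longlonglongrightarrow> c'"
  shows "(\<integral>\<^sup>+x. ennreal (g x) \<partial>M) \<le> ennreal c'"
proof -
  have "(\<integral>\<^sup>+x. ennreal (g x) \<partial>M) = (\<integral>\<^sup>+x. liminf (\<lambda>i. ennreal (f i x)) \<partial>M)"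
    by (intro nn_integral_cong lim_imp_Liminf[symmetric] tendsto_ennrealI lim) simp
  also have "\<dots> \<le> liminf (\<lambda>i. \<integral>\<^sup>+x. ennreal (f i x) \<partial>M)"
    using meas by (intro nn_integral_liminf) auto
  also have "\<dots> \<le> liminf (\<lambda>i. ennreal (c i))"
    by (intro Liminf_mono always_eventually allI)
      (simp add: nn_integral_eq_integral[OF int] nn ennreal_leI le)
  also have "\<dots> = ennreal c'"
    by (intro lim_imp_Liminf tendsto_ennrealI c) simp
  finally show ?thesis .
qed

section \<open>Moment estimates for the pseudoinverse of a projected Gaussian matrix\<close>

locale gaussian_projection = standard_gaussian \<mu>
  for \<mu> :: "('a::real_or_complex^'m^'l) measure" +
  fixes P :: "'a^'m^'m"
  assumes P: "orthogonal_projection P"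
begin

text \<open>Stein's identity for \<open>F\<close>, summed over an orthonormal basis of directions.\<close>

lemma expectation_trace_resolvent_le:
  assumes e: "e > 0"
  defines "c \<equiv> real DIM('a)" and "p \<equiv> inner (mat 1) P"
  defines "\<tau> \<equiv> \<lambda>x. inner (mat 1) (P ** resolvent e (x ** P))"
  shows "integrable \<mu> \<tau>" and "(c * (real CARD('l) - p) - (2 - c)) * (\<integral>x. \<tau> x \<partial>\<mu>) \<le> p"
proof -
  note [measurable] = borel_measurable_resolvent[OF e]
  define F where "F = (\<lambda>x::'a^'m^'l. x ** P ** resolvent e (x ** P))"
  \<comment> \<open>\<open>d x D\<close> is the derivative of \<open>F\<close> at \<open>x\<close>
    in direction \<open>D\<close>.\<close>
  define d where "d = (\<lambda>x D :: 'a^'m^'l. (D ** P) ** resolvent e (x ** P) - x ** P ** resolvent e (x ** P) ** adjoint_matrix (D ** P) ** (x ** P ** resolvent e (x ** P))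
            - x ** P ** resolvent e (x ** P) ** adjoint_matrix (x ** P) ** ((D ** P) ** resolvent e (x ** P)))"
  define b where "b = norm (mat 1 :: 'a^'m^'m)"
  have [measurable]: "F \<in> borel_measurable borel" unfolding F_def by measurable
  have [measurable]: "\<tau> \<in> borel_measurable borel" unfolding \<tau>_def by measurable
  have \<tau>_meas: "\<tau> \<in> borel_measurable \<mu>" by measurable
  have F_le: "norm (F x) \<le> b / sqrt e" for x
    unfolding F_def b_def by (rule norm_mult_resolvent(2)[OF e])
  have \<tau>0: "\<tau> x \<ge> 0" and F\<tau>: "norm (F x) ^ 2 \<le> \<tau> x" for x
    using inner_mult_resolvent(3)[OF P e, of x] e by (auto simp: \<tau>_def F_def)
  have "\<bar>\<tau> x\<bar> \<le> norm P * (b / e)" for x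
  proof -
    have "\<bar>\<tau> x\<bar> = \<bar>inner P (resolvent e (x ** P))\<bar>"
      using inner_mat_1[of P "resolvent e (x ** P)"] P by (simp add: \<tau>_def orthogonal_projection_def)
    also have "\<dots> \<le> norm P * norm (resolvent e (x ** P))" by (rule Cauchy_Schwarz_ineq2)
    also have "\<dots> \<le> norm P * (b / e)" unfolding b_def by (intro mult_left_mono norm_mult_resolvent(1)[OF e]) simp
    finally show ?thesis .
  qed
  then show int_\<tau>: "integrable \<mu> \<tau>"
    by (intro integrable_const_bound[where B="norm P * (b / e)"] AE_I2) (simp_all add: \<tau>_meas)
  have stein: "integrable \<mu> (\<lambda>x. inner x D * inner (F x) D)" "integrable \<mu> (\<lambda>x. inner (d x D) D)"
     "(\<integral>x. inner x D * inner (F x) D \<partial>\<mu>) = (\<integral>x. inner (d x D) D \<partial>\<mu>)" for D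
  proof -
    let ?B = "b / sqrt e * norm D"
    have B: "\<bar>inner (F x) D\<bar> \<le> ?B * (1 + norm x)" for x
    proof -
      have "\<bar>inner (F x) D\<bar> \<le> norm (F x) * norm D" by (rule Cauchy_Schwarz_ineq2)
      also have "\<dots> \<le> ?B * 1" by (simp only: mult_1_right) (rule mult_right_mono[OF F_le], simp)
      also have "\<dots> \<le> ?B * (1 + norm x)" using e by (intro mult_left_mono) (auto simp: b_def)
      finally show ?thesis .
    qed
    let ?L = "2 * (b / e) + (b / sqrt e)\<^sup>2"
    have C: "\<bar>inner (F (x + t *\<^sub>R D)) D - inner (F x) D\<bar> \<le> (?L * norm (D ** P) * norm D) * \<bar>t\<bar>" for x t
    proof -
      have "\<bar>inner (F (x + t *\<^sub>R D)) D - inner (F x) D\<bar> \<le> norm (F (x + t *\<^sub>R D) - F x) * norm D"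
        unfolding inner_diff_left[symmetric] by (rule Cauchy_Schwarz_ineq2)
      also have "norm (F (x + t *\<^sub>R D) - F x) \<le> ?L * norm ((x + t *\<^sub>R D) ** P - x ** P)"
        unfolding F_def b_def by (rule resolvent_lipschitz(2)[OF e])
      also have "norm ((x + t *\<^sub>R D) ** P - x ** P) = \<bar>t\<bar> * norm (D ** P)"
        by (simp add: matrix_add_rdistrib scaleR_matrix_mult)
      finally show ?thesis by (simp add: mult_right_mono algebra_simps)
    qed
    have lim: "((\<lambda>t. (inner (F (x + t *\<^sub>R D)) D - inner (F x) D) / t) \<longlongrightarrow> inner (d x D) D) (at 0)" for x
    proof -
      have "((\<lambda>t. inner ((F (x + t *\<^sub>R D) - F x) /\<^sub>R t) D) \<longlongrightarrow> inner (d x D) D) (at 0)"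
        unfolding F_def d_def by (intro tendsto_inner tendsto_const tendsto_resolvent_line[OF P e])
      then show ?thesis by (simp add: inner_diff_left divide_inverse mult.commute)
    qed
    show "integrable \<mu> (\<lambda>x. inner x D * inner (F x) D)" "integrable \<mu> (\<lambda>x. inner (d x D) D)"
     "(\<integral>x. inner x D * inner (F x) D \<partial>\<mu>) = (\<integral>x. inner (d x D) D \<partial>\<mu>)"
      by (rule stein_identity[OF _ B C lim]; measurable)+
  qed
  \<comment> \<open>The divergence is bounded below by a multiple of \<tau>:
    \<open>norm (F x) ^ 2\<close> is replaced by the larger \<open>\<tau> x\<close>, and the
    nonnegative term \<open>c * e * (\<tau> x)^2\<close> is dropped.\<close>
  have "(\<integral>x. c * (real CARD('l) - p) * \<tau> x - (2 - c) * \<tau> x \<partial>\<mu>) \<le> (\<integral>x. (\<Sum>D\<in>Basis. inner (d x D) D) \<partial>\<mu>)"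
  proof (rule integral_mono)
    fix x
    have c2: "2 - c \<ge> 0" using DIM_le_2[where ?'a='a] by (simp add: c_def)
    have "(\<Sum>D\<in>Basis. inner (d x D) D) = c * real CARD('l) * \<tau> x - (2 - c) * norm (F x) ^ 2 - c * (p - e * \<tau> x) * \<tau> x"
      unfolding d_def c_def \<tau>_def p_def F_def sum_Basis_resolvent_derivative[OF P e, symmetric]
      by (simp only: inner_commute)
    moreover have "(2 - c) * norm (F x) ^ 2 \<le> (2 - c) * \<tau> x" by (rule mult_left_mono[OF F\<tau> c2])
    moreover have "c * (p - e * \<tau> x) * \<tau> x \<le> c * p * \<tau> x"
      using e \<tau>0[of x] by (simp add: algebra_simps c_def)
    ultimately show "c * (real CARD('l) - p) * \<tau> x - (2 - c) * \<tau> x \<le> (\<Sum>D\<in>Basis. inner (d x D) D)"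
      by (simp add: algebra_simps)
  qed (auto intro!: stein int_\<tau> Bochner_Integration.integrable_sum Bochner_Integration.integrable_diff integrable_mult_right)
  also have "\<dots> = (\<Sum>D\<in>Basis. \<integral>x. inner x D * inner (F x) D \<partial>\<mu>)"
    by (simp add: Bochner_Integration.integral_sum stein)
  also have "\<dots> = (\<integral>x. inner x (F x) \<partial>\<mu>)"
    by (simp add: Bochner_Integration.integral_sum[symmetric] stein(1) euclidean_inner[symmetric])
  also have "\<dots> = (\<integral>x. p - e * \<tau> x \<partial>\<mu>)"
    by (simp add: F_def p_def \<tau>_def inner_mult_resolvent(2)[OF P e])
  also have "\<dots> \<le> (\<integral>x. p \<partial>\<mu>)"
    using int_\<tau> \<tau>0 e by (intro integral_mono) auto
  also have "\<dots> = p" by (simp add: prob_space)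
  finally show "(c * (real CARD('l) - p) - (2 - c)) * (\<integral>x. \<tau> x \<partial>\<mu>) \<le> p"
    using int_\<tau> by (simp add: algebra_simps)
qed

text \<open>
  Stein's identity in the directions \<open>E N\<^sup>*\<close>: they are annihilated by \<open>P\<close>, so \<open>K\<close> is constant along them.
\<close>

lemma expectation_norm_resolvent_mult:
  fixes N :: "'a^'n^'m"
  assumes e: "e > 0" and PN: "P ** N = 0"
  defines "K \<equiv> \<lambda>x :: 'a^'m^'l. resolvent e (x ** P) ** adjoint_matrix (x ** P)"
  shows "integrable \<mu> (\<lambda>x. norm (K x ** x ** N) ^ 2)"
    and "(\<integral>x. norm (K x ** x ** N) ^ 2 \<partial>\<mu>) = (\<integral>x. real DIM('a) * norm (K x) ^ 2 * norm N ^ 2 \<partial>\<mu>)"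
proof -
  note [measurable] = borel_measurable_resolvent[OF e]
  \<comment> \<open>As a quadratic form of \<open>R\<close> in \<open>x ** N\<close>, the squared
    norm exposes one linear factor for Stein's identity.\<close>
  define R where "R = (\<lambda>x. adjoint_matrix (K x) ** K x)"
  define b where "b = norm (mat 1 :: 'a^'m^'m) / sqrt e"
  have [measurable]: "K \<in> borel_measurable borel" unfolding K_def by measurable
  have [measurable]: "R \<in> borel_measurable borel" unfolding R_def by measurable
  have "norm (K x) \<le> b" for x
    using norm_mult_resolvent(2)[OF e, of "x ** P"] norm_adjoint[of "x ** P ** resolvent e (x ** P)"]
    by (simp add: K_def b_def adjoint_matrix_mult adjoint_resolvent[OF e] norm_adjoint del: norm_adjoint)
  then have R_le: "norm (R x) \<le> b ^ 2" for x
    unfolding R_def power2_eq_square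
    by (intro order_trans[OF norm_matrix_mult] mult_mono) (auto intro: order_trans[OF norm_ge_zero])
  have stein: "integrable \<mu> (\<lambda>x. inner (x ** N) E * inner (R x ** (x ** N)) E)"
     "integrable \<mu> (\<lambda>x. inner (R x ** E ** (adjoint_matrix N ** N)) E)"
     "(\<integral>x. inner (x ** N) E * inner (R x ** (x ** N)) E \<partial>\<mu>) = (\<integral>x. inner (R x ** E ** (adjoint_matrix N ** N)) E \<partial>\<mu>)"
    for E
  proof -
    \<comment> \<open>The inner product of \<open>x\<close> with \<open>?u\<close> is the coordinate
      of \<open>x ** N\<close> along \<open>E\<close>. Since \<open>?u ** P = 0\<close>, the field
      is affine along \<open>?u\<close>, with the slope computed in \<open>diff\<close>.\<close>
    let ?u = "E ** adjoint_matrix N"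
    have uP: "?u ** P = 0"
    proof -
      have "adjoint_matrix N ** P = adjoint_matrix (P ** N)"
        using P by (simp add: adjoint_matrix_mult orthogonal_projection_def)
      then show ?thesis using PN by (simp add: matrix_mul_assoc[symmetric])
    qed
    have R: "R (x + t *\<^sub>R ?u) = R x" for x t
      by (simp add: R_def K_def matrix_add_rdistrib scaleR_matrix_mult uP)
    have diff: "inner (R (x + t *\<^sub>R ?u) ** ((x + t *\<^sub>R ?u) ** N)) E - inner (R x ** (x ** N)) E
        = t * inner (R x ** E ** (adjoint_matrix N ** N)) E" for x t
      unfolding R by (simp add: matrix_add_rdistrib matrix_add_ldistrib scaleR_matrix_mult matrix_mult_scaleR inner_add_left matrix_mul_assoc)
    have B: "\<bar>inner (R x ** (x ** N)) E\<bar> \<le> (b\<^sup>2 * norm N * norm E) * (1 + norm x)" for x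
    proof -
      have "\<bar>inner (R x ** (x ** N)) E\<bar> \<le> norm (R x ** (x ** N)) * norm E" by (rule Cauchy_Schwarz_ineq2)
      also have "\<dots> \<le> (norm (R x) * (norm x * norm N)) * norm E"
        by (intro mult_right_mono order_trans[OF norm_matrix_mult] mult_left_mono norm_matrix_mult) auto
      also have "\<dots> \<le> (b\<^sup>2 * ((1 + norm x) * norm N)) * norm E"
        by (intro mult_right_mono mult_mono R_le) auto
      finally show ?thesis by (simp add: algebra_simps)
    qed
    have RE: "\<bar>inner (R x ** E ** (adjoint_matrix N ** N)) E\<bar> \<le> b\<^sup>2 * norm E * norm (adjoint_matrix N ** N) * norm E" for x
      by (intro order_trans[OF Cauchy_Schwarz_ineq2] mult_right_mono order_trans[OF norm_matrix_mult] R_le) auto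
    have C: "\<bar>inner (R (x + t *\<^sub>R ?u) ** ((x + t *\<^sub>R ?u) ** N)) E - inner (R x ** (x ** N)) E\<bar>
       \<le> (b\<^sup>2 * norm E * norm (adjoint_matrix N ** N) * norm E) * \<bar>t\<bar>" for x t
      unfolding diff abs_mult using RE[of x] by (simp add: mult_left_mono mult.commute)
    have lim: "((\<lambda>t. (inner (R (x + t *\<^sub>R ?u) ** ((x + t *\<^sub>R ?u) ** N)) E - inner (R x ** (x ** N)) E) / t)
       \<longlongrightarrow> inner (R x ** E ** (adjoint_matrix N ** N)) E) (at 0)" for x
      unfolding diff by (rule tendsto_eventually) (auto simp: eventually_at_filter)
    have u: "inner x ?u = inner (x ** N) E" for x :: "'a^'m^'l"
      by (simp add: inner_mult_right_matrix)
    note st = stein_identity[OF _ B C lim, unfolded u]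
    show "integrable \<mu> (\<lambda>x. inner (x ** N) E * inner (R x ** (x ** N)) E)"
     "integrable \<mu> (\<lambda>x. inner (R x ** E ** (adjoint_matrix N ** N)) E)"
     "(\<integral>x. inner (x ** N) E * inner (R x ** (x ** N)) E \<partial>\<mu>) = (\<integral>x. inner (R x ** E ** (adjoint_matrix N ** N)) E \<partial>\<mu>)"
      by (rule st; measurable)+
  qed
  have eq: "norm (K x ** x ** N) ^ 2 = (\<Sum>E\<in>Basis. inner (x ** N) E * inner (R x ** (x ** N)) E)" for x
  proof -
    have "norm (K x ** x ** N) ^ 2 = inner (x ** N) (R x ** (x ** N))"
      unfolding R_def
      by (metis dot_square_norm inner_mult_left_matrix matrix_mul_assoc)
    also have "\<dots> = (\<Sum>E\<in>Basis. inner (x ** N) E * inner (R x ** (x ** N)) E)"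
      by (rule euclidean_inner)
    finally show ?thesis .
  qed
  show "integrable \<mu> (\<lambda>x. norm (K x ** x ** N) ^ 2)"
    unfolding eq by (intro Bochner_Integration.integrable_sum stein(1))
  have "(\<integral>x. norm (K x ** x ** N) ^ 2 \<partial>\<mu>) = (\<integral>x. (\<Sum>E\<in>Basis. inner (R x ** E ** (adjoint_matrix N ** N)) E) \<partial>\<mu>)"
    unfolding eq using stein by (simp add: Bochner_Integration.integral_sum)
  also have "\<dots> = (\<integral>x. real DIM('a) * norm (K x) ^ 2 * norm N ^ 2 \<partial>\<mu>)"
  proof (rule Bochner_Integration.integral_cong[OF refl])
    fix x
    have "adjoint_matrix (R x) = R x" by (simp add: R_def adjoint_matrix_mult)
    \<comment> \<open>The traces of \<open>R x\<close> and of the Gram matrix of \<open>N\<close>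
      are the two squared norms.\<close>
    from sum_Basis_mult_matrix[OF this, of "adjoint_matrix N ** N"]
    show "(\<Sum>E\<in>Basis. inner (R x ** E ** (adjoint_matrix N ** N)) E) = real DIM('a) * norm (K x) ^ 2 * norm N ^ 2"
      by (subst inner_commute) (simp add: norm_sq_matrix R_def)
  qed
  finally show "(\<integral>x. norm (K x ** x ** N) ^ 2 \<partial>\<mu>) = (\<integral>x. real DIM('a) * norm (K x) ^ 2 * norm N ^ 2 \<partial>\<mu>)" .
qed

context
  fixes c p \<kappa> :: real
  defines "c \<equiv> real DIM('a)" and "p \<equiv> inner (mat 1) P"
  defines "\<kappa> \<equiv> c * (real CARD('l) - p) - (2 - c)"
  assumes \<kappa>: "\<kappa> > 0"
begin

text \<open>Because \<open>2 - c = c \<alpha>\<close>, the constant \<kappa> is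
  \<open>c (l - p - \<alpha>)\<close>; its positivity is the oversampling condition. The resulting
  bound does not depend on \<open>e\<close>.\<close>

lemma expectation_trace_resolvent_le':
  assumes e: "e > 0"
  shows "(\<integral>x. inner (mat 1) (P ** resolvent e (x ** P)) \<partial>\<mu>) \<le> p / \<kappa>"
  using expectation_trace_resolvent_le(2)[OF e] \<kappa>
  by (simp add: \<kappa>_def c_def p_def pos_le_divide_eq mult.commute)

text \<open>The regularised inverse has squared norm at most the trace \<tau>, so the same bound
  holds for every \<open>e\<close> and survives the limit by Fatou.\<close>

lemma nn_integral_pseudoinverse_mult_le:
  fixes N :: "'a^'n^'m"
  assumes PN: "P ** N = 0"
  shows "(\<integral>\<^sup>+x. ennreal (norm (pseudoinverse (x ** P) ** x ** N) ^ 2) \<partial>\<mu>) \<le> ennreal (c * p / \<kappa> * norm N ^ 2)"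
proof (rule nn_integral_LIMSEQ_le)
  fix i
  define e where "e = 1 / real (Suc i)"
  have e: "e > 0" by (simp add: e_def)
  note [measurable] = borel_measurable_resolvent[OF e]
  let ?K = "\<lambda>x :: 'a^'m^'l. resolvent e (x ** P) ** adjoint_matrix (x ** P)"
  let ?\<tau> = "\<lambda>x. inner (mat 1) (P ** resolvent e (x ** P))"
  note * = expectation_norm_resolvent_mult[OF e PN]
  show "integrable \<mu> (\<lambda>x. norm (resolvent (1 / real (Suc i)) (x ** P) ** adjoint_matrix (x ** P) ** x ** N) ^ 2)"
    using *(1) unfolding e_def .
  then show "(\<lambda>x. norm (resolvent (1 / real (Suc i)) (x ** P) ** adjoint_matrix (x ** P) ** x ** N) ^ 2) \<in> borel_measurable \<mu>"
    by (rule borel_measurable_integrable)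
  have K: "norm (?K x) ^ 2 \<le> ?\<tau> x" for x
  proof -
    have "norm (?K x) = norm (x ** P ** resolvent e (x ** P))"
      by (subst norm_adjoint[symmetric]) (simp add: adjoint_matrix_mult adjoint_resolvent[OF e] del: norm_adjoint)
    then show ?thesis using inner_mult_resolvent(3)[OF P e, of x] e by simp
  qed
  have "(\<integral>x. norm (?K x ** x ** N) ^ 2 \<partial>\<mu>) = (\<integral>x. c * norm (?K x) ^ 2 * norm N ^ 2 \<partial>\<mu>)"
    using *(2) by (simp add: c_def)
  also have "\<dots> \<le> (\<integral>x. c * ?\<tau> x * norm N ^ 2 \<partial>\<mu>)"
    by (intro integral_mono_AE' AE_I2 mult_right_mono mult_left_mono K
        integrable_mult_left integrable_mult_right expectation_trace_resolvent_le(1)[OF e])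
      (auto simp: c_def intro!: mult_nonneg_nonneg order_trans[OF zero_le_power2 K])
  also have "\<dots> = c * (\<integral>x. ?\<tau> x \<partial>\<mu>) * norm N ^ 2"
    by simp
  also have "\<dots> \<le> c * (p / \<kappa>) * norm N ^ 2"
    by (intro mult_right_mono mult_left_mono expectation_trace_resolvent_le'[OF e]) (auto simp: c_def)
  finally show "(\<integral>x. norm (resolvent (1 / real (Suc i)) (x ** P) ** adjoint_matrix (x ** P) ** x ** N) ^ 2 \<partial>\<mu>) \<le> c * p / \<kappa> * norm N ^ 2"
    unfolding e_def by simp
next
  fix x :: "'a^'m^'l"
  show "(\<lambda>i. norm (resolvent (1 / real (Suc i)) (x ** P) ** adjoint_matrix (x ** P) ** x ** N) ^ 2)
    \<longlonglongrightarrow> norm (pseudoinverse (x ** P) ** x ** N) ^ 2"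
    by (intro tendsto_intros LIMSEQ_resolvent_pseudoinverse)
qed (auto intro: tendsto_const)

text \<open>The regularised version differs from \<open>P\<close> by \<open>e\<close> times
  \<open>H ** P\<close>. The square of this error is at most \<open>e * \<tau>\<close>, of mean at
  most \<open>e * p / \<kappa>\<close>, so the limiting error has mean 0. In other words,
  \<open>x\<close> is almost surely injective on the range of \<open>P\<close>.\<close>

lemma AE_pseudoinverse_mult: "AE x in \<mu>. pseudoinverse (x ** P) ** (x ** P) = P"
proof -
  have "(\<integral>\<^sup>+x. ennreal (norm (P - pseudoinverse (x ** P) ** (x ** P)) ^ 2) \<partial>\<mu>) \<le> ennreal 0"
  proof (rule nn_integral_LIMSEQ_le)
    fix i
    define e where "e = 1 / real (Suc i)"
    have e: "e > 0" by (simp add: e_def)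
    note [measurable] = borel_measurable_resolvent[OF e]
    let ?\<tau> = "\<lambda>x. inner (mat 1) (P ** resolvent e (x ** P))"
    let ?f = "\<lambda>x :: 'a^'m^'l. norm (P - resolvent e (x ** P) ** adjoint_matrix (x ** P) ** (x ** P)) ^ 2"
    have f: "?f x \<le> e * ?\<tau> x" for x
    proof -
      have "resolvent e (x ** P) ** adjoint_matrix (x ** P) ** (x ** P) = resolvent e (x ** P) ** (adjoint_matrix (x ** P) ** (x ** P)) ** P"
      proof -
        have "H ** A ** G = H ** (A ** G) ** P" if "G ** P = G" for H :: "'a^'m^'m" and A G
          by (simp only: that matrix_mul_assoc[symmetric])
        from this[OF adjoint_mult_projection(2)[OF P e]] show ?thesis .
      qed
      also have "\<dots> = P - e *\<^sub>R (resolvent e (x ** P) ** P)"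
        by (simp add: resolvent_mult_gram[OF e] matrix_diff_rdistrib scaleR_matrix_mult)
      finally have "?f x = e * (e * norm (resolvent e (x ** P) ** P) ^ 2)"
        by (simp add: power2_eq_square)
      then show ?thesis using inner_mult_resolvent(3)[OF P e, of x] e by simp
    qed
    have \<tau>: "integrable \<mu> (\<lambda>x. e * ?\<tau> x)"
      by (intro integrable_mult_right expectation_trace_resolvent_le(1)[OF e])
    have "?f \<in> borel_measurable \<mu>" by measurable
    then show m: "(\<lambda>x. norm (P - resolvent (1 / real (Suc i)) (x ** P) ** adjoint_matrix (x ** P) ** (x ** P)) ^ 2) \<in> borel_measurable \<mu>"
      unfolding e_def .
    have "integrable \<mu> ?f"
      using order_trans[OF f abs_ge_self] m unfolding e_def[symmetric]
      by (intro Bochner_Integration.integrable_bound[OF \<tau>] AE_I2) simp_all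
    then show "integrable \<mu> (\<lambda>x. norm (P - resolvent (1 / real (Suc i)) (x ** P) ** adjoint_matrix (x ** P) ** (x ** P)) ^ 2)"
      unfolding e_def .
    have "(\<integral>x. ?f x \<partial>\<mu>) \<le> (\<integral>x. e * ?\<tau> x \<partial>\<mu>)"
      by (intro integral_mono_AE' AE_I2 \<tau> f order_trans[OF zero_le_power2 f])
    also have "\<dots> \<le> e * (p / \<kappa>)"
      using mult_left_mono[OF expectation_trace_resolvent_le'[OF e], of e] e by simp
    finally show "(\<integral>x. norm (P - resolvent (1 / real (Suc i)) (x ** P) ** adjoint_matrix (x ** P) ** (x ** P)) ^ 2 \<partial>\<mu>)
        \<le> 1 / real (Suc i) * (p / \<kappa>)"
      unfolding e_def .
  next
    fix x :: "'a^'m^'l"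
    show "(\<lambda>i. norm (P - resolvent (1 / real (Suc i)) (x ** P) ** adjoint_matrix (x ** P) ** (x ** P)) ^ 2)
      \<longlonglongrightarrow> norm (P - pseudoinverse (x ** P) ** (x ** P)) ^ 2"
      by (intro tendsto_intros LIMSEQ_resolvent_pseudoinverse)
    show "(\<lambda>i. 1 / real (Suc i) * (p / \<kappa>)) \<longlonglongrightarrow> 0"
      by (rule tendsto_eq_intros LIMSEQ_Suc[OF lim_1_over_n] refl | simp del: of_nat_Suc)+
  qed auto
  then have "(\<integral>\<^sup>+x. ennreal (norm (P - pseudoinverse (x ** P) ** (x ** P)) ^ 2) \<partial>\<mu>) = 0"
    by simp
  then have "AE x in \<mu>. ennreal (norm (P - pseudoinverse (x ** P) ** (x ** P)) ^ 2) = 0"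
    by (subst (asm) nn_integral_0_iff_AE) auto
  then show ?thesis by eventually_elim simp
qed

end

end

section \<open>The laws of standard normal matrices\<close>

text \<open>The Cameron-Martin formula for a single direction, tested on nonnegative functions.
  Integrability questions do not arise, and the property adds up over directions, so that it can be
  checked on multiples of basis vectors.\<close>

definition gaussian_shift :: "'e::euclidean_space measure \<Rightarrow> 'e \<Rightarrow> bool" where
  "gaussian_shift \<mu> u \<longleftrightarrow> (\<forall>F\<in>borel_measurable borel.
     (\<integral>\<^sup>+x. F (x + u) \<partial>\<mu>) = (\<integral>\<^sup>+x. ennreal (exp (x \<bullet> u - u \<bullet> u / 2)) * F x \<partial>\<mu>))"

lemma gaussian_shift_0: "gaussian_shift \<mu> 0"
  by (simp add: gaussian_shift_def)

lemma gaussian_shift_add: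
  assumes "gaussian_shift \<mu> u" "gaussian_shift \<mu> v"
  shows "gaussian_shift \<mu> (u + v)"
  unfolding gaussian_shift_def
proof
  fix F :: "'a \<Rightarrow> ennreal" assume [measurable]: "F \<in> borel_measurable borel"
  have "(\<integral>\<^sup>+x. F (x + (u + v)) \<partial>\<mu>) = (\<integral>\<^sup>+x. F ((x + u) + v) \<partial>\<mu>)"
    by (simp add: add.assoc)
  also have "\<dots> = (\<integral>\<^sup>+x. ennreal (exp (x \<bullet> u - u \<bullet> u / 2)) * F (x + v) \<partial>\<mu>)"
    using assms(1) unfolding gaussian_shift_def by (rule bspec) measurable
  \<comment> \<open>Rewriting the density in \<open>x + v\<close> prepares the second shift and
    creates the cross term \<open>v \<bullet> u\<close> of the combined density.\<close>
  also have "\<dots> = (\<integral>\<^sup>+x. ennreal (exp ((x + v) \<bullet> u - v \<bullet> u - u \<bullet> u / 2)) * F (x + v) \<partial>\<mu>)"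
    by (simp add: inner_add_left)
  also have "\<dots> = (\<integral>\<^sup>+x. ennreal (exp (x \<bullet> v - v \<bullet> v / 2)) * (ennreal (exp (x \<bullet> u - v \<bullet> u - u \<bullet> u / 2)) * F x) \<partial>\<mu>)"
    using assms(2) unfolding gaussian_shift_def by (rule bspec) measurable
  also have "\<dots> = (\<integral>\<^sup>+x. ennreal (exp (x \<bullet> (u + v) - (u + v) \<bullet> (u + v) / 2)) * F x \<partial>\<mu>)"
    by (intro nn_integral_cong)
      (simp add: mult.assoc[symmetric] ennreal_mult'[symmetric] exp_add[symmetric] inner_add_left inner_add_right
        inner_commute[of u v] algebra_simps add_divide_distrib)
  finally show "(\<integral>\<^sup>+x. F (x + (u + v)) \<partial>\<mu>) = \<dots>" .
qed

lemma gaussian_shift_Basis: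
  assumes "\<And>b s. b \<in> Basis \<Longrightarrow> gaussian_shift \<mu> (s *\<^sub>R b)"
  shows "gaussian_shift \<mu> u"
proof -
  have "gaussian_shift \<mu> (\<Sum>b\<in>B. (u \<bullet> b) *\<^sub>R b)" if "B \<subseteq> Basis" for B
    using finite_subset[OF that finite_Basis] that
    by (induction B rule: finite_induct) (auto intro: gaussian_shift_add gaussian_shift_0 assms)
  from this[of Basis] show ?thesis by (simp add: euclidean_representation)
qed

lemma standard_gaussianI:
  assumes "prob_space \<mu>" and sets: "sets \<mu> = sets borel" and shift: "\<And>u. gaussian_shift \<mu> u"
  shows "standard_gaussian \<mu>"
proof -
  interpret prob_space \<mu> by fact
  note [measurable_cong] = sets
  show ?thesis
  proof
    fix u
    show "distr \<mu> borel (\<lambda>x. x + u) = density \<mu> (\<lambda>x. ennreal (exp (x \<bullet> u - u \<bullet> u / 2)))"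
    proof (rule measure_eqI)
      fix A assume "A \<in> sets (distr \<mu> borel (\<lambda>x. x + u))"
      then have [measurable]: "A \<in> sets borel" by simp
      have A: "A \<in> sets \<mu>" by (simp add: sets)
      have "emeasure (distr \<mu> borel (\<lambda>x. x + u)) A = (\<integral>\<^sup>+x. indicator A (x + u) \<partial>\<mu>)"
        by (simp add: nn_integral_indicator[symmetric] nn_integral_distr del: nn_integral_indicator)
      also have "\<dots> = (\<integral>\<^sup>+x. ennreal (exp (x \<bullet> u - u \<bullet> u / 2)) * indicator A x \<partial>\<mu>)"
        using shift[of u] unfolding gaussian_shift_def by (rule bspec) measurable
      also have "\<dots> = emeasure (density \<mu> (\<lambda>x. ennreal (exp (x \<bullet> u - u \<bullet> u / 2)))) A"
        using A by (simp add: emeasure_density)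
      finally show "emeasure (distr \<mu> borel (\<lambda>x. x + u)) A = \<dots>" .
    qed (simp add: sets)
  qed fact
qed

lemma (in standard_gaussian) gaussian_shift: "gaussian_shift \<mu> u"
  unfolding gaussian_shift_def
proof
  fix F :: "'e \<Rightarrow> ennreal" assume [measurable]: "F \<in> borel_measurable borel"
  have "(\<integral>\<^sup>+x. F (x + u) \<partial>\<mu>) = (\<integral>\<^sup>+x. F x \<partial>distr \<mu> borel (\<lambda>x. x + u))"
    by (simp add: nn_integral_distr)
  also have "\<dots> = (\<integral>\<^sup>+x. ennreal (exp (x \<bullet> u - u \<bullet> u / 2)) * F x \<partial>\<mu>)"
    unfolding distr_shift by (simp add: nn_integral_density)
  finally show "(\<integral>\<^sup>+x. F (x + u) \<partial>\<mu>) = \<dots>" .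
qed

lemma (in standard_gaussian) standard_gaussian_distr_isometry:
  fixes T :: "'e \<Rightarrow> 'f::euclidean_space"
  assumes T: "linear T" "\<And>x y. T x \<bullet> T y = x \<bullet> y" "surj T"
  shows "standard_gaussian (distr \<mu> borel T)"
proof (rule standard_gaussianI)
  have [measurable]: "T \<in> borel_measurable borel"
    using T(1) by (intro borel_measurable_continuous_onI linear_continuous_on linear_conv_bounded_linear[THEN iffD1])
  show "prob_space (distr \<mu> borel T)" by (rule prob_space_distr) measurable
  fix u
  obtain v where u: "u = T v" using T(3) by (metis surjD)
  show "gaussian_shift (distr \<mu> borel T) u"
    unfolding gaussian_shift_def
  proof
    fix F :: "'f \<Rightarrow> ennreal" assume [measurable]: "F \<in> borel_measurable borel"
    have "(\<integral>\<^sup>+x. F (x + u) \<partial>distr \<mu> borel T) = (\<integral>\<^sup>+x. F (T (x + v)) \<partial>\<mu>)"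
      by (simp add: nn_integral_distr u linear_add[OF T(1)])
    also have "\<dots> = (\<integral>\<^sup>+x. ennreal (exp (x \<bullet> v - v \<bullet> v / 2)) * F (T x) \<partial>\<mu>)"
      using gaussian_shift unfolding gaussian_shift_def by (rule bspec) measurable
    also have "\<dots> = (\<integral>\<^sup>+x. ennreal (exp (x \<bullet> u - u \<bullet> u / 2)) * F x \<partial>distr \<mu> borel T)"
      by (simp add: nn_integral_distr u T(2))
    finally show "(\<integral>\<^sup>+x. F (x + u) \<partial>distr \<mu> borel T) = \<dots>" .
  qed
qed simp

text \<open>Translation invariance of Lebesgue measure moves the shift onto the density, and
  expanding the square in the exponent leaves the exponential factor.\<close>

lemma nn_integral_std_normal_shift:
  assumes [measurable]: "g \<in> borel_measurable borel"
  shows "(\<integral>\<^sup>+x. g (x + s) \<partial>density lborel std_normal_density)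
       = (\<integral>\<^sup>+x. ennreal (exp (x * s - s * s / 2)) * g x \<partial>density lborel std_normal_density)"
proof -
  have *: "std_normal_density (y - s) = std_normal_density y * exp (y * s - s * s / 2)" for y
    by (simp add: std_normal_density_def exp_add[symmetric] power2_eq_square algebra_simps add_divide_distrib diff_divide_distrib)
  have "(\<integral>\<^sup>+x. g (x + s) \<partial>density lborel std_normal_density) = (\<integral>\<^sup>+x. ennreal (std_normal_density x) * g (x + s) \<partial>lborel)"
    by (simp add: nn_integral_density)
  also have "\<dots> = (\<integral>\<^sup>+x. ennreal (std_normal_density ((x + s) - s)) * g (x + s) \<partial>lborel)" by simp
  also have "\<dots> = (\<integral>\<^sup>+x. ennreal (std_normal_density (x - s)) * g x \<partial>distr lborel borel (\<lambda>x. x + s))"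
    by (subst nn_integral_distr) auto
  also have "distr lborel borel (\<lambda>x::real. x + s) = lborel"
  proof -
    have "(\<lambda>x::real. x + s) = (+) s" by (simp add: fun_eq_iff)
    then show ?thesis using lborel_distr_plus[of s] by simp
  qed
  also have "(\<integral>\<^sup>+x. ennreal (std_normal_density (x - s)) * g x \<partial>lborel)
     = (\<integral>\<^sup>+x. ennreal (std_normal_density x) * (ennreal (exp (x * s - s * s / 2)) * g x) \<partial>lborel)"
    unfolding * by (intro nn_integral_cong) (simp add: ennreal_mult' mult.assoc)
  also have "\<dots> = (\<integral>\<^sup>+x. ennreal (exp (x * s - s * s / 2)) * g x \<partial>density lborel std_normal_density)"
    by (simp add: nn_integral_density)
  finally show ?thesis .
qed

section \<open>Independence, joint laws and matrices with normal entries\<close>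

context prob_space
begin

lemma distr_Pair_indep_borel:
  fixes X :: "'a \<Rightarrow> 'b::topological_space" and Y :: "'a \<Rightarrow> 'c::topological_space"
  assumes "indep_borel X Y"
  shows "distr M (borel \<Otimes>\<^sub>M borel) (\<lambda>\<omega>. (X \<omega>, Y \<omega>)) = distr M borel X \<Otimes>\<^sub>M distr M borel Y"
proof -
  have [measurable]: "random_variable borel X" "random_variable borel Y"
    using assms by (auto simp: indep_borel_def)
  interpret X: prob_space "distr M borel X" by (rule prob_space_distr) simp
  interpret Y: prob_space "distr M borel Y" by (rule prob_space_distr) simp
  show ?thesis
  proof (rule sym, rule pair_measure_eqI)
    fix A B assume AB: "A \<in> sets (distr M borel X)" "B \<in> sets (distr M borel Y)"
    have "prob ((X -` A \<inter> space M) \<inter> (Y -` B \<inter> space M)) = prob (X -` A \<inter> space M) * prob (Y -` B \<inter> space M)"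
      using assms AB unfolding indep_borel_def
      by (intro indep_setD[where A="sigma_sets (space M) {X -` S \<inter> space M |S. S \<in> sets borel}"
            and B="sigma_sets (space M) {Y -` S \<inter> space M |S. S \<in> sets borel}"]) auto
    moreover have "(\<lambda>\<omega>. (X \<omega>, Y \<omega>)) -` (A \<times> B) \<inter> space M = (X -` A \<inter> space M) \<inter> (Y -` B \<inter> space M)"
      by auto
    ultimately show "emeasure (distr M borel X) A * emeasure (distr M borel Y) B
        = emeasure (distr M (borel \<Otimes>\<^sub>M borel) (\<lambda>\<omega>. (X \<omega>, Y \<omega>))) (A \<times> B)"
      using AB by (simp add: emeasure_distr emeasure_eq_measure ennreal_mult'[symmetric])
  qed (auto simp: X.sigma_finite_measure_axioms Y.sigma_finite_measure_axioms cong: sets_pair_measure_cong)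
qed

lemma nn_integral_indep_borel:
  fixes X :: "'a \<Rightarrow> 'b::topological_space" and Y :: "'a \<Rightarrow> 'c::topological_space"
  assumes "indep_borel X Y" and f' [measurable]: "(\<lambda>(x, y). f x y) \<in> borel_measurable (borel \<Otimes>\<^sub>M borel)"
  shows "(\<integral>\<^sup>+\<omega>. f (X \<omega>) (Y \<omega>) \<partial>M) = (\<integral>\<^sup>+x. \<integral>\<^sup>+y. f x y \<partial>distr M borel Y \<partial>distr M borel X)"
proof -
  have [measurable]: "random_variable borel X" "random_variable borel Y"
    using assms by (auto simp: indep_borel_def)
  interpret Y: prob_space "distr M borel Y" by (rule prob_space_distr) simp
  have f'': "(\<lambda>(x, y). f x y) \<in> borel_measurable (distr M borel X \<Otimes>\<^sub>M distr M borel Y)"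
    using f' by (simp cong: measurable_cong_sets sets_pair_measure_cong)
  have "(\<integral>\<^sup>+\<omega>. f (X \<omega>) (Y \<omega>) \<partial>M) = (\<integral>\<^sup>+z. (case z of (x, y) \<Rightarrow> f x y) \<partial>distr M (borel \<Otimes>\<^sub>M borel) (\<lambda>\<omega>. (X \<omega>, Y \<omega>)))"
    by (subst nn_integral_distr) auto
  also have "\<dots> = (\<integral>\<^sup>+x. \<integral>\<^sup>+y. f x y \<partial>distr M borel Y \<partial>distr M borel X)"
    unfolding distr_Pair_indep_borel[OF assms(1)] using Y.nn_integral_fst[OF f''] by simp
  finally show ?thesis .
qed

lemma indep_borel_if_indep_var: "indep_var borel X borel Y \<Longrightarrow> indep_borel X Y"
  by (simp add: indep_borel_def indep_var_eq)

text \<open>For a basis direction \<open>b\<close>, belonging to one entry, split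
  \<open>G = Z + X\<close> with \<open>X\<close> that entry times \<open>b\<close>. \<open>Z\<close>
  is independent of \<open>X\<close> and orthogonal to \<open>b\<close>, so a shift along
  \<open>b\<close> acts on \<open>X\<close> alone, by the scalar formula, while the exponent does
  not see \<open>Z\<close>.\<close>

lemma standard_gaussian_real_std_normal_matrix:
  fixes G :: "'a \<Rightarrow> real^'n^'m"
  assumes G: "real_std_normal_matrix G"
  shows "random_variable borel G" and "standard_gaussian (distr M borel G)"
proof -
  have ind: "indep_vars (\<lambda>_. borel) (\<lambda>(i, j) \<omega>. G \<omega> $ i $ j) UNIV"
    and d: "\<And>i j. distributed M lborel (\<lambda>\<omega>. G \<omega> $ i $ j) std_normal_density"
    using G by (auto simp: real_std_normal_matrix_def)
  have rv [measurable]: "random_variable borel (\<lambda>\<omega>. G \<omega> $ i $ j)" for i j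
    using distributed_measurable[OF d[of i j]] by simp
  show [measurable]: "random_variable borel G"
    by (subst borel_measurable_euclidean_space) (auto simp: Basis_vec_def inner_axis)
  show "standard_gaussian (distr M borel G)"
  proof (rule standard_gaussianI)
    show "prob_space (distr M borel G)" by (rule prob_space_distr) simp
    fix u
    show "gaussian_shift (distr M borel G) u"
    proof (rule gaussian_shift_Basis)
      fix b :: "real^'n^'m" and s assume "b \<in> Basis"
      then obtain i j where b: "b = axis i (axis j 1)" by (auto simp: Basis_vec_def)
      have bb: "b \<bullet> b = 1" and Gb: "x \<bullet> b = x $ i $ j" for x :: "real^'n^'m" by (simp_all add: b inner_axis)
      define X where "X = (\<lambda>\<omega>. (G \<omega> $ i $ j) *\<^sub>R b)"
      define Z where "Z = (\<lambda>\<omega>. G \<omega> - X \<omega>)"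
      have iv: "indep_borel Z X"
      proof (rule indep_borel_if_indep_var)
        let ?Y1 = "\<lambda>f :: 'm \<times> 'n \<Rightarrow> real. (\<chi> i' j'. if (i', j') = (i, j) then 0 else f (i', j')) :: real^'n^'m"
        let ?Y2 = "\<lambda>f :: 'm \<times> 'n \<Rightarrow> real. f (i, j) *\<^sub>R b"
        have "indep_var borel (?Y1 \<circ> (\<lambda>\<omega>. \<lambda>p\<in>UNIV - {(i, j)}. (case p of (i, j) \<Rightarrow> \<lambda>\<omega>. G \<omega> $ i $ j) \<omega>))
           borel (?Y2 \<circ> (\<lambda>\<omega>. \<lambda>p\<in>{(i, j)}. (case p of (i, j) \<Rightarrow> \<lambda>\<omega>. G \<omega> $ i $ j) \<omega>))"
        proof (rule indep_var_compose[OF indep_var_restrict[OF ind]])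
          have "(\<lambda>f. (if (i', j') = (i, j) then 0 else f (i', j')) :: real) \<in> borel_measurable (Pi\<^sub>M (UNIV - {(i, j)}) (\<lambda>_. borel))" for i' j'
            by (cases "(i', j') = (i, j)") (auto intro!: measurable_component_singleton)
          then show "?Y1 \<in> borel_measurable (Pi\<^sub>M (UNIV - {(i, j)}) (\<lambda>_. borel))"
            by (subst borel_measurable_euclidean_space) (auto simp: Basis_vec_def inner_axis)
          show "?Y2 \<in> borel_measurable (Pi\<^sub>M {(i, j)} (\<lambda>_. borel))"
            by (intro borel_measurable_scaleR measurable_component_singleton borel_measurable_const) simp
        qed auto
        also have "?Y1 \<circ> (\<lambda>\<omega>. \<lambda>p\<in>UNIV - {(i, j)}. (case p of (i, j) \<Rightarrow> \<lambda>\<omega>. G \<omega> $ i $ j) \<omega>) = Z"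
          by (auto simp: fun_eq_iff Z_def X_def b vec_eq_iff axis_def)
        also have "?Y2 \<circ> (\<lambda>\<omega>. \<lambda>p\<in>{(i, j)}. (case p of (i, j) \<Rightarrow> \<lambda>\<omega>. G \<omega> $ i $ j) \<omega>) = X"
          by (auto simp: fun_eq_iff X_def)
        finally show "indep_var borel Z borel X" .
      qed
      have Zb: "Z \<omega> \<bullet> b = 0" for \<omega> by (simp add: Z_def X_def inner_diff_left Gb) (simp add: b axis_def)
      have ZX: "G \<omega> = Z \<omega> + X \<omega>" for \<omega> by (simp add: Z_def)
      have Z_rv [measurable]: "random_variable borel Z" using iv by (simp add: indep_borel_def)
      have dX: "distr M borel X = distr (density lborel std_normal_density) borel (\<lambda>x. x *\<^sub>R b)"
        unfolding distributed_distr_eq_density[OF d[of i j], symmetric]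
        by (subst distr_distr) (simp_all add: X_def o_def)
      have AE: "AE z in distr M borel Z. z \<bullet> b = 0"
        by (subst AE_distr_iff) (auto simp: Zb)
      show "gaussian_shift (distr M borel G) (s *\<^sub>R b)"
        unfolding gaussian_shift_def
      proof
        fix F :: "real^'n^'m \<Rightarrow> ennreal" assume [measurable]: "F \<in> borel_measurable borel"
        have "(\<integral>\<^sup>+x. F (x + s *\<^sub>R b) \<partial>distr M borel G) = (\<integral>\<^sup>+\<omega>. F (Z \<omega> + X \<omega> + s *\<^sub>R b) \<partial>M)"
          by (simp add: nn_integral_distr ZX)
        also have "\<dots> = (\<integral>\<^sup>+z. \<integral>\<^sup>+y. F (z + y + s *\<^sub>R b) \<partial>distr M borel X \<partial>distr M borel Z)"
          by (rule nn_integral_indep_borel[OF iv]) measurable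
        also have "\<dots> = (\<integral>\<^sup>+z. \<integral>\<^sup>+x. F (z + (x + s) *\<^sub>R b) \<partial>density lborel std_normal_density \<partial>distr M borel Z)"
          unfolding dX by (simp add: nn_integral_distr scaleR_add_left add.assoc)
        also have "\<dots> = (\<integral>\<^sup>+z. \<integral>\<^sup>+x. ennreal (exp (x * s - s * s / 2)) * F (z + x *\<^sub>R b) \<partial>density lborel std_normal_density \<partial>distr M borel Z)"
          by (intro nn_integral_cong nn_integral_std_normal_shift) measurable
        also have "\<dots> = (\<integral>\<^sup>+z. \<integral>\<^sup>+x. ennreal (exp ((z + x *\<^sub>R b) \<bullet> (s *\<^sub>R b) - s * s / 2)) * F (z + x *\<^sub>R b) \<partial>density lborel std_normal_density \<partial>distr M borel Z)"
          by (intro nn_integral_cong_AE eventually_mono[OF AE]) (simp add: inner_add_left bb mult.commute)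
        also have "\<dots> = (\<integral>\<^sup>+z. \<integral>\<^sup>+y. ennreal (exp ((z + y) \<bullet> (s *\<^sub>R b) - s * s / 2)) * F (z + y) \<partial>distr M borel X \<partial>distr M borel Z)"
          unfolding dX by (simp add: nn_integral_distr)
        also have "\<dots> = (\<integral>\<^sup>+\<omega>. ennreal (exp ((Z \<omega> + X \<omega>) \<bullet> (s *\<^sub>R b) - s * s / 2)) * F (Z \<omega> + X \<omega>) \<partial>M)"
          by (rule nn_integral_indep_borel[OF iv, symmetric]) measurable
        also have "\<dots> = (\<integral>\<^sup>+x. ennreal (exp (x \<bullet> (s *\<^sub>R b) - s *\<^sub>R b \<bullet> (s *\<^sub>R b) / 2)) * F x \<partial>distr M borel G)"
          by (simp add: nn_integral_distr ZX[symmetric] bb)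
        finally show "(\<integral>\<^sup>+x. F (x + s *\<^sub>R b) \<partial>distr M borel G) = \<dots>" .
      qed
    qed
  qed simp
qed

text \<open>
  The entries of a complex standard normal matrix have variance 2, hence the law is standard
  Gaussian for the underlying real inner product without any rescaling.
\<close>

lemma standard_gaussian_complex_std_normal_matrix:
  fixes G :: "'a \<Rightarrow> complex^'n^'m"
  assumes G: "complex_std_normal_matrix G"
  shows "random_variable borel G" and "standard_gaussian (distr M borel G)"
proof -
  define C where "C = (\<lambda>(a :: real^'n^'m) (b :: real^'n^'m). (\<chi> i j. of_real (a $ i $ j) + \<i> * of_real (b $ i $ j)) :: complex^'n^'m)"
  obtain G1 G2 where G1: "real_std_normal_matrix G1" and G2: "real_std_normal_matrix G2"
    and ind: "indep_borel G1 G2" and eq: "\<And>\<omega>. G \<omega> = C (G1 \<omega>) (G2 \<omega>)"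
    using G unfolding complex_std_normal_matrix_def C_def by blast
  have C_add: "C a b + C a' b' = C (a + a') (b + b')" for a b a' b'
    by (simp add: C_def vec_eq_iff algebra_simps)
  have C_inner: "C a b \<bullet> C a' b' = a \<bullet> a' + b \<bullet> b'" for a b a' b'
    by (simp add: C_def inner_vec_def inner_complex_def sum.distrib)
  have "continuous_on UNIV (\<lambda>(a, b). C a b)"
    unfolding C_def split_beta' by (intro continuous_intros)
  then have C_meas [measurable]: "(\<lambda>(a, b). C a b) \<in> borel_measurable (borel \<Otimes>\<^sub>M borel)"
    by (simp add: borel_prod borel_measurable_continuous_onI)
  have [measurable]: "random_variable borel G1" "random_variable borel G2"
    using ind by (auto simp: indep_borel_def)
  show G_meas [measurable]: "random_variable borel G"
    unfolding eq[abs_def] by measurable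
  interpret G1: standard_gaussian "distr M borel G1"
    by (rule standard_gaussian_real_std_normal_matrix[OF G1])
  interpret G2: standard_gaussian "distr M borel G2"
    by (rule standard_gaussian_real_std_normal_matrix[OF G2])
  show "standard_gaussian (distr M borel G)"
  proof (rule standard_gaussianI)
    show "prob_space (distr M borel G)" by (rule prob_space_distr) simp
    fix u :: "complex^'n^'m"
    define v w where "v = (\<chi> i j. Re (u $ i $ j))" and "w = (\<chi> i j. Im (u $ i $ j))"
    have u: "u = C v w"
      by (simp add: C_def v_def w_def vec_eq_iff complex_eq_iff)
    show "gaussian_shift (distr M borel G) u"
      unfolding gaussian_shift_def
    proof
      fix F :: "complex^'n^'m \<Rightarrow> ennreal" assume [measurable]: "F \<in> borel_measurable borel"
      let ?e = "\<lambda>x u. ennreal (exp (x \<bullet> u - u \<bullet> u / 2))"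
      have "(\<integral>\<^sup>+x. F (x + u) \<partial>distr M borel G) = (\<integral>\<^sup>+\<omega>. F (C (G1 \<omega> + v) (G2 \<omega> + w)) \<partial>M)"
        by (simp add: nn_integral_distr u eq C_add)
      also have "\<dots> = (\<integral>\<^sup>+a. \<integral>\<^sup>+b. F (C (a + v) (b + w)) \<partial>distr M borel G2 \<partial>distr M borel G1)"
        by (rule nn_integral_indep_borel[OF ind]) measurable
      \<comment> \<open>The imaginary part is shifted in the inner integral and the real part in the
        outer one; \<open>C_inner\<close> merges the two densities.\<close>
      also have "\<dots> = (\<integral>\<^sup>+a. \<integral>\<^sup>+b. ?e b w * F (C (a + v) b) \<partial>distr M borel G2 \<partial>distr M borel G1)"
        by (intro nn_integral_cong bspec[OF G2.gaussian_shift[unfolded gaussian_shift_def]]) measurable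
      also have "\<dots> = (\<integral>\<^sup>+a. ?e a v * (\<integral>\<^sup>+b. ?e b w * F (C a b) \<partial>distr M borel G2) \<partial>distr M borel G1)"
        by (intro bspec[OF G1.gaussian_shift[unfolded gaussian_shift_def]]) measurable
      also have "\<dots> = (\<integral>\<^sup>+a. \<integral>\<^sup>+b. ?e a v * (?e b w * F (C a b)) \<partial>distr M borel G2 \<partial>distr M borel G1)"
        by (intro nn_integral_cong nn_integral_cmult[symmetric]) measurable
      also have "\<dots> = (\<integral>\<^sup>+a. \<integral>\<^sup>+b. ?e (C a b) u * F (C a b) \<partial>distr M borel G2 \<partial>distr M borel G1)"
      proof (intro nn_integral_cong)
        fix a b
        have "a \<bullet> v - v \<bullet> v / 2 + (b \<bullet> w - w \<bullet> w / 2) = C a b \<bullet> u - u \<bullet> u / 2"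
          by (simp add: u C_inner add_divide_distrib)
        then have "?e (C a b) u = ?e a v * ?e b w"
          by (simp only: ennreal_mult'[symmetric] exp_ge_zero exp_add[symmetric])
        then show "?e a v * (?e b w * F (C a b)) = ?e (C a b) u * F (C a b)"
          by (simp only: mult.assoc)
      qed
      also have "\<dots> = (\<integral>\<^sup>+\<omega>. ?e (C (G1 \<omega>) (G2 \<omega>)) u * F (C (G1 \<omega>) (G2 \<omega>)) \<partial>M)"
        by (rule nn_integral_indep_borel[OF ind, symmetric]) measurable
      also have "\<dots> = (\<integral>\<^sup>+x. ?e x u * F x \<partial>distr M borel G)"
        by (simp add: nn_integral_distr eq)
      finally show "(\<integral>\<^sup>+x. F (x + u) \<partial>distr M borel G) = \<dots>" .
    qed
  qed simp
qed

end

section \<open>Error bounds for the sketch\<close>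

lemma rank_0_matrix: "rank (0::'a::field^'n^'m) = 0"
proof -
  have "rows (0::'a^'n^'m) \<subseteq> {0}" by (auto simp: rows_def row_def vec_eq_iff)
  then have "vec.dim (rows (0::'a^'n^'m)) \<le> vec.dim {0 :: 'a^'n}"
    by (rule vec.dim_subset)
  then show ?thesis by (simp add: row_rank_def_gen)
qed

lemma rank_mult_le_right_gen: "rank (A ** B) \<le> rank (B :: 'a::field^'n^'k)"
proof -
  have "row i (A ** B) = (\<Sum>k\<in>UNIV. A $ i $ k *s row k B)" for i
    by (simp add: row_def vec_eq_iff matrix_matrix_mult_def)
  then have "row i (A ** B) \<in> vec.span (rows B)" for i
    by (simp only:) (intro vec.span_sum vec.span_scale vec.span_base, auto simp: rows_def)
  then have "rows (A ** B) \<subseteq> vec.span (rows B)" by (auto simp: rows_def)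
  then show ?thesis
    unfolding row_rank_def_gen by (metis vec.dim_span vec.dim_subset)
qed

text \<open>Gram-Schmidt in terms of projections: a new vector with residual \<open>D\<close> adds
  the rank-one projection along \<open>D\<close>, of trace 1, and a dependent one adds nothing.
  Vectors are written as one-row matrices so that the algebra of matrices applies.\<close>

lemma orthogonal_projection_fixing_vectors:
  fixes W :: "('a::real_or_complex^'n) set"
  assumes "finite W"
  obtains P where "orthogonal_projection P" "inner (mat 1) P \<le> real (card W)"
    "\<And>w. w \<in> W \<Longrightarrow> (\<chi> (i::1). w) ** P = (\<chi> (i::1). w)"
proof -
  have "\<exists>P. orthogonal_projection P \<and> inner (mat 1) P \<le> real (card W) \<and>
    (\<forall>w\<in>W. (\<chi> (i::1). w) ** P = (\<chi> (i::1). w))"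
    using assms
  proof (induction W rule: finite_induct)
    case empty
    show ?case by (intro exI[of _ 0]) (simp add: orthogonal_projection_def)
  next
    case (insert w W)
    then obtain P where P: "orthogonal_projection P" "inner (mat 1) P \<le> real (card W)"
        "\<forall>w\<in>W. (\<chi> (i::1). w) ** P = (\<chi> (i::1). w)" by blast
    have aP: "adjoint_matrix P = P" and PP: "P ** P = P" using P(1) by (auto simp: orthogonal_projection_def)
    define w1 where "w1 = ((\<chi> i. w) :: 'a^'n^1)"
    define D where "D = w1 - w1 ** P"
    define n where "n = (norm D)\<^sup>2"
    show ?case
    proof (cases "D = 0")
      case True
      then have "w1 ** P = w1" by (simp add: D_def)
      with P insert.hyps show ?thesis by (intro exI[of _ P]) (auto simp: w1_def)
    next
      case False
      then have n: "n > 0" by (simp add: n_def)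
      define P' where "P' = P + (1 / n) *\<^sub>R (adjoint_matrix D ** D)"
      have DP: "D ** P = 0" by (simp add: D_def matrix_diff_rdistrib matrix_mul_assoc[symmetric] PP)
      have PD: "P ** adjoint_matrix D = 0"
        using arg_cong[OF DP, of adjoint_matrix] by (simp add: adjoint_matrix_mult aP)
      have DD: "D ** adjoint_matrix D = n *\<^sub>R mat 1"
      proof -
        have "D $ i = D $ 1" for i :: 1 by (metis num1_eq1)
        then have "n = (\<Sum>j\<in>UNIV. inner (D $ 1 $ j) (D $ 1 $ j))"
          by (simp add: n_def dot_square_norm[symmetric] inner_vec_def UNIV_1)
        then have "(\<Sum>k\<in>UNIV. D $ 1 $ k * conjugate (D $ 1 $ k)) = of_real n"
          by (simp only: mult_conjugate_self of_real_sum)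
        then show ?thesis
          by (simp add: vec_eq_iff matrix_matrix_mult_def mat_def forall_1 of_real_def)
      qed
      have w1D: "w1 ** adjoint_matrix D = n *\<^sub>R mat 1"
      proof -
        have "w1 ** adjoint_matrix D = D ** adjoint_matrix D + w1 ** (P ** adjoint_matrix D)"
          by (simp add: D_def matrix_diff_rdistrib matrix_mul_assoc)
        then show ?thesis by (simp add: PD DD)
      qed
      have "adjoint_matrix P' = P'"
        by (simp add: P'_def adjoint_matrix_add adjoint_matrix_scaleR adjoint_matrix_mult aP)
      moreover have "P' ** P' = P'"
      proof -
        have 1: "P ** (adjoint_matrix D ** D) = 0" "adjoint_matrix D ** D ** P = 0"
          by (simp_all add: matrix_mul_assoc PD) (simp add: matrix_mul_assoc[symmetric] DP)
        have "adjoint_matrix D ** D ** (adjoint_matrix D ** D) = adjoint_matrix D ** (D ** adjoint_matrix D) ** D"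
          by (simp only: matrix_mul_assoc)
        then have 2: "adjoint_matrix D ** D ** (adjoint_matrix D ** D) = n *\<^sub>R (adjoint_matrix D ** D)"
          by (simp add: DD matrix_mult_scaleR scaleR_matrix_mult)
        show ?thesis
          using n by (simp add: P'_def matrix_add_ldistrib matrix_add_rdistrib matrix_mult_scaleR scaleR_matrix_mult PP 1 2)
      qed
      moreover have "inner (mat 1) P' \<le> real (card (insert w W))"
        using P(2) insert.hyps n by (simp add: P'_def inner_add_right norm_sq_matrix n_def)
      moreover have "(\<chi> (i::1). w') ** P' = (\<chi> (i::1). w')" if "w' \<in> insert w W" for w'
      proof (cases "w' = w")
        case True
        have "w1 ** P' = w1 ** P + (1 / n) *\<^sub>R (w1 ** adjoint_matrix D ** D)"
          by (simp add: P'_def matrix_add_ldistrib matrix_mult_scaleR matrix_mul_assoc)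
        also have "\<dots> = w1 ** P + D" using n by (simp add: w1D scaleR_matrix_mult)
        also have "\<dots> = w1" by (simp add: D_def)
        finally show ?thesis using True by (simp add: w1_def)
      next
        case False
        let ?w = "(\<chi> (i::1). w')"
        have w': "?w ** P = ?w" using P(3) that False by blast
        then have "?w ** adjoint_matrix D = ?w ** (P ** adjoint_matrix D)" by (simp add: matrix_mul_assoc)
        then have "?w ** adjoint_matrix D = 0" by (simp add: PD)
        then show ?thesis
          by (simp add: P'_def matrix_add_ldistrib matrix_mult_scaleR matrix_mul_assoc w')
      qed
      ultimately show ?thesis unfolding orthogonal_projection_def by blast
    qed
  qed
  then show thesis using that by blast
qed

text \<open>The vectors fixed by \<open>P\<close> form a subspace; containing a basis of the row
  space, it contains every row of \<open>B\<close>.\<close>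

lemma orthogonal_projection_row_space:
  fixes B :: "'a::real_or_complex^'n^'m"
  obtains P where "orthogonal_projection P" "inner (mat 1) P \<le> real (rank B)" "B ** P = B"
proof -
  obtain W where W: "W \<subseteq> rows B" "rows B \<subseteq> vec.span W" "card W = vec.dim (rows B)"
    by (metis vec.basis_exists)
  have "rows B = range (\<lambda>i. row i B)" by (auto simp: rows_def)
  then have "finite (rows B)" by simp
  then have "finite W" using W(1) finite_subset by blast
  then obtain P where P: "orthogonal_projection P" "inner (mat 1) P \<le> real (card W)"
    and fix_W: "\<And>w. w \<in> W \<Longrightarrow> (\<chi> (i::1). w) ** P = (\<chi> (i::1). w)"
    by (rule orthogonal_projection_fixing_vectors) blast
  let ?S = "{w. (\<chi> (i::1). w) ** P = (\<chi> (i::1). w)}"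
  have sub: "vec.subspace ?S"
    unfolding vec.subspace_def
    by (auto simp: vec_eq_iff matrix_matrix_mult_def distrib_right sum.distrib mult.assoc sum_distrib_left[symmetric])
  have "W \<subseteq> ?S" using fix_W by blast
  then have "vec.span W \<subseteq> ?S" by (rule vec.span_minimal[OF _ sub])
  then have "row i B \<in> ?S" for i using W(2) by (auto simp: rows_def)
  then have "(B ** P) $ i $ j = B $ i $ j" for i j
    by (simp add: vec_eq_iff matrix_matrix_mult_def row_def)
  then have "B ** P = B" by (simp add: vec_eq_iff)
  moreover have "inner (mat 1) P \<le> real (rank B)" using P(2) W(3) by (simp add: row_rank_def_gen)
  ultimately show thesis using that P(1) by blast
qed

section \<open>Residuals of projections and the two stages of the sketch\<close>

lemma norm_projection_decomp:
  fixes Y :: "'a::real_or_complex^'n^'m"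
  assumes P: "orthogonal_projection P"
  shows "norm Y ^ 2 = norm (P ** Y) ^ 2 + norm (Y - P ** Y) ^ 2"
proof -
  have "inner (P ** Y) (Y - P ** Y) = inner Y (P ** Y - P ** P ** Y)"
    using P by (simp add: inner_mult_left_matrix orthogonal_projection_def matrix_diff_ldistrib matrix_mul_assoc)
  also have "\<dots> = 0" using P by (simp add: orthogonal_projection_def)
  finally have "norm (P ** Y + (Y - P ** Y)) ^ 2 = norm (P ** Y) ^ 2 + norm (Y - P ** Y) ^ 2"
    by (intro norm_add_Pythagorean) (simp add: orthogonal_def)
  then show ?thesis by simp
qed

lemma norm_projection_le:
  fixes Y :: "'a::real_or_complex^'n^'m"
  assumes "orthogonal_projection P"
  shows "norm (P ** Y) \<le> norm Y" "norm (Y - P ** Y) \<le> norm Y"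
proof -
  have le: "norm (P ** Y) ^ 2 \<le> norm Y ^ 2" "norm (Y - P ** Y) ^ 2 \<le> norm Y ^ 2"
    using norm_projection_decomp[OF assms, of Y] by auto
  show "norm (P ** Y) \<le> norm Y" by (rule power2_le_imp_le[OF le(1) norm_ge_zero])
  show "norm (Y - P ** Y) \<le> norm Y" by (rule power2_le_imp_le[OF le(2) norm_ge_zero])
qed

lemma orthonormal_columns_projection:
  fixes Q :: "'a::real_or_complex^'k^'m"
  assumes "orthonormal_columns Q"
  shows "orthogonal_projection (Q ** adjoint_matrix Q)"
    and "inner (mat 1) (Q ** adjoint_matrix Q) = real CARD('k)"
    and "norm (Q ** Y) = norm Y"
    and "norm (adjoint_matrix Q ** Z) \<le> norm Z"
proof -
  have Q: "adjoint_matrix Q ** Q = mat 1" using assms by (simp add: orthonormal_columns_def)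
  have "Q ** adjoint_matrix Q ** (Q ** adjoint_matrix Q) = Q ** (adjoint_matrix Q ** Q) ** adjoint_matrix Q"
    by (simp only: matrix_mul_assoc)
  then show P: "orthogonal_projection (Q ** adjoint_matrix Q)"
    by (simp add: orthogonal_projection_def adjoint_matrix_mult Q)
  have "inner (mat 1) (Q ** adjoint_matrix Q) = inner (adjoint_matrix Q) (adjoint_matrix Q)"
    using inner_mat_1[of "adjoint_matrix Q" "adjoint_matrix Q"] by simp
  also have "\<dots> = inner (mat 1) (adjoint_matrix Q ** Q)"
    by (simp add: inner_adjoint inner_mat_1)
  finally show "inner (mat 1) (Q ** adjoint_matrix Q) = real CARD('k)"
    by (simp add: Q inner_mat_1_mat_1)
  have n: "norm (Q ** Y) = norm Y" for Y :: "'a^'z^'k"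
    by (simp add: norm_eq_sqrt_inner inner_mult_left_matrix matrix_mul_assoc Q)
  then show "norm (Q ** Y) = norm Y" .
  have "norm (adjoint_matrix Q ** Z) = norm (Q ** adjoint_matrix Q ** Z)"
    by (simp add: n matrix_mul_assoc[symmetric])
  also have "\<dots> \<le> norm Z" by (rule norm_projection_le[OF P])
  finally show "norm (adjoint_matrix Q ** Z) \<le> norm Z" .
qed

text \<open>The columns of the pseudoinverse lie in the range of the adjoint of
  \<open>x ** P\<close>, which \<open>P\<close> fixes.\<close>

lemma projection_mult_pseudoinverse:
  fixes x :: "'a::real_or_complex^'m^'l"
  assumes "orthogonal_projection P"
  shows "P ** pseudoinverse (x ** P) = pseudoinverse (x ** P)"
proof -
  let ?G = "x ** P" and ?K = "pseudoinverse (x ** P)"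
  have K: "?K ** ?G ** ?K = ?K" "adjoint_matrix (?K ** ?G) = ?K ** ?G"
    using is_pseudoinverse_pseudoinverse[of ?G] by (auto simp: is_pseudoinverse_def)
  then have "?K = adjoint_matrix ?G ** adjoint_matrix ?K ** ?K"
    by (simp add: adjoint_matrix_mult)
  moreover have "P ** adjoint_matrix ?G = adjoint_matrix ?G"
    using assms by (simp add: adjoint_matrix_mult orthogonal_projection_def matrix_mul_assoc)
  ultimately show ?thesis by (metis matrix_mul_assoc)
qed

text \<open>\<open>N\<close> is orthogonal to the range of \<open>P\<close>, where the subtracted
  term takes its values. By Pythagoras the squares add, which is the origin of the 1 in
  \<open>1 + f\<close>.\<close>

lemma (in gaussian_projection) nn_integral_residual_le:
  fixes N :: "'a^'n^'m"
  defines "c \<equiv> real DIM('a)" and "p \<equiv> inner (mat 1) P"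
  defines "\<kappa> \<equiv> c * (real CARD('l) - p) - (2 - c)"
  assumes \<kappa>: "\<kappa> > 0" and PN: "P ** N = 0"
  shows "(\<integral>\<^sup>+x. ennreal (norm (N - pseudoinverse (x ** P) ** x ** N) ^ 2) \<partial>\<mu>)
    \<le> ennreal ((1 + c * p / \<kappa>) * norm N ^ 2)"
proof -
  have eq: "norm (N - pseudoinverse (x ** P) ** x ** N) ^ 2 = norm N ^ 2 + norm (pseudoinverse (x ** P) ** x ** N) ^ 2"
    for x :: "'a^'m^'l"
  proof -
    have "P ** (N - pseudoinverse (x ** P) ** x ** N) = - (pseudoinverse (x ** P) ** x ** N)"
      using projection_mult_pseudoinverse[OF P, of x] PN by (simp add: matrix_diff_ldistrib matrix_mul_assoc)
    then show ?thesis
      using norm_projection_decomp[OF P, of "N - pseudoinverse (x ** P) ** x ** N"] by simp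
  qed
  have p0: "p \<ge> 0" unfolding p_def norm_orthogonal_projection_sq[OF P, symmetric] by simp
  have "(\<integral>\<^sup>+x. ennreal (norm (N - pseudoinverse (x ** P) ** x ** N) ^ 2) \<partial>\<mu>)
      = (\<integral>\<^sup>+x. ennreal (norm N ^ 2) + ennreal (norm (pseudoinverse (x ** P) ** x ** N) ^ 2) \<partial>\<mu>)"
    by (simp add: eq ennreal_plus)
  also have "\<dots> = ennreal (norm N ^ 2) + (\<integral>\<^sup>+x. ennreal (norm (pseudoinverse (x ** P) ** x ** N) ^ 2) \<partial>\<mu>)"
    by (subst nn_integral_add) (auto simp: emeasure_space_1)
  also have "\<dots> \<le> ennreal (norm N ^ 2) + ennreal (c * p / \<kappa> * norm N ^ 2)"
    using nn_integral_pseudoinverse_mult_le[OF \<kappa>[unfolded \<kappa>_def c_def p_def] PN]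
    by (intro add_left_mono) (simp add: \<kappa>_def c_def p_def)
  also have "\<dots> = ennreal ((1 + c * p / \<kappa>) * norm N ^ 2)"
    using \<kappa> p0 by (simp add: ennreal_plus[symmetric] c_def algebra_simps del: ennreal_plus)
  finally show ?thesis .
qed

text \<open>\<open>(2 - c) / c\<close> for the real dimension \<open>c\<close> of the field is the parameter \<open>\<alpha>\<close>.\<close>

definition field_defect :: "'a::real_or_complex itself \<Rightarrow> nat \<Rightarrow> bool" where
  "field_defect _ \<alpha> \<longleftrightarrow> 2 - real DIM('a) = real DIM('a) * real \<alpha>"

lemma field_defect_real: "field_defect TYPE(real) 1"
  and field_defect_complex: "field_defect TYPE(complex) 0"
  by (simp_all add: field_defect_def)

text \<open>The field dimension cancels by \<open>field_defect\<close>. Since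
  \<open>p / (l - p - \<alpha>)\<close> increases with \<open>p\<close>, an upper bound
  \<open>s\<close> on the trace is enough.\<close>

lemma (in gaussian_projection) nn_integral_residual_le_sketch_factor:
  fixes N :: "'a^'n^'m"
  assumes \<alpha>: "field_defect TYPE('a) \<alpha>" and s: "inner (mat 1) P \<le> real s" "s + \<alpha> < CARD('l)"
    and PN: "P ** N = 0"
  shows "(\<integral>\<^sup>+x. ennreal (norm (N - pseudoinverse (x ** P) ** x ** N) ^ 2) \<partial>\<mu>)
    \<le> ennreal ((1 + sketch_factor \<alpha> s CARD('l)) * norm N ^ 2)"
proof -
  define c where "c = real DIM('a)"
  define p where "p = inner (mat 1) P"
  have c: "c > 0" by (simp add: c_def)
  have d: "real CARD('l) - real s - real \<alpha> > 0"
    using s(2) by linarith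
  have p: "p \<ge> 0" unfolding p_def norm_orthogonal_projection_sq[OF P, symmetric] by simp
  have \<kappa>: "c * (real CARD('l) - p) - (2 - c) = c * (real CARD('l) - p - real \<alpha>)"
    using \<alpha> by (simp add: field_defect_def c_def algebra_simps)
  have dp: "real CARD('l) - p - real \<alpha> > 0" using d s(1) by (simp add: p_def)
  then have \<kappa>0: "c * (real CARD('l) - p) - (2 - c) > 0" unfolding \<kappa> using c by simp
  have "c * p / (c * (real CARD('l) - p) - (2 - c)) = p / (real CARD('l) - p - real \<alpha>)"
    unfolding \<kappa> using c by simp
  also have "\<dots> \<le> sketch_factor \<alpha> s CARD('l)"
    unfolding sketch_factor_def using d s(1) p by (intro frac_le) (auto simp: p_def)
  finally have "(1 + c * p / (c * (real CARD('l) - p) - (2 - c))) * norm N ^ 2 \<le> (1 + sketch_factor \<alpha> s CARD('l)) * norm N ^ 2"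
    by (intro mult_right_mono) auto
  with nn_integral_residual_le[OF \<kappa>0[unfolded c_def p_def] PN] show ?thesis
    unfolding c_def p_def by (meson ennreal_leI order_trans)
qed

text \<open>\<Omega> multiplies \<open>A\<close> from the right, so its adjoint takes the role of
  \<open>x\<close> in the range finder.\<close>

lemma standard_gaussian_distr_adjoint:
  fixes \<mu> :: "('a::real_or_complex^'m^'l) measure"
  assumes "standard_gaussian \<mu>"
  shows "standard_gaussian (distr \<mu> borel adjoint_matrix)"
proof (rule standard_gaussian.standard_gaussian_distr_isometry[OF assms])
  show "linear (adjoint_matrix :: 'a^'m^'l \<Rightarrow> _)"
    by (rule linearI) (auto simp: adjoint_matrix_add adjoint_matrix_scaleR)
  show "surj (adjoint_matrix :: 'a^'m^'l \<Rightarrow> _)" by (metis adjoint_matrix_adjoint surjI)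
qed (rule inner_adjoint)

text \<open>
  The columns of \<open>A \<Omega> Z\<close> lie in the range of \<open>Q \<Omega>\<close> for every \<open>Z\<close>, so the projection error is at most
  \<open>\<parallel>A - A \<Omega> Z\<parallel>\<close>. With \<open>Z\<close> the adjoint of the pseudoinverse of \<open>\<Omega>\<^sup>* P\<close>, this is the adjoint of the
  residual of \<open>N\<close>.
\<close>

lemma nn_integral_range_finder_le:
  fixes \<mu> :: "('a::real_or_complex^'k^'n) measure" and A B :: "'a^'n^'m" and Q :: "'a^'k^'n \<Rightarrow> 'a^'k^'m"
  assumes \<mu>: "standard_gaussian \<mu>" and \<alpha>: "field_defect TYPE('a) \<alpha>"
    and B: "rank B \<le> s" "s + \<alpha> < CARD('k)"
    and Q: "\<And>\<Omega>. orthonormal_columns (Q \<Omega>)" "\<And>\<Omega>. \<exists>R. A ** \<Omega> = Q \<Omega> ** R"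
  shows "(\<integral>\<^sup>+\<Omega>. ennreal (norm (A - Q \<Omega> ** adjoint_matrix (Q \<Omega>) ** A) ^ 2) \<partial>\<mu>)
     \<le> ennreal ((1 + sketch_factor \<alpha> s CARD('k)) * norm (A - B) ^ 2)"
proof -
  obtain P where BP: "orthogonal_projection P" "inner (mat 1) P \<le> real (rank B)" "B ** P = B"
    by (rule orthogonal_projection_row_space)
  have aP: "adjoint_matrix P = P" and PP: "P ** P = P" using BP(1) by (auto simp: orthogonal_projection_def)
  interpret \<mu>: standard_gaussian \<mu> by (rule \<mu>)
  interpret gaussian_projection "distr \<mu> borel adjoint_matrix" P
    by (intro gaussian_projection.intro standard_gaussian_distr_adjoint \<mu> gaussian_projection_axioms.intro BP(1))
  have p_le: "inner (mat 1) P \<le> real s" using BP(2) B(1) by linarith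
  define N where "N = adjoint_matrix A - P ** adjoint_matrix A"
  have PN: "P ** N = 0" by (simp add: N_def matrix_diff_ldistrib matrix_mul_assoc PP)
  let ?res = "\<lambda>x :: 'a^'n^'k. norm (N - pseudoinverse (x ** P) ** x ** N) ^ 2"
  have "norm N \<le> norm (A - B)"
  proof -
    have "P ** adjoint_matrix B = adjoint_matrix B"
      using arg_cong[OF BP(3), of adjoint_matrix] by (simp add: adjoint_matrix_mult aP)
    then have "N = adjoint_matrix (A - B) - P ** adjoint_matrix (A - B)"
      by (simp add: N_def adjoint_matrix_minus matrix_diff_ldistrib)
    then show ?thesis using norm_projection_le(2)[OF BP(1), of "adjoint_matrix (A - B)"] by simp
  qed
  then have N: "norm N ^ 2 \<le> norm (A - B) ^ 2" by (simp add: power_mono)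
  have range: "norm (A - Q \<Omega> ** adjoint_matrix (Q \<Omega>) ** A) ^ 2 \<le> ?res (adjoint_matrix \<Omega>)"
    if "pseudoinverse (adjoint_matrix \<Omega> ** P) ** (adjoint_matrix \<Omega> ** P) = P" for \<Omega>
  proof -
    define K where "K = pseudoinverse (adjoint_matrix \<Omega> ** P)"
    define Z where "Z = adjoint_matrix K"
    let ?P = "Q \<Omega> ** adjoint_matrix (Q \<Omega>)"
    have q: "adjoint_matrix (Q \<Omega>) ** Q \<Omega> = mat 1" using Q(1) by (simp add: orthonormal_columns_def)
    obtain R where R: "A ** \<Omega> = Q \<Omega> ** R" using Q(2) by blast
    have "?P ** (A ** \<Omega>) = Q \<Omega> ** (adjoint_matrix (Q \<Omega>) ** Q \<Omega>) ** R"
      by (simp only: R matrix_mul_assoc)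
    then have "?P ** (A ** \<Omega>) = A ** \<Omega>" by (simp add: q R)
    then have PA: "?P ** (A ** \<Omega> ** Z) = A ** \<Omega> ** Z" by (metis matrix_mul_assoc)
    have "adjoint_matrix (K ** (adjoint_matrix \<Omega> ** P)) = P"
      using that by (simp add: K_def aP)
    then have PZ: "P ** \<Omega> ** Z = P" by (simp add: adjoint_matrix_mult aP Z_def)
    have aN: "adjoint_matrix N = A - A ** P"
      by (simp add: N_def adjoint_matrix_minus adjoint_matrix_mult aP)
    have "adjoint_matrix (N - K ** adjoint_matrix \<Omega> ** N) = adjoint_matrix N - adjoint_matrix N ** \<Omega> ** Z"
      by (simp add: adjoint_matrix_minus adjoint_matrix_mult Z_def matrix_mul_assoc)
    \<comment> \<open>The contribution of \<open>A ** P\<close> cancels, because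
      \<open>P ** \<Omega> ** Z = P\<close>.\<close>
    also have "\<dots> = A - A ** \<Omega> ** Z - (A ** P - A ** (P ** \<Omega> ** Z))"
      by (simp add: aN matrix_diff_rdistrib matrix_mul_assoc)
    also have "\<dots> = A - A ** \<Omega> ** Z" by (simp add: PZ)
    finally have eq: "adjoint_matrix (N - K ** adjoint_matrix \<Omega> ** N) = A - A ** \<Omega> ** Z" .
    have "A - ?P ** A = (A - A ** \<Omega> ** Z) - ?P ** (A - A ** \<Omega> ** Z)"
      by (simp add: matrix_diff_ldistrib PA)
    then have "norm (A - ?P ** A) = norm ((A - A ** \<Omega> ** Z) - ?P ** (A - A ** \<Omega> ** Z))"
      by (simp only:)
    also have "\<dots> \<le> norm (A - A ** \<Omega> ** Z)"
      by (rule norm_projection_le(2)[OF orthonormal_columns_projection(1)[OF Q(1)[of \<Omega>]], of "A - A ** \<Omega> ** Z"])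
    also have "\<dots> = norm (N - K ** adjoint_matrix \<Omega> ** N)"
      unfolding eq[symmetric] by simp
    finally show ?thesis by (simp add: K_def power_mono)
  qed
  have AE: "AE x in distr \<mu> borel adjoint_matrix. pseudoinverse (x ** P) ** (x ** P) = P"
  proof (rule AE_pseudoinverse_mult)
    have "real DIM('a) * (real CARD('k) - inner (mat 1) P - real \<alpha>) > 0"
      using p_le B(2) by (intro mult_pos_pos) (auto simp: DIM_positive)
    then show "0 < real DIM('a) * (real CARD('k) - inner (mat 1) P) - (2 - real DIM('a))"
      using \<alpha> by (simp add: field_defect_def algebra_simps)
  qed
  have "AE \<Omega> in \<mu>. pseudoinverse (adjoint_matrix \<Omega> ** P) ** (adjoint_matrix \<Omega> ** P) = P"
    using AE by (subst (asm) AE_distr_iff) auto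
  then have "(\<integral>\<^sup>+\<Omega>. ennreal (norm (A - Q \<Omega> ** adjoint_matrix (Q \<Omega>) ** A) ^ 2) \<partial>\<mu>)
      \<le> (\<integral>\<^sup>+\<Omega>. ennreal (?res (adjoint_matrix \<Omega>)) \<partial>\<mu>)"
    by (intro nn_integral_mono_AE, eventually_elim) (intro ennreal_leI range)
  also have "\<dots> = (\<integral>\<^sup>+x. ennreal (?res x) \<partial>distr \<mu> borel adjoint_matrix)"
    by (subst nn_integral_distr) auto
  also have "\<dots> \<le> ennreal ((1 + sketch_factor \<alpha> s CARD('k)) * norm N ^ 2)"
    by (rule nn_integral_residual_le_sketch_factor[OF \<alpha> p_le B(2) PN])
  also have "\<dots> \<le> ennreal ((1 + sketch_factor \<alpha> s CARD('k)) * norm (A - B) ^ 2)"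
    using B(2) by (intro ennreal_leI mult_left_mono N) (auto simp: sketch_factor_def)
  finally show ?thesis .
qed

text \<open>Almost surely the sketch reproduces the component \<open>P ** A\<close> exactly, so only
  the part \<open>N\<close> orthogonal to the range of \<open>Q\<close> causes error beyond what is
  already lost.\<close>

lemma nn_integral_sketch_le:
  fixes \<nu> :: "('a::real_or_complex^'m^'l) measure" and A :: "'a^'n^'m" and Q :: "'a^'k^'m"
  assumes \<nu>: "standard_gaussian \<nu>" and \<alpha>: "field_defect TYPE('a) \<alpha>"
    and kl: "CARD('k) + \<alpha> < CARD('l)" and Q: "orthonormal_columns Q"
  shows "(\<integral>\<^sup>+\<Psi>. ennreal (norm (A - Q ** (pseudoinverse (\<Psi> ** Q) ** (\<Psi> ** A))) ^ 2) \<partial>\<nu>)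
     \<le> ennreal ((1 + sketch_factor \<alpha> CARD('k) CARD('l)) * norm (A - Q ** adjoint_matrix Q ** A) ^ 2)"
proof -
  define P where "P = Q ** adjoint_matrix Q"
  have P: "orthogonal_projection P" and p: "inner (mat 1) P = real CARD('k)"
    using orthonormal_columns_projection[OF Q] by (auto simp: P_def)
  interpret gaussian_projection \<nu> P
    by (intro gaussian_projection.intro \<nu> gaussian_projection_axioms.intro P)
  define N where "N = A - P ** A"
  have PN: "P ** N = 0" using P by (simp add: N_def matrix_diff_ldistrib matrix_mul_assoc orthogonal_projection_def)
  have "AE \<Psi> in \<nu>. pseudoinverse (\<Psi> ** P) ** (\<Psi> ** P) = P"
  proof (rule AE_pseudoinverse_mult)
    have "real DIM('a) * (real CARD('l) - inner (mat 1) P - real \<alpha>) > 0"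
      using kl p by (intro mult_pos_pos) (auto simp: DIM_positive)
    then show "0 < real DIM('a) * (real CARD('l) - inner (mat 1) P) - (2 - real DIM('a))"
      using \<alpha> by (simp add: field_defect_def algebra_simps)
  qed
  then have "(\<integral>\<^sup>+\<Psi>. ennreal (norm (A - Q ** (pseudoinverse (\<Psi> ** Q) ** (\<Psi> ** A))) ^ 2) \<partial>\<nu>)
     = (\<integral>\<^sup>+\<Psi>. ennreal (norm (N - pseudoinverse (\<Psi> ** P) ** \<Psi> ** N) ^ 2) \<partial>\<nu>)"
  proof (intro nn_integral_cong_AE, eventually_elim)
    fix \<Psi> :: "'a^'m^'l" assume K: "pseudoinverse (\<Psi> ** P) ** (\<Psi> ** P) = P"
    let ?K = "pseudoinverse (\<Psi> ** P)"
    have "Q ** (pseudoinverse (\<Psi> ** Q) ** (\<Psi> ** A)) = ?K ** (\<Psi> ** A)"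
      unfolding P_def pseudoinverse_orthonormal_columns[OF Q] by (simp only: matrix_mul_assoc)
    moreover have "N - ?K ** \<Psi> ** N = A - ?K ** (\<Psi> ** A) - (P ** A - ?K ** (\<Psi> ** P) ** A)"
      by (simp add: N_def matrix_diff_ldistrib matrix_mul_assoc)
    ultimately show "ennreal (norm (A - Q ** (pseudoinverse (\<Psi> ** Q) ** (\<Psi> ** A))) ^ 2)
      = ennreal (norm (N - ?K ** \<Psi> ** N) ^ 2)" by (simp add: K)
  qed
  also have "\<dots> \<le> ennreal ((1 + sketch_factor \<alpha> CARD('k) CARD('l)) * norm N ^ 2)"
    by (rule nn_integral_residual_le_sketch_factor[OF \<alpha> _ kl PN]) (simp add: p)
  finally show ?thesis by (simp add: N_def P_def)
qed

section \<open>Tail energies, truncation and the expected error\<close>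

lemma tail_energy_sq:
  fixes A :: "'a::real_normed_field^'n^'m"
  shows "tail_energy (j + 1) A ^ 2 = (INF B\<in>{B. rank B < j + 1}. norm (A - B) ^ 2)"
    and "0 \<le> tail_energy (j + 1) A"
proof -
  \<comment> \<open>The index \<open>j + 1\<close> admits the zero matrix as a competitor, so the
    infimum is over a nonempty set.\<close>
  have "{B :: 'a^'n^'m. rank B < j + 1} \<noteq> {}" by (auto intro!: exI[of _ 0] simp: rank_0_matrix)
  then have "0 \<le> (INF B\<in>{B. rank B < j + 1}. norm (A - B) ^ 2)" by (rule cINF_greatest) simp
  then show "tail_energy (j + 1) A ^ 2 = (INF B\<in>{B. rank B < j + 1}. norm (A - B) ^ 2)"
    "0 \<le> tail_energy (j + 1) A"
    by (simp_all add: tail_energy_def)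
qed

text \<open>A bound valid for every competitor \<open>B\<close> passes to the infimum; all upper
  bounds by tail energies are obtained in this way.\<close>

lemma le_mult_tail_energy_sq:
  fixes A :: "'a::real_normed_field^'n^'m"
  assumes c: "c \<ge> 0" and le: "\<And>B :: 'a^'n^'m. rank B \<le> j \<Longrightarrow> x \<le> c * norm (A - B) ^ 2"
  shows "x \<le> c * tail_energy (j + 1) A ^ 2"
proof -
  let ?S = "{B :: 'a^'n^'m. rank B < j + 1}"
  have ne: "?S \<noteq> {}" by (auto intro!: exI[of _ 0] simp: rank_0_matrix)
  show ?thesis
  \<comment> \<open>Division by \<open>c\<close> is impossible here; the zero matrix as competitor
    gives \<open>x \<le> 0\<close>.\<close>
  proof (cases "c = 0")
    case True
    then show ?thesis using le[of 0] by (simp add: rank_0_matrix)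
  next
    case False
    then have "x / c \<le> norm (A - B) ^ 2" if "B \<in> ?S" for B
      using le[of B] that c by (simp add: field_simps)
    then have "x / c \<le> (INF B\<in>?S. norm (A - B) ^ 2)" by (rule cINF_greatest[OF ne])
    then show ?thesis using False c unfolding tail_energy_sq(1) by (simp add: field_simps)
  qed
qed

text \<open>For a competitor \<open>C\<close> of rank at most \<open>r\<close>, the matrix
  \<open>adjoint_matrix Q ** C\<close> competes with \<open>X'\<close>. The error
  \<open>norm (A - Q ** X)\<close> is paid twice: in going from \<open>A\<close> to
  \<open>Q ** X\<close>, and in comparing \<open>Q ** X\<close> with \<open>C\<close> instead of
  \<open>A\<close> with \<open>C\<close>.\<close>

lemma norm_fixed_rank_le:
  fixes A :: "'a::real_or_complex^'n^'m" and Q :: "'a^'k^'m" and X :: "'a^'n^'k"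
  assumes Q: "orthonormal_columns Q" and T: "is_best_rank_approx r X X'"
  shows "norm (A - Q ** X') \<le> tail_energy (r + 1) A + 2 * norm (A - Q ** X)"
proof -
  define d where "d = norm (A - Q ** X') - 2 * norm (A - Q ** X)"
  have d: "d \<le> norm (A - C)" if C: "rank C \<le> r" for C :: "'a^'n^'m"
  proof -
    have "rank (adjoint_matrix Q ** C) \<le> r" using rank_mult_le_right_gen[of "adjoint_matrix Q" C] C by linarith
    then have "norm (X - X') \<le> norm (X - adjoint_matrix Q ** C)"
      using T by (simp add: is_best_rank_approx_def)
    also have "X - adjoint_matrix Q ** C = adjoint_matrix Q ** (Q ** X - C)"
      using Q by (simp add: matrix_diff_ldistrib matrix_mul_assoc orthonormal_columns_def)
    also have "norm \<dots> \<le> norm (Q ** X - C)" by (rule orthonormal_columns_projection(4)[OF Q])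
    finally have "norm (Q ** X - Q ** X') \<le> norm (Q ** X - C)"
      by (simp add: matrix_diff_ldistrib[symmetric] orthonormal_columns_projection(3)[OF Q])
    also have "\<dots> \<le> norm (A - Q ** X) + norm (A - C)"
      using norm_triangle_ineq4[of "A - C" "A - Q ** X"] by (simp add: norm_minus_commute)
    finally have "norm (Q ** X - Q ** X') \<le> norm (A - Q ** X) + norm (A - C)" .
    moreover have "norm (A - Q ** X') \<le> norm (A - Q ** X) + norm (Q ** X - Q ** X')"
      using norm_triangle_ineq[of "A - Q ** X" "Q ** X - Q ** X'"] by simp
    ultimately show ?thesis by (simp add: d_def)
  qed
  have "d \<le> tail_energy (r + 1) A"
  \<comment> \<open>The tail energy is accessible through its square only, and \<open>d\<close> may
    be negative.\<close>
  proof (cases "d \<le> 0")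
    case True
    then show ?thesis using tail_energy_sq(2)[of r A] by linarith
  next
    case False
    have "d ^ 2 \<le> 1 * tail_energy (r + 1) A ^ 2"
      using d False by (intro le_mult_tail_energy_sq) (auto intro!: power_mono)
    then show ?thesis
      by (intro power2_le_imp_le[of d]) (use tail_energy_sq(2)[of r A] in simp_all)
  qed
  then show ?thesis by (simp add: d_def)
qed

text \<open>Jensen's inequality in the form of nonnegative variance; integrability of
  \<open>Y\<close> follows from \<open>|y| \<le> 1 + y^2\<close>.\<close>

lemma (in prob_space) expectation_le_sqrt:
  fixes Y :: "'a \<Rightarrow> real"
  assumes [measurable]: "random_variable borel Y"
    and le: "(\<integral>\<^sup>+\<omega>. ennreal (Y \<omega> ^ 2) \<partial>M) \<le> ennreal c" and c: "c \<ge> 0"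
  shows "integrable M Y" and "expectation Y \<le> sqrt c"
proof -
  have Y2: "integrable M (\<lambda>\<omega>. Y \<omega> ^ 2)"
    using le by (intro integrableI_nonneg) (auto simp: le_less_trans)
  show Y: "integrable M Y"
  proof (rule Bochner_Integration.integrable_bound)
    show "integrable M (\<lambda>\<omega>. 1 + Y \<omega> ^ 2)" using Y2 by simp
    have "\<bar>y\<bar> \<le> 1 + y ^ 2" for y :: real
      using zero_le_power2[of "\<bar>y\<bar> - 1"] by (simp add: power2_diff)
    then show "AE \<omega> in M. norm (Y \<omega>) \<le> norm (1 + Y \<omega> ^ 2)" by simp
  qed simp
  have "ennreal (expectation (\<lambda>\<omega>. Y \<omega> ^ 2)) \<le> ennreal c"
    using le nn_integral_eq_integral[OF Y2] by simp
  then have "expectation (\<lambda>\<omega>. Y \<omega> ^ 2) \<le> c" using c by (simp add: ennreal_le_iff)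
  moreover have "0 \<le> expectation (\<lambda>\<omega>. Y \<omega> ^ 2) - expectation Y ^ 2"
    using variance_eq[OF Y Y2] variance_positive by metis
  ultimately show "expectation Y \<le> sqrt c" by (intro real_le_rsqrt) linarith
qed

text \<open>\<open>Q\<close> is a function of \<Omega> alone, so independence permits integrating
  the squared error of \<open>Q X\<close> over \<Psi> with \<open>Q\<close> frozen, and then over
  \<Omega>. This holds for every admissible \<rho>; the truncation to rank \<open>r\<close> is added
  pointwise at the end.\<close>

lemma (in prob_space) expectation_fixed_rank_error_le:
  fixes A :: "'a1::real_or_complex^'n^'m" and \<Omega> :: "'a \<Rightarrow> 'a1^'k::{finite,linorder}^'n" and \<Psi> :: "'a \<Rightarrow> 'a1^'m^'l"
  assumes \<alpha>: "field_defect TYPE('a1) \<alpha>" and r: "1 \<le> r" "CARD('k) > r + \<alpha>" and l: "CARD('l) > CARD('k) + \<alpha>"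
    and qr: "qr_procedure qr" and T: "best_rank_selection r T"
    and \<Omega>: "standard_gaussian (distr M borel \<Omega>)" and \<Psi>: "standard_gaussian (distr M borel \<Psi>)"
    and ind: "indep_borel \<Omega> \<Psi>"
  shows "integrable M (\<lambda>\<omega>. norm (A - fixed_rank_approx qr T A (\<Omega> \<omega>) (\<Psi> \<omega>)))"
    and "expectation (\<lambda>\<omega>. norm (A - fixed_rank_approx qr T A (\<Omega> \<omega>) (\<Psi> \<omega>)))
          \<le> tail_energy (r + 1) A
            + 2 * sqrt (1 + sketch_factor \<alpha> CARD('k) CARD('l))
              * (MIN \<rho>\<in>{\<rho>. 1 \<le> \<rho> \<and> \<rho> + \<alpha> < CARD('k)}.
                   sqrt (1 + sketch_factor \<alpha> \<rho> CARD('k)) * tail_energy (\<rho> + 1) A)"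
proof -
  have [measurable]: "random_variable borel \<Omega>" "random_variable borel \<Psi>"
    using ind by (auto simp: indep_borel_def)
  have qr_m [measurable]: "qr \<in> borel_measurable borel" and T_m [measurable]: "T \<in> borel_measurable borel"
    using qr T by (auto simp: qr_procedure_def best_rank_selection_def)
  define Q where "Q = sketch_Q qr A"
  define X where "X = (\<lambda>\<Omega> (\<Psi> :: 'a1^'m^'l). pseudoinverse (\<Psi> ** Q \<Omega>) ** (\<Psi> ** A))"
  have Q: "orthonormal_columns (Q \<Omega>)" "\<exists>R. A ** \<Omega> = Q \<Omega> ** R" for \<Omega>
    using qr unfolding qr_procedure_def qr_factorization_def Q_def sketch_Q_def by blast+
  have [measurable]: "Q \<in> borel_measurable borel"
    unfolding Q_def sketch_Q_def by measurable
  define Y where "Y = (\<lambda>\<omega>. norm (A - Q (\<Omega> \<omega>) ** X (\<Omega> \<omega>) (\<Psi> \<omega>)))"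
  have X_meas [measurable]: "(\<lambda>\<omega>. X (\<Omega> \<omega>) (\<Psi> \<omega>)) \<in> borel_measurable M"
    unfolding X_def by measurable
  have Y_meas [measurable]: "Y \<in> borel_measurable M"
    unfolding Y_def by measurable
  let ?err = "\<lambda>\<omega>. norm (A - fixed_rank_approx qr T A (\<Omega> \<omega>) (\<Psi> \<omega>))"
  have err: "fixed_rank_approx qr T A (\<Omega> \<omega>) (\<Psi> \<omega>) = Q (\<Omega> \<omega>) ** T (X (\<Omega> \<omega>) (\<Psi> \<omega>))" for \<omega>
    by (simp add: fixed_rank_approx_def sketch_X_def Q_def X_def)
  have err_meas: "?err \<in> borel_measurable M" unfolding err by measurable
  let ?fk = "1 + sketch_factor \<alpha> CARD('k) CARD('l)"
  have fk: "?fk \<ge> 0" using l by (simp add: sketch_factor_def)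
  have EY2: "(\<integral>\<^sup>+\<omega>. ennreal (Y \<omega> ^ 2) \<partial>M)
      \<le> ennreal (?fk * ((1 + sketch_factor \<alpha> \<rho> CARD('k)) * norm (A - B) ^ 2))"
    if \<rho>: "\<rho> + \<alpha> < CARD('k)" and B: "rank B \<le> \<rho>" for \<rho> B
  proof -
    have "(\<integral>\<^sup>+\<omega>. ennreal (Y \<omega> ^ 2) \<partial>M)
        = (\<integral>\<^sup>+x. \<integral>\<^sup>+y. ennreal (norm (A - Q x ** X x y) ^ 2) \<partial>distr M borel \<Psi> \<partial>distr M borel \<Omega>)"
      unfolding Y_def by (rule nn_integral_indep_borel[OF ind]) (unfold X_def, measurable)
    also have "\<dots> \<le> (\<integral>\<^sup>+x. ennreal (?fk * norm (A - Q x ** adjoint_matrix (Q x) ** A) ^ 2) \<partial>distr M borel \<Omega>)"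
      unfolding X_def by (intro nn_integral_mono nn_integral_sketch_le[OF \<Psi> \<alpha> l Q(1)])
    also have "\<dots> = ennreal ?fk * (\<integral>\<^sup>+x. ennreal (norm (A - Q x ** adjoint_matrix (Q x) ** A) ^ 2) \<partial>distr M borel \<Omega>)"
      using fk by (subst nn_integral_cmult[symmetric]) (auto simp: ennreal_mult')
    also have "\<dots> \<le> ennreal ?fk * ennreal ((1 + sketch_factor \<alpha> \<rho> CARD('k)) * norm (A - B) ^ 2)"
      by (intro mult_left_mono nn_integral_range_finder_le[OF \<Omega> \<alpha> B \<rho> Q]) simp
    also have "\<dots> = ennreal (?fk * ((1 + sketch_factor \<alpha> \<rho> CARD('k)) * norm (A - B) ^ 2))"
      using fk by (simp add: ennreal_mult')
    finally show ?thesis .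
  qed
  have EY: "integrable M Y" "expectation Y \<le> sqrt ?fk * (sqrt (1 + sketch_factor \<alpha> \<rho> CARD('k)) * tail_energy (\<rho> + 1) A)"
    if \<rho>: "\<rho> + \<alpha> < CARD('k)" for \<rho>
  proof -
    let ?f\<rho> = "1 + sketch_factor \<alpha> \<rho> CARD('k)"
    have f\<rho>: "?f\<rho> \<ge> 0" using \<rho> by (simp add: sketch_factor_def)
    have le: "expectation Y \<le> sqrt (?fk * (?f\<rho> * norm (A - B) ^ 2))" and "integrable M Y" if "rank B \<le> \<rho>" for B
      using expectation_le_sqrt[OF Y_meas EY2[OF \<rho> that]] fk f\<rho> by auto
    then show "integrable M Y" using rank_0_matrix le0 by metis
    have E0: "expectation Y \<ge> 0" by (rule Bochner_Integration.integral_nonneg) (simp add: Y_def)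
    \<comment> \<open>Squares are compared because the tail energy is a root of an infimum of
      squares.\<close>
    have "expectation Y ^ 2 \<le> (?fk * ?f\<rho>) * tail_energy (\<rho> + 1) A ^ 2"
    proof (rule le_mult_tail_energy_sq)
      fix B :: "'a1^'n^'m" assume "rank B \<le> \<rho>"
      from power_mono[OF le[OF this] E0, of 2]
      show "expectation Y ^ 2 \<le> (?fk * ?f\<rho>) * norm (A - B) ^ 2"
        using fk f\<rho> by (simp add: mult.assoc)
    qed (use fk f\<rho> in simp)
    also have "\<dots> = (sqrt ?fk * (sqrt ?f\<rho> * tail_energy (\<rho> + 1) A)) ^ 2"
      using fk f\<rho> by (simp add: power_mult_distrib)
    finally show "expectation Y \<le> sqrt ?fk * (sqrt ?f\<rho> * tail_energy (\<rho> + 1) A)"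
      using fk f\<rho> tail_energy_sq(2)[of \<rho> A] by (intro power2_le_imp_le[of "expectation Y"]) auto
  qed
  have Y_int: "integrable M Y" using EY(1)[of r] r by simp
  have err_le: "?err \<omega> \<le> tail_energy (r + 1) A + 2 * Y \<omega>" for \<omega>
    unfolding err Y_def using T by (intro norm_fixed_rank_le Q) (simp add: best_rank_selection_def)
  have bnd_int: "integrable M (\<lambda>\<omega>. tail_energy (r + 1) A + 2 * Y \<omega>)" using Y_int by simp
  show err_int: "integrable M ?err"
    by (rule Bochner_Integration.integrable_bound[OF bnd_int err_meas])
      (use order_trans[OF err_le abs_ge_self] in simp)
  let ?S = "{\<rho>. 1 \<le> \<rho> \<and> \<rho> + \<alpha> < CARD('k)}"
  let ?g = "\<lambda>\<rho>. sqrt (1 + sketch_factor \<alpha> \<rho> CARD('k)) * tail_energy (\<rho> + 1) A"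
  have "finite ?S" by (rule finite_subset[of _ "{..CARD('k)}"]) auto
  \<comment> \<open>The target rank itself is admissible, so the minimum is over a nonempty set and
    is attained.\<close>
  moreover have "r \<in> ?S" using r by simp
  ultimately have "Min (?g ` ?S) \<in> ?g ` ?S" by (intro Min_in) auto
  then obtain \<rho> where \<rho>: "\<rho> \<in> ?S" and min: "Min (?g ` ?S) = ?g \<rho>" by auto
  have "expectation ?err \<le> expectation (\<lambda>\<omega>. tail_energy (r + 1) A + 2 * Y \<omega>)"
    by (rule integral_mono[OF err_int bnd_int err_le])
  also have "\<dots> = tail_energy (r + 1) A + 2 * expectation Y"
    using Y_int by (simp add: prob_space)
  also have "\<dots> \<le> tail_energy (r + 1) A + 2 * (sqrt ?fk * ?g \<rho>)"
    using EY(2)[of \<rho>] \<rho> by simp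
  finally show "expectation ?err \<le> tail_energy (r + 1) A + 2 * sqrt ?fk * (MIN \<rho>\<in>?S. ?g \<rho>)"
    unfolding min by simp
qed

theorem corollary6p4:
  fixes M :: "'w measure" and r :: nat
  assumes "prob_space M"
    and "1 \<le> r" and "r \<le> min CARD('m::finite) CARD('n::finite)"
    and "CARD('k::{finite,linorder}) \<le> CARD('n)" and "CARD('l::finite) \<le> CARD('m)"
  shows
    "(\<forall>(A :: real^'n^'m) qr T (\<Omega> :: 'w \<Rightarrow> real^('k::{finite,linorder})^'n) (\<Psi> :: 'w \<Rightarrow> real^'m^'l).
        CARD('k) > r + 1 \<longrightarrow> CARD('l) > CARD('k) + 1 \<longrightarrow>
        qr_procedure qr \<longrightarrow> best_rank_selection r T \<longrightarrow>
        prob_space.real_std_normal_matrix M \<Omega> \<longrightarrow>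
        prob_space.real_std_normal_matrix M \<Psi> \<longrightarrow>
        prob_space.indep_borel M \<Omega> \<Psi> \<longrightarrow>
        integrable M (\<lambda>\<omega>. norm (A - fixed_rank_approx qr T A (\<Omega> \<omega>) (\<Psi> \<omega>))) \<and>
        prob_space.expectation M (\<lambda>\<omega>. norm (A - fixed_rank_approx qr T A (\<Omega> \<omega>) (\<Psi> \<omega>)))
          \<le> tail_energy (r + 1) A
            + 2 * sqrt (1 + sketch_factor 1 CARD('k) CARD('l))
              * (MIN \<rho>\<in>{\<rho>. 1 \<le> \<rho> \<and> \<rho> + 1 < CARD('k)}.
                   sqrt (1 + sketch_factor 1 \<rho> CARD('k)) * tail_energy (\<rho> + 1) A))
     \<and>
     (\<forall>(A :: complex^'n^'m) qr T (\<Omega> :: 'w \<Rightarrow> complex^('k::{finite,linorder})^'n) (\<Psi> :: 'w \<Rightarrow> complex^'m^'l).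
        CARD('k) > r + 0 \<longrightarrow> CARD('l) > CARD('k) + 0 \<longrightarrow>
        qr_procedure qr \<longrightarrow> best_rank_selection r T \<longrightarrow>
        prob_space.complex_std_normal_matrix M \<Omega> \<longrightarrow>
        prob_space.complex_std_normal_matrix M \<Psi> \<longrightarrow>
        prob_space.indep_borel M \<Omega> \<Psi> \<longrightarrow>
        integrable M (\<lambda>\<omega>. norm (A - fixed_rank_approx qr T A (\<Omega> \<omega>) (\<Psi> \<omega>))) \<and>
        prob_space.expectation M (\<lambda>\<omega>. norm (A - fixed_rank_approx qr T A (\<Omega> \<omega>) (\<Psi> \<omega>)))
          \<le> tail_energy (r + 1) A
            + 2 * sqrt (1 + sketch_factor 0 CARD('k) CARD('l))
              * (MIN \<rho>\<in>{\<rho>. 1 \<le> \<rho> \<and> \<rho> + 0 < CARD('k)}.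
                   sqrt (1 + sketch_factor 0 \<rho> CARD('k)) * tail_energy (\<rho> + 1) A))"
proof (intro conjI allI impI)
  interpret prob_space M by fact
  fix A :: "real^'n^'m"
    and qr :: "real^('k::{finite,linorder})^'m \<Rightarrow> real^('k::{finite,linorder})^'m"
    and T :: "real^'n^('k::{finite,linorder}) \<Rightarrow> real^'n^('k::{finite,linorder})"
    and \<Omega> :: "'w \<Rightarrow> real^('k::{finite,linorder})^'n" and \<Psi> :: "'w \<Rightarrow> real^'m^'l"
  assume *: "CARD('k) > r + 1" "CARD('l) > CARD('k) + 1" "qr_procedure qr" "best_rank_selection r T"
    "real_std_normal_matrix \<Omega>" "real_std_normal_matrix \<Psi>" "indep_borel \<Omega> \<Psi>"
  note bound = expectation_fixed_rank_error_le[OF field_defect_real assms(2) *(1-4)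
      standard_gaussian_real_std_normal_matrix(2)[OF *(5)]
      standard_gaussian_real_std_normal_matrix(2)[OF *(6)] *(7)]
  show "integrable M (\<lambda>\<omega>. norm (A - fixed_rank_approx qr T A (\<Omega> \<omega>) (\<Psi> \<omega>)))"
    by (rule bound)
  show "expectation (\<lambda>\<omega>. norm (A - fixed_rank_approx qr T A (\<Omega> \<omega>) (\<Psi> \<omega>)))
          \<le> tail_energy (r + 1) A
            + 2 * sqrt (1 + sketch_factor 1 CARD('k) CARD('l))
              * (MIN \<rho>\<in>{\<rho>. 1 \<le> \<rho> \<and> \<rho> + 1 < CARD('k)}.
                   sqrt (1 + sketch_factor 1 \<rho> CARD('k)) * tail_energy (\<rho> + 1) A)"
    by (rule bound)
next
  interpret prob_space M by fact
  fix A :: "complex^'n^'m"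
    and qr :: "complex^('k::{finite,linorder})^'m \<Rightarrow> complex^('k::{finite,linorder})^'m"
    and T :: "complex^'n^('k::{finite,linorder}) \<Rightarrow> complex^'n^('k::{finite,linorder})"
    and \<Omega> :: "'w \<Rightarrow> complex^('k::{finite,linorder})^'n" and \<Psi> :: "'w \<Rightarrow> complex^'m^'l"
  assume *: "CARD('k) > r + 0" "CARD('l) > CARD('k) + 0" "qr_procedure qr" "best_rank_selection r T"
    "complex_std_normal_matrix \<Omega>" "complex_std_normal_matrix \<Psi>" "indep_borel \<Omega> \<Psi>"
  note bound = expectation_fixed_rank_error_le[OF field_defect_complex assms(2) *(1-4)
      standard_gaussian_complex_std_normal_matrix(2)[OF *(5)]
      standard_gaussian_complex_std_normal_matrix(2)[OF *(6)] *(7)]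
  show "integrable M (\<lambda>\<omega>. norm (A - fixed_rank_approx qr T A (\<Omega> \<omega>) (\<Psi> \<omega>)))"
    by (rule bound)
  show "expectation (\<lambda>\<omega>. norm (A - fixed_rank_approx qr T A (\<Omega> \<omega>) (\<Psi> \<omega>)))
          \<le> tail_energy (r + 1) A
            + 2 * sqrt (1 + sketch_factor 0 CARD('k) CARD('l))
              * (MIN \<rho>\<in>{\<rho>. 1 \<le> \<rho> \<and> \<rho> + 0 < CARD('k)}.
                   sqrt (1 + sketch_factor 0 \<rho> CARD('k)) * tail_energy (\<rho> + 1) A)"
    by (rule bound)
qed

end
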